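(* Let $0<q\le 1$ and suppose that $\mathcal{A}$ is a proper $q$-Banach subalgebra of $\mathcal{B}(\ell^2(\mathbb{G}))$, that $A,B,Q,R\in\mathcal{A}$, and that $Q$ and $R$ are positive and strictly positive on $\ell^2(\mathbb{G})$, respectively. Assume that $(A,B)$ is approximately controllable and $(A,Q^{1/2})$ is exponentially detectable. Then the unique positive definite solution $X\in\mathcal{B}(\ell^2(\mathbb{G}))$ of the Riccati equation $$A^*X+XA-XBR^{-1}B^*X+Q=0$$ satisfies $X\in\mathcal{A}$, and $A_X=A-BR^{-1}B^*X$ is exponentially stable on $\mathcal{A}$.
   Context: $\mathbb{G}\subset\mathbb{Z}^d$ ($d\ge 1$) is the discrete spatial domain, and $\mathcal{B}(\ell^2(\mathbb{G}))$ is the Banach algebra of bounded linear operators on $\ell^2(\mathbb{G})$, identified with (infinite) matrices indexed by $\mathbb{G}\times\mathbb{G}$. An operator $Q$ is positive if it is self-adjoint with $\langle Qx,x\rangle\ge 0$ for all $x$; it is strictly positive if it is self-adjoint and $\langle Qx,x\rangle\ge c\|x\|_2^2$ for some $c>0$ and all $x$. A matrix $A$ in $\mathcal{A}$ (or in $\mathcal{B}(\ell^2(\mathbb{G}))$) is exponentially stable on $\mathcal{A}$ (resp. on $\mathcal{B}(\ell^2(\mathbb{G}))$) if there are $E,\alpha>0$ with $\|e^{tA}\|\le Ee^{-\alpha t}$ for all $t\ge 0$ in the corresponding ($q$-)norm. $(A,C)$ is exponentially detectable if $A+LC$ is exponentially stable on $\mathcal{B}(\ell^2(\mathbb{G}))$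 for some bounded $L$. $(A,B)$ (the system $\dot x=Ax+Bu$) is approximately controllable if its reachable subspace $$\mathfrak{R}=\Big\{z\in\ell^2(\mathbb{G})\ \Big|\ \exists\,T>0,\ u\in L^2([0,T];\ell^2(\mathbb{G}))\ \text{s.t.}\ z=\int_0^T e^{A(T-\tau)}Bu(\tau)\,d\tau\Big\}$$ is dense in $\ell^2(\mathbb{G})$. The paper takes existence and uniqueness of the positive definite (strictly positive) solution $X$ from classical LQR theory. For $0<q\le 1$, a complex vector space $\mathcal{A}$ of matrices is a $q$-Banach space with $q$-norm $\|\cdot\|_{\mathcal{A}}$ if it is complete with respect to the metric $d(A,B)=\|A-B\|_{\mathcal{A}}^q$ and, for all $A,B\in\mathcal{A}$, $\alpha\in\mathbb{C}$: (i) $\|A\|_{\mathcal{A}}\ge 0$, with equality iff $A=0$; (ii) $\|\alpha A\|_{\mathcal{A}}=|\alpha|\,\|A\|_{\mathcal{A}}$; (iii) $\|A+B\|_{\mathcal{A}}^q\le\|A\|_{\mathcal{A}}^q+\|B\|_{\mathcal{A}}^q$. A $q$-Banach space $\mathcal{A}$ is a $q$-Banach algebra if it contains the unit element $I$, with $M:=\|I\|_{\mathcal{A}}<\infty$, and there is a constant $K_0>0$ with (iv) $AB\in\mathcal{A}$ and $\|AB\|_{\mathcal{A}}\le K_0\|A\|_{\mathcal{A}}\|B\|_{\mathcal{A}}$ for all $A,B\in\mathcal{A}$. A $q$-Banach algebra $\mathcal{A}$ of matrices on $\mathbb{G}$ is proper (a proper $q$-Banach subalgebra of $\mathcal{B}(\ell^2(\mathbb{G}))$)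 if: (P1) $A^*\in\mathcal{A}$ and $\|A^*\|_{\mathcal{A}}=\|A\|_{\mathcal{A}}$ for all $A\in\mathcal{A}$; (P2) $\mathcal{A}$ is a subalgebra of $\mathcal{B}(\ell^2(\mathbb{G}))$ and $\|A\|_{\mathcal{B}(\ell^2(\mathbb{G}))}\le\|A\|_{\mathcal{A}}$ for all $A\in\mathcal{A}$; (P3) $\mathcal{A}$ is a differential subalgebra of $\mathcal{B}=\mathcal{B}(\ell^2(\mathbb{G}))$ of some order $\theta\in(0,1]$: there is a constant $D>0$ such that for all $A,B\in\mathcal{A}$, $$\|AB\|_{\mathcal{A}}^q\le D\,\|A\|_{\mathcal{A}}^q\|B\|_{\mathcal{A}}^q\left(\Big(\tfrac{\|A\|_{\mathcal{B}}}{\|A\|_{\mathcal{A}}}\Big)^{q\theta}+\Big(\tfrac{\|B\|_{\mathcal{B}}}{\|B\|_{\mathcal{A}}}\Big)^{q\theta}\right)$$ (right side read as $0$ if $A=0$ or $B=0$).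
   Formalization: Existence of the positive definite solution X is assumed, not proved, since it can fail under the stated hypotheses (e.g. scalars A=-1, B=R=1, Q=0, where the solutions are 0 and -2); its uniqueness, X∈𝒜 and exponential stability of A_X on 𝒜 are what is claimed. *)

theory Defs
  imports "HOL-Analysis.Analysis"
begin

section \<open>The Hilbert space of square-summable families\<close>

class scaleC =
  fixes scaleC :: "complex \<Rightarrow> 'a \<Rightarrow> 'a" (infixr "*\<^sub>C" 75)

typedef 'i ell2 = "{x :: 'i \<Rightarrow> complex. (\<lambda>i. (cmod (x i))\<^sup>2) summable_on UNIV}"
  morphisms coord Abs_ell2
  by (rule exI[of _ "\<lambda>_. 0"]) auto

setup_lifting type_definition_ell2

lemma coord_summable: "(\<lambda>i. (cmod (coord x i))\<^sup>2) summable_on UNIV"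
  using coord[of x] by simp

lemma ell2_eqI: "(\<And>i. coord x i = coord y i) \<Longrightarrow> x = y"
  by (simp add: coord_inject[symmetric] fun_eq_iff)

lemma summable_square_add:
  fixes x y :: "'i \<Rightarrow> complex"
  assumes "(\<lambda>i. (cmod (x i))\<^sup>2) summable_on UNIV" "(\<lambda>i. (cmod (y i))\<^sup>2) summable_on UNIV"
  shows "(\<lambda>i. (cmod (x i + y i))\<^sup>2) summable_on UNIV"
proof (rule summable_on_comparison_test)
  show "(\<lambda>i. 2 * (cmod (x i))\<^sup>2 + 2 * (cmod (y i))\<^sup>2) summable_on UNIV"
    using assms by (intro summable_on_add summable_on_cmult_right)
next
  fix i
  have "(cmod (x i + y i))\<^sup>2 \<le> (cmod (x i) + cmod (y i))\<^sup>2"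
    by (intro power_mono norm_triangle_ineq) auto
  also have "\<dots> \<le> 2 * (cmod (x i))\<^sup>2 + 2 * (cmod (y i))\<^sup>2"
    using sum_squares_bound[of "cmod (x i)" "cmod (y i)"] by (simp add: power2_sum)
  finally show "(cmod (x i + y i))\<^sup>2 \<le> 2 * (cmod (x i))\<^sup>2 + 2 * (cmod (y i))\<^sup>2" .
qed auto

lemma summable_square_cmult:
  fixes x :: "'i \<Rightarrow> complex"
  assumes "(\<lambda>i. (cmod (x i))\<^sup>2) summable_on UNIV"
  shows "(\<lambda>i. (cmod (c * x i))\<^sup>2) summable_on UNIV"
  using assms by (simp add: norm_mult power_mult_distrib summable_on_cmult_right)

lemma abs_summable_coord_mult:
  "(\<lambda>i. norm (coord x i * cnj (coord y i))) summable_on UNIV"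
proof (rule summable_on_comparison_test)
  show "(\<lambda>i. (cmod (coord x i))\<^sup>2 + (cmod (coord y i))\<^sup>2) summable_on UNIV"
    by (intro summable_on_add coord_summable)
next
  fix i
  have "2 * (cmod (coord x i) * cmod (coord y i)) \<le> (cmod (coord x i))\<^sup>2 + (cmod (coord y i))\<^sup>2"
    using sum_squares_bound[of "cmod (coord x i)" "cmod (coord y i)"] by (simp add: mult.assoc)
  moreover have "0 \<le> cmod (coord x i) * cmod (coord y i)"
    by simp
  ultimately show "norm (coord x i * cnj (coord y i)) \<le> (cmod (coord x i))\<^sup>2 + (cmod (coord y i))\<^sup>2"
    unfolding norm_mult complex_mod_cnj by linarith
qed auto

lemmas summable_coord_mult = abs_summable_summable[OF abs_summable_coord_mult]

instantiation ell2 :: (type) real_inner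
begin

lift_definition zero_ell2 :: "'a ell2" is "\<lambda>_. 0"
  by simp

lift_definition plus_ell2 :: "'a ell2 \<Rightarrow> 'a ell2 \<Rightarrow> 'a ell2" is "\<lambda>x y i. x i + y i"
  by (rule summable_square_add)

lift_definition uminus_ell2 :: "'a ell2 \<Rightarrow> 'a ell2" is "\<lambda>x i. - x i"
  by simp

definition minus_ell2 :: "'a ell2 \<Rightarrow> 'a ell2 \<Rightarrow> 'a ell2" where
  "minus_ell2 x y = x + - y"

lift_definition scaleR_ell2 :: "real \<Rightarrow> 'a ell2 \<Rightarrow> 'a ell2" is "\<lambda>r x i. complex_of_real r * x i"
  by (rule summable_square_cmult)

definition inner_ell2 :: "'a ell2 \<Rightarrow> 'a ell2 \<Rightarrow> real" where
  "inner_ell2 x y = (\<Sum>\<^sub>\<infinity>i. Re (coord x i * cnj (coord y i)))"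

definition norm_ell2 :: "'a ell2 \<Rightarrow> real" where
  "norm_ell2 x = sqrt (\<Sum>\<^sub>\<infinity>i. (cmod (coord x i))\<^sup>2)"

definition dist_ell2 :: "'a ell2 \<Rightarrow> 'a ell2 \<Rightarrow> real" where
  "dist_ell2 x y = norm (x - y)"

definition sgn_ell2 :: "'a ell2 \<Rightarrow> 'a ell2" where
  "sgn_ell2 x = inverse (norm x) *\<^sub>R x"

definition uniformity_ell2 :: "('a ell2 \<times> 'a ell2) filter" where
  "uniformity_ell2 = (INF e\<in>{0 <..}. principal {(x, y). dist x y < e})"

definition open_ell2 :: "'a ell2 set \<Rightarrow> bool" where
  "open_ell2 U = (\<forall>x\<in>U. eventually (\<lambda>(x', y). x' = x \<longrightarrow> y \<in> U) uniformity)"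

instance
proof
  fix x y z :: "'a ell2" and a b :: real
  show "x + y + z = x + (y + z)" by transfer (simp add: add.assoc)
  show "x + y = y + x" by transfer (simp add: add.commute)
  show "0 + x = x" by transfer simp
  show "- x + x = 0" by transfer simp
  show "x - y = x + - y" by (rule minus_ell2_def)
  show "a *\<^sub>R (x + y) = a *\<^sub>R x + a *\<^sub>R y" by transfer (simp add: algebra_simps)
  show "(a + b) *\<^sub>R x = a *\<^sub>R x + b *\<^sub>R x" by transfer (simp add: algebra_simps)
  show "a *\<^sub>R b *\<^sub>R x = (a * b) *\<^sub>R x" by transfer (simp add: algebra_simps)
  show "1 *\<^sub>R x = x" by transfer simp
  show "dist x y = norm (x - y)" by (rule dist_ell2_def)
  show "sgn x = inverse (norm x) *\<^sub>R x" by (rule sgn_ell2_def)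
  show "uniformity = (INF e\<in>{0 <..}. principal {(x, y :: 'a ell2). dist x y < e})"
    by (rule uniformity_ell2_def)
  show "open U = (\<forall>x\<in>U. eventually (\<lambda>(x', y). x' = x \<longrightarrow> y \<in> U) uniformity)" for U :: "'a ell2 set"
    by (rule open_ell2_def)
  have summ: "(\<lambda>i. Re (coord x i * cnj (coord y i))) summable_on UNIV" for x y :: "'a ell2"
    using summable_coord_mult by (rule summable_on_Re)
  have sq: "inner x x = (\<Sum>\<^sub>\<infinity>i. (cmod (coord x i))\<^sup>2)" for x :: "'a ell2"
    unfolding inner_ell2_def by (simp only: complex_norm_square[symmetric] Re_complex_of_real)
  show "inner x y = inner y x"
    unfolding inner_ell2_def by (simp add: mult.commute)
  have "inner (x + y) z = (\<Sum>\<^sub>\<infinity>i. Re (coord x i * cnj (coord z i)) + Re (coord y i * cnj (coord z i)))"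
    unfolding inner_ell2_def by (simp add: plus_ell2.rep_eq distrib_right)
  then show "inner (x + y) z = inner x z + inner y z"
    unfolding inner_ell2_def by (simp only: infsum_add[OF summ summ])
  have "inner (a *\<^sub>R x) y = (\<Sum>\<^sub>\<infinity>i. a * Re (coord x i * cnj (coord y i)))"
    unfolding inner_ell2_def by (simp add: scaleR_ell2.rep_eq right_diff_distrib mult.assoc)
  then show "inner (a *\<^sub>R x) y = a * inner x y"
    unfolding inner_ell2_def by (simp only: infsum_cmult_right')
  show "0 \<le> inner x x"
    unfolding sq by (rule infsum_nonneg) simp
  show "inner x x = 0 \<longleftrightarrow> x = 0"
  proof
    assume "inner x x = 0"
    then have "(cmod (coord x i))\<^sup>2 = 0" for i
      unfolding sq by (intro nonneg_infsum_le_0D[OF _ coord_summable, where x = i]) auto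
    then show "x = 0"
      by (intro ell2_eqI) (simp add: zero_ell2.rep_eq)
  next
    assume "x = 0"
    then show "inner x x = 0"
      unfolding inner_ell2_def by (simp add: zero_ell2.rep_eq)
  qed
  show "norm x = sqrt (inner x x)"
    unfolding sq by (rule norm_ell2_def)
qed

end

lemmas coord_simps [simp] = zero_ell2.rep_eq plus_ell2.rep_eq uminus_ell2.rep_eq scaleR_ell2.rep_eq

lemma coord_diff [simp]: "coord (x - y) i = coord x i - coord y i"
  unfolding minus_ell2_def coord_simps by (rule diff_conv_add_uminus[symmetric])

lemma norm_ell2_square: "(norm x)\<^sup>2 = (\<Sum>\<^sub>\<infinity>i. (cmod (coord x i))\<^sup>2)"
  unfolding norm_ell2_def by (simp add: infsum_nonneg)

lemma sum_coord_le_norm_square: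
  "finite F \<Longrightarrow> (\<Sum>i\<in>F. (cmod (coord x i))\<^sup>2) \<le> (norm x)\<^sup>2"
  unfolding norm_ell2_square by (rule finite_sum_le_infsum[OF coord_summable]) auto

lemma cmod_coord_le_norm: "cmod (coord x i) \<le> norm x"
  by (rule power2_le_imp_le) (use sum_coord_le_norm_square[of "{i}" x] in simp_all)

instance ell2 :: (type) banach
proof
  fix X :: "nat \<Rightarrow> 'a ell2"
  assume "Cauchy X"
  then have X: "\<exists>N. \<forall>m\<ge>N. \<forall>n\<ge>N. norm (X m - X n) < e" if "e > 0" for e
    using that by (simp add: Cauchy_iff)
  have "Cauchy (\<lambda>n. coord (X n) i)" for i
    unfolding Cauchy_iff
  proof (intro allI impI)
    fix e :: real
    assume "e > 0"
    then obtain N where N: "\<forall>m\<ge>N. \<forall>n\<ge>N. norm (X m - X n) < e"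
      using X by blast
    have "norm (coord (X m) i - coord (X n) i) < e" if "m \<ge> N" "n \<ge> N" for m n
      using cmod_coord_le_norm[of "X m - X n" i] N that by (simp add: le_less_trans)
    then show "\<exists>N. \<forall>m\<ge>N. \<forall>n\<ge>N. norm (coord (X m) i - coord (X n) i) < e"
      by (intro exI[of _ N]) simp
  qed
  then have "convergent (\<lambda>n. coord (X n) i)" for i
    by (rule Cauchy_convergent)
  then have l: "(\<lambda>n. coord (X n) i) \<longlonglongrightarrow> lim (\<lambda>n. coord (X n) i)" for i
    by (simp add: convergent_LIMSEQ_iff)
  define l where "l i = lim (\<lambda>n. coord (X n) i)" for i
  note l = l[folded l_def]
  have bound: "(\<Sum>i\<in>F. (cmod (coord (X n) i - l i))\<^sup>2) \<le> e\<^sup>2"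
    if "finite F" and N: "\<forall>m\<ge>N. norm (X n - X m) < e" for F e n N
  proof (rule LIMSEQ_le_const2)
    show "(\<lambda>m. \<Sum>i\<in>F. (cmod (coord (X n) i - coord (X m) i))\<^sup>2) \<longlonglongrightarrow>
        (\<Sum>i\<in>F. (cmod (coord (X n) i - l i))\<^sup>2)"
      by (intro tendsto_intros l)
    show "\<exists>M. \<forall>m\<ge>M. (\<Sum>i\<in>F. (cmod (coord (X n) i - coord (X m) i))\<^sup>2) \<le> e\<^sup>2"
    proof (intro exI allI impI)
      fix m assume "N \<le> m"
      have "(\<Sum>i\<in>F. (cmod (coord (X n - X m) i))\<^sup>2) \<le> (norm (X n - X m))\<^sup>2"
        by (rule sum_coord_le_norm_square[OF \<open>finite F\<close>])
      also have "\<dots> \<le> e\<^sup>2"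
        using N \<open>N \<le> m\<close> by (intro power_mono) (auto intro: less_imp_le)
      finally show "(\<Sum>i\<in>F. (cmod (coord (X n) i - coord (X m) i))\<^sup>2) \<le> e\<^sup>2"
        by simp
    qed
  qed
  have summ: "(\<lambda>i. (cmod (coord (X n) i - l i))\<^sup>2) summable_on UNIV"
    if "\<forall>m\<ge>N. norm (X n - X m) < e" for e n N
    using bound[OF _ that]
    by (intro nonneg_bdd_above_summable_on bdd_aboveI2[where M = "e\<^sup>2"]) auto
  obtain N0 where N0: "\<forall>m\<ge>N0. norm (X N0 - X m) < 1"
    using X[of 1] by auto
  have "(\<lambda>i. (cmod (coord (X N0) i + (-1) * (coord (X N0) i - l i)))\<^sup>2) summable_on UNIV"
    by (intro summable_square_add summable_square_cmult coord_summable summ[OF N0])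
  then have "(\<lambda>i. (cmod (l i))\<^sup>2) summable_on UNIV"
    by simp
  then have coord_L: "coord (Abs_ell2 l) = l"
    by (simp add: Abs_ell2_inverse)
  have "X \<longlonglongrightarrow> Abs_ell2 l"
  proof (rule LIMSEQ_I)
    fix r :: real
    assume "r > 0"
    then obtain N where N: "\<forall>m\<ge>N. \<forall>n\<ge>N. norm (X m - X n) < r / 2"
      using X[of "r / 2"] by auto
    have "norm (X n - Abs_ell2 l) < r" if "n \<ge> N" for n
    proof -
      have n: "\<forall>m\<ge>N. norm (X n - X m) < r / 2"
        using N that by blast
      have "(norm (X n - Abs_ell2 l))\<^sup>2 \<le> (r / 2)\<^sup>2"
        unfolding norm_ell2_square coord_diff coord_L
        by (rule infsum_le_finite_sums[OF summ[OF n]]) (rule bound[OF _ n])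
      then have "norm (X n - Abs_ell2 l) \<le> r / 2"
        by (rule power2_le_imp_le) (use \<open>r > 0\<close> in simp)
      then show ?thesis
        using \<open>r > 0\<close> by linarith
    qed
    then show "\<exists>no. \<forall>n\<ge>no. norm (X n - Abs_ell2 l) < r"
      by blast
  qed
  then show "convergent X"
    by (rule convergentI)
qed

instance ell2 :: (countable) second_countable_topology
proof
  define cpx where "cpx = (\<lambda>(p, q). Complex (real_of_rat p) (real_of_rat q))"
  have cpx: "\<exists>r. cmod (z - cpx r) < e" if "e > 0" for z e
  proof -
    obtain p where p: "Re z < real_of_rat p" "real_of_rat p < Re z + e / 2"
      using of_rat_dense[of "Re z" "Re z + e / 2"] \<open>e > 0\<close> by auto
    obtain q where q: "Im z < real_of_rat q" "real_of_rat q < Im z + e / 2"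
      using of_rat_dense[of "Im z" "Im z + e / 2"] \<open>e > 0\<close> by auto
    have "cmod (z - cpx (p, q)) \<le> \<bar>Re (z - cpx (p, q))\<bar> + \<bar>Im (z - cpx (p, q))\<bar>"
      by (rule cmod_le)
    also have "\<dots> < e"
      using p q by (simp add: cpx_def)
    finally show ?thesis
      by blast
  qed
  define fin :: "('a \<times> rat \<times> rat) list \<Rightarrow> 'a \<Rightarrow> complex" where
    "fin xs i = (case map_of xs i of None \<Rightarrow> 0 | Some r \<Rightarrow> cpx r)" for xs i
  have coord_fin: "coord (Abs_ell2 (fin xs)) = fin xs" for xs
  proof -
    have "finite {i. fin xs i \<noteq> 0}"
      by (rule finite_subset[OF _ finite_dom_map_of[of xs]])
        (auto simp: fin_def dom_def split: option.splits)
    then have "(\<lambda>i. (cmod (fin xs i))\<^sup>2) summable_on UNIV"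
      by (subst summable_on_cong_neutral[where T = "{i. fin xs i \<noteq> 0}"
            and g = "\<lambda>i. (cmod (fin xs i))\<^sup>2"]) auto
    then show ?thesis
      by (simp add: Abs_ell2_inverse)
  qed
  define D where "D = range (\<lambda>xs. Abs_ell2 (fin xs))"
  have dense: "\<exists>d\<in>D. norm (x - d) < e" if "e > 0" for x :: "'a ell2" and e
  proof -
    define h where "h = e\<^sup>2 / 4"
    have "h > 0"
      using \<open>e > 0\<close> by (simp add: h_def)
    obtain F where F: "finite F" "dist (\<Sum>i\<in>F. (cmod (coord x i))\<^sup>2) ((norm x)\<^sup>2) \<le> h"
      using infsum_finite_approximation[OF coord_summable \<open>h > 0\<close>, of x]
      unfolding norm_ell2_square by blast
    define c where "c = sqrt (h / (real (card F) + 1))"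
    have "c > 0"
      using \<open>h > 0\<close> by (simp add: c_def)
    have c2: "c\<^sup>2 = h / (real (card F) + 1)"
      using \<open>h > 0\<close> by (simp add: c_def)
    have "\<forall>i. \<exists>r. cmod (coord x i - cpx r) < c"
      using cpx \<open>c > 0\<close> by blast
    then obtain r where r: "\<And>i. cmod (coord x i - cpx (r i)) < c"
      by metis
    obtain ys where ys: "set ys = F"
      using finite_list[OF F(1)] by blast
    define xs where "xs = map (\<lambda>i. (i, r i)) ys"
    have fin: "fin xs i = (if i \<in> F then cpx (r i) else 0)" for i
      unfolding fin_def xs_def map_of_map_restrict ys[symmetric]
      by (simp add: restrict_map_def)
    have "(\<Sum>i\<in>H. (cmod (coord (x - Abs_ell2 (fin xs)) i))\<^sup>2) \<le> 2 * h" if "finite H" for H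
    proof -
      have "(\<Sum>i\<in>H. (cmod (coord (x - Abs_ell2 (fin xs)) i))\<^sup>2) \<le>
          (\<Sum>i\<in>F \<union> H. (cmod (coord (x - Abs_ell2 (fin xs)) i))\<^sup>2)"
        using F(1) that by (intro sum_mono2) auto
      also have "\<dots> = (\<Sum>i\<in>F. (cmod (coord x i - cpx (r i)))\<^sup>2) + (\<Sum>i\<in>H - F. (cmod (coord x i))\<^sup>2)"
        using F(1) that
        by (subst Un_Diff_cancel[symmetric], subst sum.union_disjoint)
          (auto simp: coord_fin fin intro!: arg_cong2[where f = plus] sum.cong)
      also have "(\<Sum>i\<in>F. (cmod (coord x i - cpx (r i)))\<^sup>2) \<le> (\<Sum>i\<in>F. c\<^sup>2)"
        by (intro sum_mono power_mono less_imp_le[OF r]) auto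
      also have "(\<Sum>i\<in>F. c\<^sup>2) \<le> h"
        using \<open>h > 0\<close> by (simp add: c2 field_simps)
      also have "(\<Sum>i\<in>H - F. (cmod (coord x i))\<^sup>2) \<le> h"
      proof -
        have "(\<Sum>i\<in>F. (cmod (coord x i))\<^sup>2) + (\<Sum>i\<in>H - F. (cmod (coord x i))\<^sup>2)
            = (\<Sum>i\<in>F \<union> (H - F). (cmod (coord x i))\<^sup>2)"
          using F(1) that by (intro sum.union_disjoint[symmetric]) auto
        also have "\<dots> \<le> (norm x)\<^sup>2"
          using F(1) that by (intro sum_coord_le_norm_square) auto
        finally show ?thesis
          using F(2) by (simp add: dist_real_def)
      qed
      finally show ?thesis
        by simp
    qed
    then have "(norm (x - Abs_ell2 (fin xs)))\<^sup>2 \<le> 2 * h"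
      unfolding norm_ell2_square by (intro infsum_le_finite_sums coord_summable) auto
    also have "2 * h < e\<^sup>2"
      using \<open>e > 0\<close> by (simp add: h_def)
    finally have "norm (x - Abs_ell2 (fin xs)) < e"
      by (rule power2_less_imp_less) (use \<open>e > 0\<close> in simp)
    then show ?thesis
      by (auto simp: D_def)
  qed
  define B where "B = (\<lambda>(d, n). ball d (1 / real (Suc n))) ` (D \<times> (UNIV :: nat set))"
  have "topological_basis B"
  proof (rule topological_basisI)
    show "open U" if "U \<in> B" for U
      using that by (auto simp: B_def)
  next
    fix U and x :: "'a ell2"
    assume "open U" "x \<in> U"
    then obtain e where e: "e > 0" "ball x e \<subseteq> U"
      by (meson openE)
    obtain n where n: "1 / real (Suc n) < e / 2"
      using nat_approx_posE[of "e / 2"] e(1) by auto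
    obtain d where d: "d \<in> D" "norm (x - d) < 1 / real (Suc n)"
      using dense[of "1 / real (Suc n)" x] by auto
    have "ball d (1 / real (Suc n)) \<subseteq> ball x e"
    proof
      fix y
      assume "y \<in> ball d (1 / real (Suc n))"
      then have "dist d y < e / 2"
        using n by simp
      moreover have "dist x d < e / 2"
        using d(2) n by (simp add: dist_norm)
      ultimately show "y \<in> ball x e"
        using dist_triangle[of x y d] by simp
    qed
    moreover have "x \<in> ball d (1 / real (Suc n))"
      using d(2) by (simp add: dist_norm norm_minus_commute)
    moreover have "ball d (1 / real (Suc n)) \<in> B"
      unfolding B_def using d(1) by (intro image_eqI[of _ _ "(d, n)"]) auto
    ultimately show "\<exists>B'\<in>B. x \<in> B' \<and> B' \<subseteq> U"
      using e(2) by blast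
  qed
  moreover have "countable B"
    unfolding B_def D_def by (intro countable_image countable_SIGMA) auto
  ultimately show "\<exists>B :: 'a ell2 set set. countable B \<and> open = generate_topology B"
    using topological_basis_imp_subbasis by blast
qed

instantiation ell2 :: (type) scaleC
begin

lift_definition scaleC_ell2 :: "complex \<Rightarrow> 'a ell2 \<Rightarrow> 'a ell2" is "\<lambda>c x i. c * x i"
  by (rule summable_square_cmult)

instance ..

end

definition cinner :: "'i ell2 \<Rightarrow> 'i ell2 \<Rightarrow> complex" where
  "cinner x y = (\<Sum>\<^sub>\<infinity>i. coord x i * cnj (coord y i))"

lemma scaleC_add: "c *\<^sub>C (x + y) = c *\<^sub>C x + c *\<^sub>C (y :: 'i ell2)"
  by (rule ell2_eqI) (simp add: scaleC_ell2.rep_eq distrib_left)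

lemma scaleC_scaleR: "c *\<^sub>C (r *\<^sub>R x) = r *\<^sub>R (c *\<^sub>C (x :: 'i ell2))"
  by (rule ell2_eqI) (simp add: scaleC_ell2.rep_eq)

lemma scaleC_scaleC: "c *\<^sub>C (d *\<^sub>C x) = d *\<^sub>C (c *\<^sub>C (x :: 'i ell2))"
  by (rule ell2_eqI) (simp add: scaleC_ell2.rep_eq)

lemma norm_scaleC: "norm (c *\<^sub>C x) = cmod c * norm (x :: 'i ell2)"
proof (rule power2_eq_imp_eq)
  show "(norm (c *\<^sub>C x))\<^sup>2 = (cmod c * norm x)\<^sup>2"
    by (simp add: norm_ell2_square power_mult_distrib scaleC_ell2.rep_eq norm_mult infsum_cmult_right')
qed auto

lemma bounded_linear_scaleC: "bounded_linear (\<lambda>x :: 'i ell2. c *\<^sub>C x)"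
  by (rule bounded_linear_intro[where K = "cmod c"])
    (simp_all add: scaleC_add scaleC_scaleR norm_scaleC mult.commute)

section \<open>Bounded complex-linear operators\<close>

typedef 'i ell2_op = "{T :: 'i ell2 \<Rightarrow>\<^sub>L 'i ell2. \<forall>c x. blinfun_apply T (c *\<^sub>C x) = c *\<^sub>C blinfun_apply T x}"
  morphisms blinfun_of Abs_ell2_op
  by (rule exI[of _ 0]) (auto intro!: ell2_eqI simp: scaleC_ell2.rep_eq)

setup_lifting type_definition_ell2_op

definition app :: "'i ell2_op \<Rightarrow> 'i ell2 \<Rightarrow> 'i ell2" (infixr "\<cdot>" 75) where
  "T \<cdot> x = blinfun_apply (blinfun_of T) x"

lemma blinfun_of_scaleC: "blinfun_apply (blinfun_of T) (c *\<^sub>C x) = c *\<^sub>C blinfun_apply (blinfun_of T) x"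
  using blinfun_of[of T] by simp

instantiation ell2_op :: (type) "{real_normed_algebra_1, scaleC}"
begin

lift_definition zero_ell2_op :: "'a ell2_op" is 0
  by (auto intro!: ell2_eqI simp: scaleC_ell2.rep_eq)

lift_definition one_ell2_op :: "'a ell2_op" is id_blinfun
  by simp

lift_definition plus_ell2_op :: "'a ell2_op \<Rightarrow> 'a ell2_op \<Rightarrow> 'a ell2_op" is "(+)"
  by (simp add: blinfun.add_left scaleC_add)

lift_definition minus_ell2_op :: "'a ell2_op \<Rightarrow> 'a ell2_op \<Rightarrow> 'a ell2_op" is "(-)"
  by (auto intro!: ell2_eqI simp: blinfun.diff_left scaleC_ell2.rep_eq right_diff_distrib)

lift_definition uminus_ell2_op :: "'a ell2_op \<Rightarrow> 'a ell2_op" is uminus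
  by (auto intro!: ell2_eqI simp: blinfun.minus_left scaleC_ell2.rep_eq)

lift_definition times_ell2_op :: "'a ell2_op \<Rightarrow> 'a ell2_op \<Rightarrow> 'a ell2_op" is "(o\<^sub>L)"
  by simp

lift_definition scaleR_ell2_op :: "real \<Rightarrow> 'a ell2_op \<Rightarrow> 'a ell2_op" is scaleR
  by (simp add: blinfun.scaleR_left scaleC_scaleR)

lift_definition scaleC_ell2_op :: "complex \<Rightarrow> 'a ell2_op \<Rightarrow> 'a ell2_op" is
  "\<lambda>c T. blinfun_compose (Blinfun (scaleC c)) T"
  by (simp add: bounded_linear_Blinfun_apply[OF bounded_linear_scaleC] scaleC_scaleC)

lift_definition norm_ell2_op :: "'a ell2_op \<Rightarrow> real" is norm .

definition dist_ell2_op :: "'a ell2_op \<Rightarrow> 'a ell2_op \<Rightarrow> real" where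
  "dist_ell2_op S T = norm (S - T)"

definition sgn_ell2_op :: "'a ell2_op \<Rightarrow> 'a ell2_op" where
  "sgn_ell2_op T = inverse (norm T) *\<^sub>R T"

definition uniformity_ell2_op :: "('a ell2_op \<times> 'a ell2_op) filter" where
  "uniformity_ell2_op = (INF e\<in>{0 <..}. principal {(x, y). dist x y < e})"

definition open_ell2_op :: "'a ell2_op set \<Rightarrow> bool" where
  "open_ell2_op U = (\<forall>x\<in>U. eventually (\<lambda>(x', y). x' = x \<longrightarrow> y \<in> U) uniformity)"

instance
proof
  fix R S T :: "'a ell2_op" and a b :: real
  show "R + S + T = R + (S + T)" by transfer (simp add: add.assoc)
  show "R + S = S + R" by transfer (simp add: add.commute)
  show "0 + R = R" by transfer simp
  show "- R + R = 0" by transfer simp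
  show "R - S = R + - S" by transfer simp
  show "a *\<^sub>R (R + S) = a *\<^sub>R R + a *\<^sub>R S" by transfer (simp add: algebra_simps)
  show "(a + b) *\<^sub>R R = a *\<^sub>R R + b *\<^sub>R R" by transfer (simp add: algebra_simps)
  show "a *\<^sub>R b *\<^sub>R R = (a * b) *\<^sub>R R" by transfer simp
  show "1 *\<^sub>R R = R" by transfer simp
  show "R * S * T = R * (S * T)" by transfer (auto intro!: blinfun_eqI)
  show "(R + S) * T = R * T + S * T"
    by transfer (auto intro!: blinfun_eqI simp: blinfun.add_left)
  show "R * (S + T) = R * S + R * T"
    by transfer (auto intro!: blinfun_eqI simp: blinfun.add_left blinfun.add_right)
  show "a *\<^sub>R R * S = a *\<^sub>R (R * S)"
    by transfer (auto intro!: blinfun_eqI simp: blinfun.scaleR_left)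
  show "R * a *\<^sub>R S = a *\<^sub>R (R * S)"
    by transfer (auto intro!: blinfun_eqI simp: blinfun.scaleR_left blinfun.scaleR_right)
  show "1 * R = R" by transfer (auto intro!: blinfun_eqI)
  show "R * 1 = R" by transfer (auto intro!: blinfun_eqI)
  obtain i :: 'a where True by simp
  have "coord (Abs_ell2 (\<lambda>j. if j = i then 1 else 0)) = (\<lambda>j. if j = i then 1 else 0)"
  proof (rule Abs_ell2_inverse, rule CollectI)
    show "(\<lambda>j. (cmod (if j = i then 1 else 0))\<^sup>2) summable_on UNIV"
      by (subst summable_on_cong_neutral[where T = "{i}"
            and g = "\<lambda>j. (cmod (if j = i then 1 else 0))\<^sup>2"]) auto
  qed
  then have nz: "Abs_ell2 (\<lambda>j. if j = i then 1 else 0) \<noteq> (0 :: 'a ell2)"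
    by (metis zero_ell2.rep_eq zero_neq_one)
  show "0 \<noteq> (1 :: 'a ell2_op)"
  proof
    assume "0 = (1 :: 'a ell2_op)"
    then have "blinfun_apply 0 x = blinfun_apply id_blinfun x" for x :: "'a ell2"
      by transfer simp
    then have "x = 0" for x :: "'a ell2"
      by simp
    then show False
      using nz by blast
  qed
  show "dist R S = norm (R - S)" by (rule dist_ell2_op_def)
  show "sgn R = inverse (norm R) *\<^sub>R R" by (rule sgn_ell2_op_def)
  show "uniformity = (INF e\<in>{0 <..}. principal {(x, y :: 'a ell2_op). dist x y < e})"
    by (rule uniformity_ell2_op_def)
  show "open U = (\<forall>x\<in>U. eventually (\<lambda>(x', y). x' = x \<longrightarrow> y \<in> U) uniformity)" for U :: "'a ell2_op set"
    by (rule open_ell2_op_def)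
  show "norm R = 0 \<longleftrightarrow> R = 0" by transfer simp
  show "norm (R + S) \<le> norm R + norm S" by transfer (rule norm_triangle_ineq)
  show "norm (a *\<^sub>R R) = \<bar>a\<bar> * norm R" by transfer simp
  show "norm (R * S) \<le> norm R * norm S" by transfer (rule norm_blinfun_compose)
  show "norm (1 :: 'a ell2_op) = 1"
  proof transfer
    have "norm (id_blinfun :: 'a ell2 \<Rightarrow>\<^sub>L 'a ell2) \<le> 1"
      by (rule norm_blinfun_bound) auto
    moreover have "1 \<le> norm (id_blinfun :: 'a ell2 \<Rightarrow>\<^sub>L 'a ell2)"
      using norm_blinfun[of id_blinfun "Abs_ell2 (\<lambda>j. if j = i then 1 else 0) :: 'a ell2"] nz
      by simp
    ultimately show "norm (id_blinfun :: 'a ell2 \<Rightarrow>\<^sub>L 'a ell2) = 1"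
      by simp
  qed
qed

end

lemma app_simps [simp]:
  "0 \<cdot> x = 0" "1 \<cdot> x = x" "(S + T) \<cdot> x = S \<cdot> x + T \<cdot> x" "(S - T) \<cdot> x = S \<cdot> x - T \<cdot> x"
  "(- T) \<cdot> x = - (T \<cdot> x)" "(S * T) \<cdot> x = S \<cdot> T \<cdot> x" "(r *\<^sub>R T) \<cdot> x = r *\<^sub>R (T \<cdot> x)"
  "(c *\<^sub>C T) \<cdot> x = c *\<^sub>C (T \<cdot> x)"
  unfolding app_def
  by (simp_all add: zero_ell2_op.rep_eq one_ell2_op.rep_eq plus_ell2_op.rep_eq minus_ell2_op.rep_eq
      uminus_ell2_op.rep_eq times_ell2_op.rep_eq scaleR_ell2_op.rep_eq scaleC_ell2_op.rep_eq
      blinfun.add_left blinfun.diff_left blinfun.minus_left blinfun.scaleR_left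
      bounded_linear_Blinfun_apply[OF bounded_linear_scaleC])

instance ell2_op :: (type) banach
proof
  fix X :: "nat \<Rightarrow> 'a ell2_op"
  assume "Cauchy X"
  have norm_diff: "norm (blinfun_of S - blinfun_of T) = norm (S - T)" for S T :: "'a ell2_op"
    by transfer simp
  have "Cauchy (\<lambda>n. blinfun_of (X n))"
    using \<open>Cauchy X\<close> unfolding Cauchy_iff norm_diff .
  then obtain L where L: "(\<lambda>n. blinfun_of (X n)) \<longlonglongrightarrow> L"
    using Cauchy_convergent convergent_def by blast
  have "blinfun_apply L (c *\<^sub>C x) = c *\<^sub>C blinfun_apply L x" for c x
  proof (rule LIMSEQ_unique)
    show "(\<lambda>n. blinfun_apply (blinfun_of (X n)) (c *\<^sub>C x)) \<longlonglongrightarrow> blinfun_apply L (c *\<^sub>C x)"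
      by (intro tendsto_intros L)
    show "(\<lambda>n. blinfun_apply (blinfun_of (X n)) (c *\<^sub>C x)) \<longlonglongrightarrow> c *\<^sub>C blinfun_apply L x"
      unfolding blinfun_of_scaleC
      by (intro bounded_linear.tendsto[OF bounded_linear_scaleC] tendsto_intros L)
  qed
  then have "blinfun_of (Abs_ell2_op L) = L"
    by (simp add: Abs_ell2_op_inverse)
  then have "X \<longlonglongrightarrow> Abs_ell2_op L"
    using L unfolding LIMSEQ_iff by (metis norm_diff)
  then show "convergent X"
    by (rule convergentI)
qed

text \<open>
  Defined as a description of the element satisfying the adjoint identity; that element exists and is
  unique for every bounded operator on a Hilbert space.
\<close>

definition adj :: "'i ell2_op \<Rightarrow> 'i ell2_op" where
  "adj T = (THE S. \<forall>x y. cinner (T \<cdot> x) y = cinner x (S \<cdot> y))"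

section \<open>Operators over a subset of the index set\<close>

text \<open>
  For a set \<open>G\<close> of indices, \<open>\<ell>\<^sup>2(G)\<close> is the closed subspace \<open>ell2_on G\<close> of families vanishing outside
  \<open>G\<close>. A bounded operator on \<open>\<ell>\<^sup>2(G)\<close>, that is, a matrix indexed by \<open>G \<times> G\<close>, is represented by its
  extension by zero, that is, the matrix padded with zeros. Sums, products, adjoints and operator norms
  are unaffected by this extension, but the identity of \<open>\<ell>\<^sup>2(G)\<close> becomes the coordinate projection
  \<open>id_on G\<close>, not \<open>1\<close>. Inverses and exponentials are therefore taken relative to \<open>id_on G\<close>.
\<close>

definition ell2_on :: "'i set \<Rightarrow> 'i ell2 set" where
  "ell2_on G = {x. \<forall>i. i \<notin> G \<longrightarrow> coord x i = 0}"

definition ops_on :: "'i set \<Rightarrow> 'i ell2_op set" where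
  "ops_on G = {T. (\<forall>x. T \<cdot> x \<in> ell2_on G) \<and> (\<forall>x\<in>ell2_on (- G). T \<cdot> x = 0)}"

lift_definition restrict_ell2 :: "'i set \<Rightarrow> 'i ell2 \<Rightarrow> 'i ell2" is
  "\<lambda>G x i. if i \<in> G then x i else 0"
  by (erule summable_on_comparison_test) auto

lemma norm_restrict_ell2: "norm (restrict_ell2 G x) \<le> norm x"
  unfolding norm_ell2_def
  by (intro real_sqrt_le_mono infsum_mono coord_summable) (simp add: restrict_ell2.rep_eq)

lemma bounded_linear_restrict_ell2: "bounded_linear (restrict_ell2 G)"
  by (rule bounded_linear_intro[where K = 1])
    (auto intro!: ell2_eqI norm_restrict_ell2 simp: restrict_ell2.rep_eq)

lift_definition id_on :: "'i set \<Rightarrow> 'i ell2_op" is "\<lambda>G. Blinfun (restrict_ell2 G)"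
  by (auto intro!: ell2_eqI
      simp: bounded_linear_Blinfun_apply[OF bounded_linear_restrict_ell2] restrict_ell2.rep_eq
        scaleC_ell2.rep_eq)

lemma id_on_app [simp]: "id_on G \<cdot> x = restrict_ell2 G x"
  by (simp add: app_def id_on.rep_eq bounded_linear_Blinfun_apply[OF bounded_linear_restrict_ell2])

definition inverse_on :: "'i set \<Rightarrow> 'i ell2_op \<Rightarrow> 'i ell2_op" where
  "inverse_on G T = (THE S. S \<in> ops_on G \<and> T * S = id_on G \<and> S * T = id_on G)"

text \<open>
  For \<open>T \<in> ops_on G\<close>, \<open>exp T\<close> is the exponential on \<open>\<ell>\<^sup>2(G)\<close> together with the identity on the
  orthogonal complement; the latter is cut off.
\<close>

definition exp_on :: "'i set \<Rightarrow> 'i ell2_op \<Rightarrow> 'i ell2_op" where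
  "exp_on G T = id_on G * exp T"

text \<open>For self-adjoint \<open>Q\<close> the number \<open>\<langle>Q x, x\<rangle>\<close> is real, so taking real parts loses nothing.\<close>

definition positive_on :: "'i set \<Rightarrow> 'i ell2_op \<Rightarrow> bool" where
  "positive_on G Q \<longleftrightarrow> Q \<in> ops_on G \<and> adj Q = Q \<and> (\<forall>x\<in>ell2_on G. 0 \<le> Re (cinner (Q \<cdot> x) x))"

definition strictly_positive_on :: "'i set \<Rightarrow> 'i ell2_op \<Rightarrow> bool" where
  "strictly_positive_on G Q \<longleftrightarrow> Q \<in> ops_on G \<and> adj Q = Q \<and>
    (\<exists>c>0. \<forall>x\<in>ell2_on G. c * (norm x)\<^sup>2 \<le> Re (cinner (Q \<cdot> x) x))"

definition sqrt_on :: "'i set \<Rightarrow> 'i ell2_op \<Rightarrow> 'i ell2_op" where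
  "sqrt_on G Q = (THE S. positive_on G S \<and> S * S = Q)"

section \<open>Proper $q$-Banach algebras\<close>

locale q_banach_space =
  fixes q :: real and \<A> :: "'i ell2_op set" and nrm :: "'i ell2_op \<Rightarrow> real"
  assumes q_pos: "0 < q" and q_le_1: "q \<le> 1"
    and zero_mem: "0 \<in> \<A>"
    and add_mem: "\<lbrakk>S \<in> \<A>; T \<in> \<A>\<rbrakk> \<Longrightarrow> S + T \<in> \<A>"
    and scaleC_mem: "T \<in> \<A> \<Longrightarrow> c *\<^sub>C T \<in> \<A>"
    and nrm_nonneg: "T \<in> \<A> \<Longrightarrow> 0 \<le> nrm T"
    and nrm_eq_0_iff: "T \<in> \<A> \<Longrightarrow> nrm T = 0 \<longleftrightarrow> T = 0"
    and nrm_scaleC: "T \<in> \<A> \<Longrightarrow> nrm (c *\<^sub>C T) = cmod c * nrm T"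
    and nrm_add: "\<lbrakk>S \<in> \<A>; T \<in> \<A>\<rbrakk> \<Longrightarrow> nrm (S + T) powr q \<le> nrm S powr q + nrm T powr q"
    and complete: "\<lbrakk>\<And>n. X n \<in> \<A>;
        \<forall>e>0. \<exists>N. \<forall>m\<ge>N. \<forall>n\<ge>N. nrm (X m - X n) powr q < e\<rbrakk>
      \<Longrightarrow> \<exists>L\<in>\<A>. (\<lambda>n. nrm (X n - L) powr q) \<longlonglongrightarrow> 0"

locale q_banach_algebra_on = q_banach_space q \<A> nrm
  for G :: "'i set" and q :: real and \<A> :: "'i ell2_op set" and nrm :: "'i ell2_op \<Rightarrow> real" +
  assumes id_mem: "id_on G \<in> \<A>"
    and mult_mem: "\<lbrakk>S \<in> \<A>; T \<in> \<A>\<rbrakk> \<Longrightarrow> S * T \<in> \<A>"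
    and nrm_mult: "\<exists>K>0. \<forall>S\<in>\<A>. \<forall>T\<in>\<A>. nrm (S * T) \<le> K * nrm S * nrm T"

text \<open>
  In the differential condition, if \<open>S = 0\<close> or \<open>T = 0\<close> then the right-hand side is \<open>0\<close>, because
  \<open>0 powr q = 0\<close>.
\<close>

locale proper_q_banach_algebra_on = q_banach_algebra_on G q \<A> nrm
  for G :: "'i set" and q :: real and \<A> :: "'i ell2_op set" and nrm :: "'i ell2_op \<Rightarrow> real" +
  assumes adj_mem: "T \<in> \<A> \<Longrightarrow> adj T \<in> \<A>"
    and nrm_adj: "T \<in> \<A> \<Longrightarrow> nrm (adj T) = nrm T"
    and subset_ops: "\<A> \<subseteq> ops_on G"
    and norm_le_nrm: "T \<in> \<A> \<Longrightarrow> norm T \<le> nrm T"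
    and differential: "\<exists>\<theta> D. 0 < \<theta> \<and> \<theta> \<le> 1 \<and> 0 < D \<and> (\<forall>S\<in>\<A>. \<forall>T\<in>\<A>.
      nrm (S * T) powr q \<le> D * nrm S powr q * nrm T powr q *
        ((norm S / nrm S) powr (q * \<theta>) + (norm T / nrm T) powr (q * \<theta>)))"

section \<open>Linear systems\<close>

text \<open>
  Membership of the exponentials in \<open>\<A>\<close> is part of stability on \<open>\<A>\<close>, as \<open>nrm\<close> is unspecified
  outside \<open>\<A>\<close>.
\<close>

definition exp_stable_on :: "'i set \<Rightarrow> 'i ell2_op set \<Rightarrow> ('i ell2_op \<Rightarrow> real) \<Rightarrow> 'i ell2_op \<Rightarrow> bool" where
  "exp_stable_on G \<A> nrm A \<longleftrightarrow> A \<in> \<A> \<and> (\<exists>E>0. \<exists>\<alpha>>0. \<forall>t\<ge>0.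
    exp_on G (t *\<^sub>R A) \<in> \<A> \<and> nrm (exp_on G (t *\<^sub>R A)) \<le> E * exp (- \<alpha> * t))"

definition exp_detectable_on :: "'i set \<Rightarrow> 'i ell2_op \<Rightarrow> 'i ell2_op \<Rightarrow> bool" where
  "exp_detectable_on G A C \<longleftrightarrow> (\<exists>L\<in>ops_on G. exp_stable_on G (ops_on G) norm (A + L * C))"

definition L2_control :: "'i::countable set \<Rightarrow> real \<Rightarrow> (real \<Rightarrow> 'i ell2) set" where
  "L2_control G T = {u. (\<forall>\<tau>\<in>{0..T}. u \<tau> \<in> ell2_on G) \<and> u \<in> borel_measurable (lebesgue_on {0..T}) \<and>
    integrable (lebesgue_on {0..T}) (\<lambda>\<tau>. (norm (u \<tau>))\<^sup>2)}"

definition reachable_on :: "'i::countable set \<Rightarrow> 'i ell2_op \<Rightarrow> 'i ell2_op \<Rightarrow> 'i ell2 set" where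
  "reachable_on G A B = {z. \<exists>T>0. \<exists>u\<in>L2_control G T.
    z = (LINT \<tau>|lebesgue_on {0..T}. exp_on G ((T - \<tau>) *\<^sub>R A) \<cdot> B \<cdot> u \<tau>)}"

text \<open>The reachable space lies in the closed space \<open>ell2_on G\<close>, so equality of the closure is density.\<close>

definition approx_controllable_on :: "'i::countable set \<Rightarrow> 'i ell2_op \<Rightarrow> 'i ell2_op \<Rightarrow> bool" where
  "approx_controllable_on G A B \<longleftrightarrow> closure (reachable_on G A B) = ell2_on G"

definition riccati_on ::
  "'i set \<Rightarrow> 'i ell2_op \<Rightarrow> 'i ell2_op \<Rightarrow> 'i ell2_op \<Rightarrow> 'i ell2_op \<Rightarrow> 'i ell2_op \<Rightarrow> bool" where
  "riccati_on G A B Q R X \<longleftrightarrow>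
    adj A * X + X * A - X * B * inverse_on G R * adj B * X + Q = 0"

end

(*
  Let N = B R^-1 B*. Stability of A - N X in B(l^2) comes from a Lyapunov function: X itself only sees
  Q^(1/2) x and B* X x, and detectability supplies a finite-horizon Gramian W that sees the rest, so k X + W
  works for large k. Uniqueness follows, since the difference of two solutions satisfies a Sylvester equation with
  two stable coefficients.

  The differential inequality gives nu(T^(2n)) <= c nu(T^n)^(2 - theta) ||T^n||^theta, so a geometric decay of ||T^n||
  forces one of nu(T^n), where nu is the q-th power of the norm of the algebra. Hence power series whose argument has
  small spectral radius in B(l^2) converge in the algebra, also for 2 x 2 matrices over it.

  The graph of X is the stable subspace of the Hamiltonian H = [A, -N; -Q, -A*]. The projection onto it is such
  a power series in (1 + exp(t H))^-1, for large t, so its entries lie in the algebra, and X is read off from them.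
*)
theory Submission
  imports Defs
begin

section \<open>Differential subalgebras\<close>

text \<open>The exponential of \<open>t *\<^sub>R H\<close> has a part close to 0 and a part with
  small inverse, so \<open>1 + exp (t *\<^sub>R H)\<close> cannot be inverted by a Neumann series
  directly. Its inverse reaches the algebra through adjoints: if \<open>M\<close> is invertible then
  \<open>adj M * M\<close> is coercive, and a coercive operator is, up to a positive factor, 1 minus
  a contraction in the operator norm, for which the Neumann series converges in the algebra. Reading
  \<open>X\<close> off the projection meets another obstacle: no single entry of it is known to be
  invertible. The first row \<open>F\<close>, \<open>G\<close> satisfies
  \<open>F + G * X = 1\<close>, which makes \<open>F * adj F + G * adj G\<close> coercive, and this
  operator can be divided by. Finally, the identity of an algebra over \<open>G\<close> is a
  coordinate projection, whereas inverses and exponentials are built around 1. All data are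
  therefore extended by multiples of the complementary projection, with signs that preserve
  coercivity, stability and the Riccati equation.\<close>

lemma geometric_inverse:
  fixes T :: "'a::{real_normed_algebra_1,banach}"
  assumes sm: "summable (\<lambda>n. T ^ n)"
  shows "(1 - T) * (\<Sum>n. T ^ n) = 1" "(\<Sum>n. T ^ n) * (1 - T) = 1"
proof -
  have "(\<Sum>n. T ^ n) = 1 + T * (\<Sum>n. T ^ n)"
    using suminf_split_head[OF sm] suminf_mult[OF sm, of T] by simp
  then show "(1 - T) * (\<Sum>n. T ^ n) = 1" by (simp add: left_diff_distrib diff_eq_eq)
  have "(\<Sum>n. T ^ n) = 1 + (\<Sum>n. T ^ n) * T"
    using suminf_split_head[OF sm] suminf_mult2[OF sm, of T] by (simp add: power_commutes)
  then show "(\<Sum>n. T ^ n) * (1 - T) = 1" by (simp add: right_diff_distrib diff_eq_eq)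
qed

text \<open>\<open>\<nu>\<close> stands for the q-th power of the q-norm, so it is subadditive and
  its homogeneity carries the exponent \<open>q\<close>. The differential inequality is multiplied
  out, which removes the special role of zero. Completeness enters only through the last two
  assumptions, where the sums are those of the ambient norm. Real scalars suffice because all series
  used below have real coefficients.\<close>

locale differential_subalgebra =
  fixes C :: "'b::{real_normed_algebra_1,banach} set" and \<nu> :: "'b \<Rightarrow> real" and q \<theta> D :: real
  assumes q_pos: "0 < q" and q_le_1: "q \<le> 1"
    and theta_pos: "0 < \<theta>" and theta_less_1: "\<theta> < 1"
    and D_pos: "0 < D"
    and one_mem: "1 \<in> C"
    and add_mem: "\<lbrakk>S \<in> C; T \<in> C\<rbrakk> \<Longrightarrow> S + T \<in> C"
    and scaleR_mem: "T \<in> C \<Longrightarrow> c *\<^sub>R T \<in> C"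
    and mult_mem: "\<lbrakk>S \<in> C; T \<in> C\<rbrakk> \<Longrightarrow> S * T \<in> C"
    and nu_nonneg: "T \<in> C \<Longrightarrow> 0 \<le> \<nu> T"
    and nu_add: "\<lbrakk>S \<in> C; T \<in> C\<rbrakk> \<Longrightarrow> \<nu> (S + T) \<le> \<nu> S + \<nu> T"
    and nu_scaleR: "T \<in> C \<Longrightarrow> \<nu> (c *\<^sub>R T) = \<bar>c\<bar> powr q * \<nu> T"
    and norm_le_nu: "T \<in> C \<Longrightarrow> norm T powr q \<le> \<nu> T"
    and nu_mult: "\<lbrakk>S \<in> C; T \<in> C\<rbrakk> \<Longrightarrow> \<nu> (S * T) \<le> D *
        (\<nu> S powr (1 - \<theta>) * norm S powr (q * \<theta>) * \<nu> T + \<nu> S * (\<nu> T powr (1 - \<theta>) * norm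
            T powr (q * \<theta>)))"
    and suminf_mem: "\<lbrakk>\<And>n. Y n \<in> C; summable (\<lambda>n. \<nu> (Y n))\<rbrakk> \<Longrightarrow> (\<Sum>n. Y n) \<in> C"
    and nu_suminf: "\<lbrakk>\<And>n. Y n \<in> C; summable (\<lambda>n. \<nu> (Y n))\<rbrakk> \<Longrightarrow> \<nu>
        (\<Sum>n. Y n) \<le> (\<Sum>n. \<nu> (Y n))"
begin

lemma zero_mem: "0 \<in> C"
  using scaleR_mem[OF one_mem, of 0] by simp

lemma uminus_mem: "T \<in> C \<Longrightarrow> - T \<in> C"
  using scaleR_mem[of T "-1"] by simp

lemma diff_mem: "\<lbrakk>S \<in> C; T \<in> C\<rbrakk> \<Longrightarrow> S - T \<in> C"
  using add_mem[OF _ uminus_mem, of S T] by simp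

lemma power_mem: "T \<in> C \<Longrightarrow> T ^ n \<in> C"
  by (induction n) (auto intro: one_mem mult_mem)

lemma norm_powr_theta_le: "T \<in> C \<Longrightarrow> \<nu> T powr (1 - \<theta>) * norm T powr (q * \<theta>) \<le> \<nu> T"
proof -
  assume T: "T \<in> C"
  have "norm T powr (q * \<theta>) \<le> \<nu> T powr \<theta>"
    using powr_mono2[OF _ _ norm_le_nu[OF T], of \<theta>] theta_pos by (simp add: powr_powr)
  then have "\<nu> T powr (1 - \<theta>) * norm T powr (q * \<theta>) \<le> \<nu> T powr (1 - \<theta>) * \<nu> T powr \<theta>"
    by (intro mult_left_mono) auto
  also have "\<dots> = \<nu> T"
    using nu_nonneg[OF T] by (simp add: powr_add[symmetric])
  finally show ?thesis .
qed

lemma nu_mult_le: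
  assumes "S \<in> C" "T \<in> C"
  shows "\<nu> (S * T) \<le> 2 * D * (\<nu> S * \<nu> T)"
proof -
  have "\<nu> (S * T) \<le> D * (\<nu> S * \<nu> T + \<nu> S * \<nu> T)"
    using assms D_pos
    by (intro order_trans[OF nu_mult] mult_left_mono add_mono mult_right_mono norm_powr_theta_le nu_nonneg) auto
  then show ?thesis by simp
qed

text \<open>Equal factors give the exponent \<open>2 - \<theta>\<close>. This deficit against the
  exponent 2 of plain submultiplicativity is what lets decay of the norm force decay of
  \<open>\<nu>\<close>.\<close>

lemma nu_square_le:
  assumes "S \<in> C"
  shows "\<nu> (S * S) \<le> 2 * D * (\<nu> S powr (2 - \<theta>) * norm S powr (q * \<theta>))"
proof -
  have "\<nu> S powr (2 - \<theta>) = \<nu> S powr (1 - \<theta>) * \<nu> S"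
    using nu_nonneg[OF assms] powr_add[of "\<nu> S" "1 - \<theta>" 1] by simp
  then show ?thesis
    using nu_mult[OF assms assms] by (simp add: algebra_simps)
qed

lemma nu_power_le: "T \<in> C \<Longrightarrow> \<nu> (T ^ n) \<le> \<nu> 1 * (2 * D * \<nu> T) ^ n"
proof (induction n)
  case (Suc n)
  have "\<nu> (T * T ^ n) \<le> 2 * D * (\<nu> T * \<nu> (T ^ n))"
    by (rule nu_mult_le) (simp_all add: Suc.prems power_mem)
  also have "\<dots> \<le> 2 * D * (\<nu> T * (\<nu> 1 * (2 * D * \<nu> T) ^ n))"
    using Suc D_pos by (intro mult_left_mono) (auto intro: nu_nonneg)
  finally show ?case by (simp add: algebra_simps)
qed simp

text \<open>
  Along the powers \<open>T ^ 2 ^ k\<close> the logarithm \<open>L k\<close> of \<open>\<nu>\<close> satisfies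
  \<open>L (k + 1) \<le> c + (2 - \<theta>) * L k - \<gamma> * 2 ^ k\<close>. Since \<open>2 - \<theta> < 2\<close>, the last term wins.
\<close>

lemma nu_power_eventually_small:
  assumes T: "T \<in> C" and dec: "\<And>n. norm (T ^ n) \<le> c * \<rho> ^ n" and \<rho>: "0 < \<rho>" "\<rho> < 1" and "0 < e"
  shows "\<exists>m>0. \<nu> (T ^ m) < e"
proof -
  define s where "s = 2 - \<theta>"
  have s: "1 < s" "s < 2" using theta_pos theta_less_1 by (auto simp: s_def)
  \<comment> \<open>The maximum makes the constant positive, so that its logarithm makes
    sense.\<close>
  define c0 where "c0 = max c 1"
  have c0: "0 < c0" by (simp add: c0_def)
  have dec0: "norm (T ^ n) \<le> c0 * \<rho> ^ n" for n
    by (rule order_trans[OF dec mult_right_mono]) (use \<rho> in \<open>auto simp: c0_def\<close>)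
  define \<gamma> where "\<gamma> = - (q * \<theta>) * ln \<rho>"
  have \<gamma>: "0 < \<gamma>" using q_pos theta_pos \<rho> by (simp add: \<gamma>_def mult_pos_neg)
  define d where "d = ln (2 * D) + q * \<theta> * ln c0"
  \<comment> \<open>\<open>b\<close> absorbs the constant term, \<open>a\<close> fits the initial
    value, and the coefficient of \<open>2 ^ k\<close> is a particular solution, so that
    \<open>L\<close> solves the recursion with equality. The 1 inside the logarithm covers
    \<open>\<nu> T = 0\<close>.\<close>
  define b where "b = d / (s - 1)"
  have b: "d - s * b = - b" using s by (simp add: b_def field_simps)
  define a where "a = ln (\<nu> T + 1) + b + \<gamma> / (2 - s)"
  define L where "L k = a * s ^ k - b - \<gamma> / (2 - s) * 2 ^ k" for k :: nat
  have L_Suc: "L (Suc k) = d + s * L k - \<gamma> * 2 ^ k" for k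
  proof -
    have "2 * \<gamma> / (2 - s) = s * (\<gamma> / (2 - s)) + \<gamma>" using s by (simp add: field_simps)
    moreover have "\<gamma> / (2 - s) * 2 ^ Suc k = 2 * \<gamma> / (2 - s) * 2 ^ k" by simp
    ultimately have "\<gamma> / (2 - s) * 2 ^ Suc k = (s * (\<gamma> / (2 - s)) + \<gamma>) * 2 ^ k" by metis
    then show ?thesis using b by (simp add: L_def algebra_simps)
  qed
  have bound: "\<nu> (T ^ (2 ^ k)) \<le> exp (L k)" for k
  proof (induction k)
    case 0
    have "L 0 = ln (\<nu> T + 1)" by (simp add: L_def a_def)
    moreover have "0 < \<nu> T + 1" using nu_nonneg[OF T] by simp
    ultimately show ?case by simp
  next
    case (Suc k)
    let ?S = "T ^ (2 ^ k)"
    have S: "?S \<in> C" by (rule power_mem[OF T])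
    have "\<nu> (?S * ?S) \<le> 2 * D * (\<nu> ?S powr s * norm ?S powr (q * \<theta>))"
      using nu_square_le[OF S] by (simp add: s_def)
    also have "\<dots> \<le> 2 * D * (exp (L k) powr s * (c0 * \<rho> ^ (2 ^ k)) powr (q * \<theta>))"
      using Suc S s D_pos q_pos theta_pos
      by (intro mult_left_mono mult_mono powr_mono2 dec0) (auto intro: nu_nonneg)
    also have "(c0 * \<rho> ^ (2 ^ k)) powr (q * \<theta>) = exp (q * \<theta> * ln c0 - \<gamma> * 2 ^ k)"
      using c0 \<rho> by (simp add: powr_def ln_mult ln_realpow \<gamma>_def algebra_simps)
    also have "exp (L k) powr s = exp (s * L k)" by (simp add: powr_def)
    also have "2 * D * (exp (s * L k) * exp (q * \<theta> * ln c0 - \<gamma> * 2 ^ k)) = exp (ln (2 * D)) * exp (s * L k) *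
        exp (q * \<theta> * ln c0 - \<gamma> * 2 ^ k)"
      using D_pos by (simp add: exp_ln[of "2 * D"] mult.assoc del: exp_ln)
    also have "\<dots> = exp (L (Suc k))"
      unfolding L_Suc d_def by (simp add: exp_add[symmetric] algebra_simps)
    also have "?S * ?S = T ^ (2 ^ Suc k)" by (simp add: power_add[symmetric] mult_2)
    finally show ?case .
  qed
  \<comment> \<open>Up to the constant \<open>b\<close>, dividing \<open>L k\<close> by
    \<open>2 ^ k\<close> leaves a negative limit, because \<open>s / 2 < 1\<close>.\<close>
  have "(\<lambda>k. (s / 2) ^ k) \<longlonglongrightarrow> 0" using s by (intro LIMSEQ_realpow_zero) auto
  then have "(\<lambda>k. a * (s / 2) ^ k - \<gamma> / (2 - s)) \<longlonglongrightarrow> a * 0 - \<gamma> / (2 - s)"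
    by (intro tendsto_diff tendsto_mult tendsto_const)
  moreover have "a * 0 - \<gamma> / (2 - s) < 0" using \<gamma> s by simp
  ultimately have "filterlim (\<lambda>k. (a * (s / 2) ^ k - \<gamma> / (2 - s)) * 2 ^ k) at_bot sequentially"
    by (rule filterlim_tendsto_neg_mult_at_bot) (intro filterlim_at_infinity_imp_filterlim_at_top
        filterlim_realpow_sequentially_gt1 always_eventually, auto)
  then have "\<forall>\<^sub>F k in sequentially. (a * (s / 2) ^ k - \<gamma> / (2 - s)) * 2 ^ k < ln e + b"
    by (rule filterlim_at_bot_dense[THEN iffD1, rule_format])
  then obtain k where "(a * (s / 2) ^ k - \<gamma> / (2 - s)) * 2 ^ k < ln e + b"
    by (auto simp: eventually_sequentially)
  then have "L k < ln e" by (simp add: L_def algebra_simps power_divide)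
  then have "exp (L k) < e" using \<open>0 < e\<close> by (metis exp_less_cancel_iff exp_ln)
  then show ?thesis using bound[of k] by (intro exI[of _ "2 ^ k"]) auto
qed

theorem nu_power_decay:
  assumes T: "T \<in> C" and "\<And>n. norm (T ^ n) \<le> c * \<rho> ^ n" "0 < \<rho>" "\<rho> < 1"
  shows "\<exists>M \<sigma>. 0 < M \<and> 0 < \<sigma> \<and> \<sigma> < 1 \<and> (\<forall>n. \<nu> (T ^ n) \<le> M * \<sigma> ^ n)"
proof -
  \<comment> \<open>Plain submultiplicativity holds with the constant \<open>2 * D\<close>, so each
    further factor \<open>T ^ m\<close> at least halves the bound.\<close>
  obtain m where m: "0 < m" "\<nu> (T ^ m) < 1 / (4 * D)"
    using nu_power_eventually_small[OF assms, of "1 / (4 * D)"] D_pos by auto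
  define M where "M = 1 + (\<Sum>i<m. \<nu> (T ^ i))"
  have nn: "0 \<le> \<nu> (T ^ i)" for i by (intro nu_nonneg power_mem T)
  have M: "0 < M" unfolding M_def by (smt (verit) nn sum_nonneg)
  have Mi: "\<nu> (T ^ i) \<le> M" if "i < m" for i
    unfolding M_def using member_le_sum[of i "{..<m}" "\<lambda>i. \<nu> (T ^ i)"] nn that by auto
  have step: "\<nu> (T ^ (m * j + i)) \<le> M * (1 / 2) ^ j" if "i < m" for i j
  proof (induction j)
    case (Suc j)
    have "\<nu> (T ^ m * T ^ (m * j + i)) \<le> 2 * D * (\<nu> (T ^ m) * \<nu> (T ^ (m * j + i)))"
      by (intro nu_mult_le power_mem T)
    also have "\<dots> \<le> 2 * D * (1 / (4 * D) * (M * (1 / 2) ^ j))"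
      using m D_pos Suc nn by (intro mult_left_mono mult_mono) auto
    also have "\<dots> = M * (1 / 2) ^ Suc j" using D_pos by simp
    finally show ?case by (simp add: power_add[symmetric] algebra_simps)
  qed (use Mi that in auto)
  \<comment> \<open>The root spreads the factor 1/2 over \<open>m\<close> steps; the incomplete
    block of length \<open>n mod m\<close> costs at most a factor 2.\<close>
  define \<sigma> where "\<sigma> = root m (1 / 2)"
  have \<sigma>: "0 < \<sigma>" "\<sigma> < 1" "\<sigma> ^ m = 1 / 2" using m by (auto simp: \<sigma>_def)
  have "\<nu> (T ^ n) \<le> 2 * M * \<sigma> ^ n" for n
  proof -
    have mod: "n mod m < m" using m by simp
    have "\<nu> (T ^ n) = \<nu> (T ^ (m * (n div m) + n mod m))" by simp
    also have "\<dots> \<le> M * (1 / 2) ^ (n div m)" by (rule step[OF mod])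
    also have "\<dots> = M * \<sigma> ^ (m * (n div m))" by (simp only: \<sigma>(3)[symmetric] power_mult)
    also have "\<dots> \<le> M * (2 * \<sigma> ^ n)"
    proof (intro mult_left_mono)
      have "1 / 2 \<le> \<sigma> ^ (n mod m)"
        using power_decreasing[of "n mod m" m \<sigma>] \<sigma> mod by simp
      then have "\<sigma> ^ (m * (n div m)) * (1 / 2) \<le> \<sigma> ^ (m * (n div m)) * \<sigma> ^ (n mod m)"
        using \<sigma> by (intro mult_left_mono) auto
      also have "\<dots> = \<sigma> ^ n" by (simp add: power_add[symmetric])
      finally show "\<sigma> ^ (m * (n div m)) \<le> 2 * \<sigma> ^ n" by simp
    qed (use M in simp)
    finally show ?thesis by simp
  qed
  then show ?thesis using M \<sigma> by (intro exI[of _ "2 * M"] exI[of _ \<sigma>]) auto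
qed

lemma power_series_mem:
  assumes T: "T \<in> C" and "\<And>n. norm (T ^ n) \<le> c * \<rho> ^ n" "0 < \<rho>" "\<rho> < 1"
    and a: "\<And>n. \<bar>a n\<bar> \<le> 1"
  shows "(\<Sum>n. a n *\<^sub>R T ^ n) \<in> C"
proof -
  obtain M \<sigma> where M: "0 < M" "0 < \<sigma>" "\<sigma> < 1" "\<And>n. \<nu> (T ^ n) \<le> M * \<sigma> ^ n"
    using nu_power_decay[OF assms(1-4)] by blast
  have "summable (\<lambda>n. \<nu> (a n *\<^sub>R T ^ n))"
  proof (rule summable_comparison_test')
    show "summable (\<lambda>n. M * \<sigma> ^ n)" using M by (intro summable_mult summable_geometric) auto
    fix n
    have "\<bar>a n\<bar> powr q \<le> 1" using powr_mono2[of q "\<bar>a n\<bar>" 1] q_pos a by simp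
    then have "\<bar>a n\<bar> powr q * \<nu> (T ^ n) \<le> 1 * (M * \<sigma> ^ n)"
      by (intro mult_mono M) (auto intro: nu_nonneg power_mem T)
    then show "norm (\<nu> (a n *\<^sub>R T ^ n)) \<le> M * \<sigma> ^ n"
      using nu_nonneg[OF power_mem[OF T, of n]] by (simp add: nu_scaleR power_mem T)
  qed
  then show ?thesis by (intro suminf_mem scaleR_mem power_mem T)
qed

lemma inverse_one_minus_mem:
  assumes T: "T \<in> C" and dec: "\<And>n. norm (T ^ n) \<le> c * \<rho> ^ n" and \<rho>: "0 < \<rho>" "\<rho> < 1"
  shows "\<exists>S\<in>C. (1 - T) * S = 1 \<and> S * (1 - T) = 1"
proof -
  have sm: "summable (\<lambda>n. T ^ n)"
    by (rule summable_comparison_test'[OF _ dec]) (use \<rho> in \<open>auto intro!: summable_mult summable_geometric\<close>)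
  have "(\<Sum>n. T ^ n) \<in> C" using power_series_mem[OF assms, of "\<lambda>_. 1"] by simp
  then show ?thesis using geometric_inverse[OF sm] by blast
qed

section \<open>Exponentials in a differential subalgebra\<close>

text \<open>The q-th power weakens the factorials, but consecutive terms still have the ratio
  \<open>\<kappa>\<close> divided by \<open>real (Suc n) powr q\<close>, which tends to 0.\<close>

lemma summable_exp_majorant: "summable (\<lambda>n. (1 / fact n) powr q * \<kappa> ^ n)" for \<kappa> :: real
proof -
  have "filterlim (\<lambda>n. real (Suc n) powr q) at_top sequentially"
    by (rule filterlim_compose[OF real_powr_at_top[OF q_pos]])
      (rule filterlim_compose[OF filterlim_real_sequentially filterlim_Suc])
  then have "\<forall>\<^sub>F n in sequentially. 2 * \<bar>\<kappa>\<bar> \<le> real (Suc n) powr q"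
    by (simp add: filterlim_at_top)
  then obtain N where N: "\<And>n. n \<ge> N \<Longrightarrow> 2 * \<bar>\<kappa>\<bar> \<le> real (Suc n) powr q"
    by (auto simp: eventually_sequentially)
  show ?thesis
  proof (rule summable_ratio_test[of "1/2" N])
    fix n assume "n \<ge> N"
    have f: "(1 / fact (Suc n)) powr q = (1 / fact n) powr q / real (Suc n) powr q"
      by (simp add: powr_divide powr_mult del: of_nat_Suc)
    have "\<bar>\<kappa>\<bar> / real (Suc n) powr q \<le> 1 / 2"
      using N[OF \<open>n \<ge> N\<close>] by (simp add: field_simps del: of_nat_Suc)
    then have "((1 / fact n) powr q * \<bar>\<kappa>\<bar> ^ n) * (\<bar>\<kappa>\<bar> / real (Suc n) powr q) \<le> ((1 /
        fact n) powr q * \<bar>\<kappa>\<bar> ^ n) * (1 / 2)"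
      by (intro mult_left_mono) auto
    then show "norm ((1 / fact (Suc n)) powr q * \<kappa> ^ Suc n) \<le> 1 / 2 * norm ((1 / fact n) powr q * \<kappa> ^ n)"
      unfolding f by (simp add: abs_mult power_abs mult_ac del: of_nat_Suc)
  qed simp
qed

text \<open>The bound uniform over short times fills the gaps between integer times in the decay
  estimate for the exponential.\<close>

lemma exp_mem_bounded:
  assumes T: "T \<in> C"
  shows "\<exists>M. \<forall>t. \<bar>t\<bar> \<le> 1 \<longrightarrow> exp (t *\<^sub>R T) \<in> C \<and> \<nu> (exp (t
      *\<^sub>R T)) \<le> M"
proof -
  define g where "g n = \<nu> 1 * ((1 / fact n) powr q * (2 * D * \<nu> T) ^ n)" for n :: nat
  have g: "summable g" unfolding g_def by (intro summable_mult summable_exp_majorant)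
  have "exp (t *\<^sub>R T) \<in> C \<and> \<nu> (exp (t *\<^sub>R T)) \<le> suminf g" if t: "\<bar>t\<bar> \<le> 1" for t
  proof -
    define Y where "Y n = (t *\<^sub>R T) ^ n /\<^sub>R fact n" for n
    have Y: "Y n \<in> C" for n unfolding Y_def by (intro scaleR_mem power_mem T)
    have Yg: "\<nu> (Y n) \<le> g n" for n
    proof -
      have "Y n = (t ^ n / fact n) *\<^sub>R T ^ n" by (simp add: Y_def scaleR_power divide_inverse_commute)
      then have "\<nu> (Y n) = \<bar>t ^ n / fact n\<bar> powr q * \<nu> (T ^ n)"
        by (simp add: nu_scaleR power_mem T)
      also have "\<dots> \<le> (1 / fact n) powr q * (\<nu> 1 * (2 * D * \<nu> T) ^ n)"
      proof (intro mult_mono powr_mono2 nu_power_le T)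
        show "\<bar>t ^ n / fact n\<bar> \<le> 1 / fact n"
          using t by (simp add: power_abs divide_right_mono power_le_one)
      qed (use q_pos in \<open>auto intro: nu_nonneg power_mem T\<close>)
      finally show ?thesis by (simp add: g_def mult_ac)
    qed
    have sm: "summable (\<lambda>n. \<nu> (Y n))"
      by (rule summable_comparison_test'[OF g, of 0]) (use Y Yg in \<open>auto simp: nu_nonneg\<close>)
    have "exp (t *\<^sub>R T) = suminf Y" unfolding exp_def Y_def ..
    then show ?thesis
      using suminf_mem[OF Y sm] nu_suminf[OF Y sm] suminf_le[OF Yg sm g] by auto
  qed
  then show ?thesis by blast
qed

lemma exp_mem: "T \<in> C \<Longrightarrow> exp T \<in> C"
  using exp_mem_bounded[of T] by (metis abs_one order_refl scaleR_one)

end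

lemma exp_scaleR_add:
  fixes T :: "'a::{real_normed_algebra_1,banach}"
  shows "exp ((s + t) *\<^sub>R T) = exp (s *\<^sub>R T) * exp (t *\<^sub>R T)"
  by (subst exp_add_commuting[symmetric]) (auto simp: scaleR_add_left mult_ac)

lemma exp_scaleR_of_nat:
  fixes T :: "'a::{real_normed_algebra_1,banach}"
  shows "exp (real n *\<^sub>R T) = exp T ^ n"
  by (induction n) (simp_all add: exp_scaleR_add[of 1, simplified])

context differential_subalgebra
begin

text \<open>At integer times the exponential is a power of \<open>exp T\<close>, where the decay of
  powers applies; the remaining fraction of a time unit contributes a bounded factor.\<close>

theorem nu_exp_decay:
  assumes T: "T \<in> C" and dec: "\<And>t. 0 \<le> t \<Longrightarrow> norm (exp (t *\<^sub>R T)) \<le> E * exp (- \<alpha>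
      * t)" and "0 < \<alpha>"
  shows "\<exists>E' \<alpha>'. 0 < E' \<and> 0 < \<alpha>' \<and> (\<forall>t\<ge>0. exp (t *\<^sub>R T) \<in> C \<and>
      \<nu> (exp (t *\<^sub>R T)) \<le> E' * exp (- \<alpha>' * t))"
proof -
  define S where "S = exp T"
  have S: "S \<in> C" unfolding S_def by (rule exp_mem[OF T])
  have "norm (S ^ n) \<le> E * exp (- \<alpha>) ^ n" for n
    using dec[of n] by (simp add: S_def exp_scaleR_of_nat exp_of_nat_mult[symmetric] mult.commute)
  then obtain M \<sigma> where M: "0 < M" "0 < \<sigma>" "\<sigma> < 1" "\<And>n. \<nu> (S ^ n) \<le> M * \<sigma> ^ n"
    using nu_power_decay[OF S, of E "exp (- \<alpha>)"] \<open>0 < \<alpha>\<close> by auto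
  obtain B where B: "\<And>t. \<bar>t\<bar> \<le> 1 \<Longrightarrow> \<nu> (exp (t *\<^sub>R T)) \<le> B"
    using exp_mem_bounded[OF T] by blast
  have "0 \<le> B" using B[of 1] nu_nonneg[OF S] by (simp add: S_def)
  define \<alpha>' where "\<alpha>' = - ln \<sigma>"
  have \<sigma>: "\<sigma> = exp (- \<alpha>')" "0 < \<alpha>'" using M by (auto simp: \<alpha>'_def)
  have "exp (t *\<^sub>R T) \<in> C \<and> \<nu> (exp (t *\<^sub>R T)) \<le> (2 * D * B * M / \<sigma> + 1) * exp (-
      \<alpha>' * t)" if "0 \<le> t" for t
  proof (intro conjI)
    show "exp (t *\<^sub>R T) \<in> C" by (intro exp_mem scaleR_mem T)
    define n where "n = nat \<lfloor>t\<rfloor>"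
    have n: "real n \<le> t" "t \<le> real n + 1" using that by (auto simp: n_def)
    have "exp (t *\<^sub>R T) = exp ((t - n) *\<^sub>R T) * S ^ n"
      using exp_scaleR_add[of "t - n" n T] by (simp add: S_def exp_scaleR_of_nat)
    then have "\<nu> (exp (t *\<^sub>R T)) \<le> 2 * D * (\<nu> (exp ((t - n) *\<^sub>R T)) * \<nu> (S ^ n))"
      by (simp add: nu_mult_le exp_mem scaleR_mem power_mem S T)
    also have "\<dots> \<le> 2 * D * (B * (M * \<sigma> ^ n))"
      using D_pos M B[of "t - n"] n \<open>0 \<le> B\<close>
      by (intro mult_left_mono mult_mono) (auto intro: nu_nonneg power_mem S)
    \<comment> \<open>Going from \<open>n\<close> to \<open>n + 1\<close> costs the factor
      \<open>1 / \<sigma>\<close> and makes the exponent comparable with \<open>t\<close>, since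
      \<open>t \<le> n + 1\<close>. The 1 added to the final constant keeps it positive even if
      \<open>B = 0\<close>.\<close>
    also have "\<sigma> ^ n = exp (- \<alpha>' * (n + 1)) / \<sigma>"
      by (simp add: \<sigma>(1) exp_of_nat_mult[symmetric] exp_diff[symmetric] algebra_simps)
    also have "2 * D * (B * (M * (exp (- \<alpha>' * (n + 1)) / \<sigma>))) = 2 * D * B * M / \<sigma> * exp (- \<alpha>' * (n + 1))"
      by simp
    also have "\<dots> \<le> (2 * D * B * M / \<sigma> + 1) * exp (- \<alpha>' * t)"
      using n \<sigma>(2) D_pos \<open>0 \<le> B\<close> M by (intro mult_mono) auto
    finally show "\<nu> (exp (t *\<^sub>R T)) \<le> (2 * D * B * M / \<sigma> + 1) * exp (- \<alpha>' * t)" .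
  qed
  moreover have "0 < 2 * D * B * M / \<sigma> + 1" using D_pos \<open>0 \<le> B\<close> M by (smt (verit) divide_nonneg_pos
      mult_nonneg_nonneg)
  ultimately show ?thesis using \<sigma>(2) by blast
qed

end

section \<open>Matrices of size two\<close>

datatype 'a mat2 = Mat2 (m11: 'a) (m12: 'a) (m21: 'a) (m22: 'a)

lemma mat2_eq_iff: "M = N \<longleftrightarrow> m11 M = m11 N \<and> m12 M = m12 N \<and> m21 M = m21 N \<and> m22 M = m22 N"
  by (cases M; cases N) simp

instantiation mat2 :: (real_normed_algebra_1) real_normed_algebra_1
begin

definition "0 = Mat2 0 0 0 0"
definition "1 = Mat2 1 0 0 1"
definition "M + N = Mat2 (m11 M + m11 N) (m12 M + m12 N) (m21 M + m21 N) (m22 M + m22 N)"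
definition "M - N = Mat2 (m11 M - m11 N) (m12 M - m12 N) (m21 M - m21 N) (m22 M - m22 N)"
definition "- M = Mat2 (- m11 M) (- m12 M) (- m21 M) (- m22 M)"
definition "r *\<^sub>R M = Mat2 (r *\<^sub>R m11 M) (r *\<^sub>R m12 M) (r *\<^sub>R m21 M) (r *\<^sub>R m22 M)"
definition "M * N = Mat2
  (m11 M * m11 N + m12 M * m21 N) (m11 M * m12 N + m12 M * m22 N)
  (m21 M * m11 N + m22 M * m21 N) (m21 M * m12 N + m22 M * m22 N)"
text \<open>The maximal row sum is submultiplicative and gives the identity norm 1, both of which
  the class demands.\<close>

definition norm_mat2 :: "'a mat2 \<Rightarrow> real" where
  "norm_mat2 M = max (norm (m11 M) + norm (m12 M)) (norm (m21 M) + norm (m22 M))"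
definition dist_mat2 :: "'a mat2 \<Rightarrow> 'a mat2 \<Rightarrow> real" where
  "dist_mat2 M N = norm (M - N)"
definition sgn_mat2 :: "'a mat2 \<Rightarrow> 'a mat2" where
  "sgn_mat2 M = inverse (norm M) *\<^sub>R M"
definition uniformity_mat2 :: "('a mat2 \<times> 'a mat2) filter" where
  "uniformity_mat2 = (INF e\<in>{0 <..}. principal {(x, y). dist x y < e})"
definition open_mat2 :: "'a mat2 set \<Rightarrow> bool" where
  "open_mat2 U = (\<forall>x\<in>U. eventually (\<lambda>(x', y). x' = x \<longrightarrow> y \<in> U) uniformity)"

lemmas mat2_defs = zero_mat2_def one_mat2_def plus_mat2_def minus_mat2_def uminus_mat2_def
  scaleR_mat2_def times_mat2_def

instance
proof
  fix L M N :: "'a mat2" and a b :: real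
  show "norm (M * N) \<le> norm M * norm N"
  proof -
    have row: "norm (a * m11 N + b * m21 N) + norm (a * m12 N + b * m22 N) \<le> (norm a + norm b) * norm N" for a b
    proof -
      have "norm (a * m11 N + b * m21 N) + norm (a * m12 N + b * m22 N) \<le>
          (norm a * norm (m11 N) + norm b * norm (m21 N)) + (norm a * norm (m12 N) + norm b * norm (m22 N))"
        by (intro add_mono norm_triangle_le norm_mult_ineq)
      also have "\<dots> = norm a * (norm (m11 N) + norm (m12 N)) + norm b * (norm (m21 N) + norm (m22 N))"
        by (simp add: algebra_simps)
      also have "\<dots> \<le> norm a * norm N + norm b * norm N"
        by (intro add_mono mult_left_mono) (auto simp: norm_mat2_def)
      finally show ?thesis by (simp add: algebra_simps)
    qed
    have "norm (M * N) = max (norm (m11 M * m11 N + m12 M * m21 N) + norm (m11 M * m12 N + m12 M * m22 N))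
       (norm (m21 M * m11 N + m22 M * m21 N) + norm (m21 M * m12 N + m22 M * m22 N))"
      by (simp only: norm_mat2_def times_mat2_def mat2.sel)
    also have "\<dots> \<le> max ((norm (m11 M) + norm (m12 M)) * norm N) ((norm (m21 M) + norm (m22 M)) * norm N)"
      using row by (intro max.mono) auto
    also have "\<dots> \<le> norm M * norm N"
      by (intro max.boundedI mult_right_mono) (auto simp: norm_mat2_def le_max_iff_disj)
    finally show ?thesis .
  qed
  show "norm (M + N) \<le> norm M + norm N"
    using norm_triangle_ineq[of "m11 M" "m11 N"] norm_triangle_ineq[of "m12 M" "m12 N"]
      norm_triangle_ineq[of "m21 M" "m21 N"] norm_triangle_ineq[of "m22 M" "m22 N"]
    unfolding norm_mat2_def plus_mat2_def mat2.sel by linarith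
  show "norm (a *\<^sub>R M) = \<bar>a\<bar> * norm M"
    by (simp add: norm_mat2_def scaleR_mat2_def max_mult_distrib_left distrib_left[symmetric])
  show "(norm M = 0) = (M = 0)"
  proof
    have "norm (m11 M) \<le> norm M" "norm (m12 M) \<le> norm M" "norm (m21 M) \<le> norm M" "norm (m22 M) \<le> norm M"
      by (auto simp: norm_mat2_def le_max_iff_disj)
    moreover assume "norm M = 0"
    ultimately show "M = 0" by (simp add: mat2_eq_iff zero_mat2_def)
  qed (simp add: norm_mat2_def zero_mat2_def)
  show "norm (1 :: 'a mat2) = 1" by (simp add: norm_mat2_def one_mat2_def)
qed (auto simp: mat2_eq_iff mat2_defs algebra_simps dist_mat2_def sgn_mat2_def uniformity_mat2_def open_mat2_def)

end

lemma mat2_sel_simps [simp]: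
  "m11 0 = 0" "m12 0 = 0" "m21 0 = 0" "m22 0 = 0"
  "m11 1 = 1" "m12 1 = 0" "m21 1 = 0" "m22 1 = 1"
  "m11 (M + N) = m11 M + m11 N" "m12 (M + N) = m12 M + m12 N"
  "m21 (M + N) = m21 M + m21 N" "m22 (M + N) = m22 M + m22 N"
  "m11 (M - N) = m11 M - m11 N" "m12 (M - N) = m12 M - m12 N"
  "m21 (M - N) = m21 M - m21 N" "m22 (M - N) = m22 M - m22 N"
  "m11 (- M) = - m11 M" "m12 (- M) = - m12 M" "m21 (- M) = - m21 M" "m22 (- M) = - m22 M"
  "m11 (r *\<^sub>R M) = r *\<^sub>R m11 M" "m12 (r *\<^sub>R M) = r *\<^sub>R m12 M"
  "m21 (r *\<^sub>R M) = r *\<^sub>R m21 M" "m22 (r *\<^sub>R M) = r *\<^sub>R m22 M"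
  "m11 (M * N) = m11 M * m11 N + m12 M * m21 N" "m12 (M * N) = m11 M * m12 N + m12 M * m22 N"
  "m21 (M * N) = m21 M * m11 N + m22 M * m21 N" "m22 (M * N) = m21 M * m12 N + m22 M * m22 N"
  by (simp_all add: mat2_defs)

lemma mat2_sum_sel [simp]:
  "m11 (sum f A) = (\<Sum>x\<in>A. m11 (f x))" "m12 (sum f A) = (\<Sum>x\<in>A. m12 (f x))"
  "m21 (sum f A) = (\<Sum>x\<in>A. m21 (f x))" "m22 (sum f A) = (\<Sum>x\<in>A. m22 (f x))"
  by (induction A rule: infinite_finite_induct) auto

lemma norm_mat2_entry_le: "norm (m11 M) \<le> norm M" "norm (m12 M) \<le> norm M" "norm (m21 M) \<le> norm M" "norm (m22 M) \<le> norm M"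
  by (auto simp: norm_mat2_def le_max_iff_disj)

lemma norm_mat2_le_sum: "norm M \<le> norm (m11 M) + norm (m12 M) + norm (m21 M) + norm (m22 M)"
  by (simp add: norm_mat2_def)

lemma bounded_linear_mat2_entry:
  "bounded_linear m11" "bounded_linear m12" "bounded_linear m21" "bounded_linear m22"
  by (rule bounded_linear_intro[where K = 1]; simp add: norm_mat2_entry_le)+

lemma tendsto_mat2I:
  assumes "((\<lambda>x. m11 (f x)) \<longlongrightarrow> m11 L) F" "((\<lambda>x. m12 (f x)) \<longlongrightarrow> m12 L) F"
    "((\<lambda>x. m21 (f x)) \<longlongrightarrow> m21 L) F" "((\<lambda>x. m22 (f x)) \<longlongrightarrow> m22 L) F"
  shows "(f \<longlongrightarrow> L) F"
proof -
  have "((\<lambda>x. norm (m11 (f x) - m11 L) + norm (m12 (f x) - m12 L) + norm (m21 (f x) - m21 L) + norm (m22 (f x) - m22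
      L)) \<longlongrightarrow> 0 + 0 + 0 + 0) F"
    using assms by (intro tendsto_add tendsto_norm_zero) (simp_all add: LIM_zero_iff)
  then have lim: "((\<lambda>x. norm (m11 (f x) - m11 L) + norm (m12 (f x) - m12 L) + norm (m21 (f x) - m21 L) + norm (m22
      (f x) - m22 L)) \<longlongrightarrow> 0) F"
    by (simp only: add_0_left)
  have le: "norm (f x - L) \<le> norm (m11 (f x) - m11 L) + norm (m12 (f x) - m12 L) + norm (m21 (f x) - m21 L) + norm (m22
      (f x) - m22 L)" for x
    using norm_mat2_le_sum[of "f x - L"] by simp
  have "((\<lambda>x. f x - L) \<longlongrightarrow> 0) F"
    by (rule Lim_null_comparison[OF always_eventually[OF allI[OF le]] lim])
  then show ?thesis by (rule LIM_zero_cancel)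
qed

instance mat2 :: ("{real_normed_algebra_1,banach}") banach
proof
  fix X :: "nat \<Rightarrow> 'a mat2"
  assume X: "Cauchy X"
  have "convergent (\<lambda>n. e (X n))" if "bounded_linear e" for e :: "'a mat2 \<Rightarrow> 'a"
    using bounded_linear.Cauchy[OF that X] by (simp add: Cauchy_convergent)
  then have "\<exists>a. (\<lambda>n. e (X n)) \<longlonglongrightarrow> a" if "bounded_linear e" for e :: "'a mat2 \<Rightarrow> 'a"
    using that by (simp add: convergent_def)
  note lim = this[OF bounded_linear_mat2_entry(1)] this[OF bounded_linear_mat2_entry(2)]
    this[OF bounded_linear_mat2_entry(3)] this[OF bounded_linear_mat2_entry(4)]
  from lim obtain a b c d where "(\<lambda>n. m11 (X n)) \<longlonglongrightarrow> a" "(\<lambda>n. m12 (X n)) \<longlonglongrightarrow> b"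
    "(\<lambda>n. m21 (X n)) \<longlonglongrightarrow> c" "(\<lambda>n. m22 (X n)) \<longlonglongrightarrow> d" by blast
  then have "X \<longlonglongrightarrow> Mat2 a b c d" by (intro tendsto_mat2I) auto
  then show "convergent X" by (rule convergentI)
qed

section \<open>Matrices over a differential subalgebra\<close>

text \<open>On the unit interval \<open>z \<le> z powr q\<close>; this is applied to
  \<open>x / (x + y)\<close> and \<open>y / (x + y)\<close>, which add up to 1.\<close>

lemma powr_subadditive:
  fixes x y q :: real
  assumes "0 \<le> x" "0 \<le> y" "0 < q" "q \<le> 1"
  shows "(x + y) powr q \<le> x powr q + y powr q"
proof (cases "x + y = 0")
  case False
  then have s: "0 < x + y" using assms by simp
  have *: "z / (x + y) \<le> (z / (x + y)) powr q" if "0 \<le> z" "z \<le> x + y" for z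
    using powr_mono'[of q 1 "z / (x + y)"] that s assms by simp
  have "1 = x / (x + y) + y / (x + y)" using s by (simp add: add_divide_distrib[symmetric])
  also have "\<dots> \<le> (x / (x + y)) powr q + (y / (x + y)) powr q"
    using assms by (intro add_mono *) auto
  also have "\<dots> = (x powr q + y powr q) / (x + y) powr q"
    using assms s by (simp add: powr_divide add_divide_distrib)
  finally show ?thesis using s by (simp add: field_simps)
qed (use assms in auto)

context differential_subalgebra
begin

definition C2 :: "'b mat2 set" where
  "C2 = {M. m11 M \<in> C \<and> m12 M \<in> C \<and> m21 M \<in> C \<and> m22 M \<in> C}"

definition nu2 :: "'b mat2 \<Rightarrow> real" where
  "nu2 M = \<nu> (m11 M) + \<nu> (m12 M) + \<nu> (m21 M) + \<nu> (m22 M)"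

text \<open>The terms \<open>\<nu> (Y n)\<close> are eventually below 1, and then the norm is at
  most its q-th power.\<close>

lemma nu_summable_norm:
  assumes "\<And>n. Y n \<in> C" "summable (\<lambda>n. \<nu> (Y n))"
  shows "summable Y"
proof (rule summable_comparison_test_ev[OF _ assms(2)])
  have "(\<lambda>n. \<nu> (Y n)) \<longlonglongrightarrow> 0" by (rule summable_LIMSEQ_zero[OF assms(2)])
  then have "\<forall>\<^sub>F n in sequentially. \<nu> (Y n) < 1" by (rule order_tendstoD) simp
  then show "\<forall>\<^sub>F n in sequentially. norm (Y n) \<le> \<nu> (Y n)"
  proof eventually_elim
    case (elim n)
    have le: "norm (Y n) powr q \<le> \<nu> (Y n)" by (rule norm_le_nu[OF assms(1)])
    have "norm (Y n) \<le> 1"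
    proof (rule ccontr)
      assume "\<not> norm (Y n) \<le> 1"
      then have "1 < norm (Y n) powr q" using q_pos by (intro gr_one_powr) auto
      then show False using le elim by simp
    qed
    then have "norm (Y n) powr 1 \<le> norm (Y n) powr q"
      using q_le_1 by (intro powr_mono') auto
    then show ?case using le by simp
  qed
qed

text \<open>Every product of two entries obeys the inequality of the whole matrices, because entries
  are dominated both in \<open>\<nu>\<close> and in norm. The factor 8 counts four entries with two
  products each.\<close>

lemma mat2_subalgebra: "differential_subalgebra C2 nu2 q \<theta> (8 * D)"
proof (rule differential_subalgebra.intro)
  show "1 \<in> C2" by (simp add: C2_def one_mem zero_mem)
  fix S T :: "'b mat2" and c :: real
  assume T: "T \<in> C2"
  note Te = T[unfolded C2_def mem_Collect_eq]
  note nnT = nu_nonneg[of "m11 T"] nu_nonneg[of "m12 T"] nu_nonneg[of "m21 T"] nu_nonneg[of "m22 T"]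
  show "c *\<^sub>R T \<in> C2" using Te by (simp add: C2_def scaleR_mem)
  show "0 \<le> nu2 T" using Te by (simp add: nu2_def nu_nonneg)
  show "nu2 (c *\<^sub>R T) = \<bar>c\<bar> powr q * nu2 T" using Te by (simp add: nu2_def nu_scaleR algebra_simps)
  show "norm T powr q \<le> nu2 T"
  proof -
    have "norm T powr q \<le> (norm (m11 T) + norm (m12 T) + norm (m21 T) + norm (m22 T)) powr q"
      using q_pos by (intro powr_mono2 norm_mat2_le_sum) auto
    also have "\<dots> \<le> norm (m11 T) powr q + norm (m12 T) powr q + norm (m21 T) powr q + norm (m22 T) powr q"
      using powr_subadditive[of "norm (m11 T) + norm (m12 T) + norm (m21 T)" "norm (m22 T)" q]
        powr_subadditive[of "norm (m11 T) + norm (m12 T)" "norm (m21 T)" q]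
        powr_subadditive[of "norm (m11 T)" "norm (m12 T)" q] q_pos q_le_1 by simp
    also have "\<dots> \<le> nu2 T" unfolding nu2_def using Te by (intro add_mono norm_le_nu) auto
    finally show ?thesis .
  qed
  assume S: "S \<in> C2"
  note Se = S[unfolded C2_def mem_Collect_eq]
  note nnS = nu_nonneg[of "m11 S"] nu_nonneg[of "m12 S"] nu_nonneg[of "m21 S"] nu_nonneg[of "m22 S"]
  show "S + T \<in> C2" using Se Te by (simp add: C2_def add_mem)
  show "nu2 (S + T) \<le> nu2 S + nu2 T"
    using Se Te nu_add[of "m11 S" "m11 T"] nu_add[of "m12 S" "m12 T"] nu_add[of "m21 S" "m21 T"] nu_add[of "m22 S" "m22 T"]
    by (simp add: nu2_def)
  show "S * T \<in> C2" using Se Te by (simp add: C2_def add_mem mult_mem)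
  let ?R = "nu2 S powr (1 - \<theta>) * norm S powr (q * \<theta>) * nu2 T + nu2 S * (nu2 T powr (1 - \<theta>) * norm T
      powr (q * \<theta>))"
  have entry: "\<nu> (s * t) \<le> D * ?R"
    if "s \<in> C" "t \<in> C" "\<nu> s \<le> nu2 S" "\<nu> t \<le> nu2 T" "norm s \<le> norm S" "norm t \<le> norm T" for s t
  proof -
    have nn: "0 \<le> \<nu> s" "0 \<le> \<nu> t" "0 \<le> nu2 S" "0 \<le> nu2 T"
      using nu_nonneg[of s] nu_nonneg[of t] that by auto
    have p: "\<nu> s powr (1 - \<theta>) \<le> nu2 S powr (1 - \<theta>)" "\<nu> t powr (1 - \<theta>) \<le> nu2 T powr (1 - \<theta>)"
      "norm s powr (q * \<theta>) \<le> norm S powr (q * \<theta>)" "norm t powr (q * \<theta>) \<le> norm T powr (q * \<theta>)"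
      using that nn q_pos theta_pos theta_less_1 by (auto intro: powr_mono2)
    have "\<nu> s powr (1 - \<theta>) * norm s powr (q * \<theta>) * \<nu> t + \<nu> s * (\<nu> t powr (1 - \<theta>) * norm
        t powr (q * \<theta>)) \<le> ?R"
      by (intro add_mono mult_mono p that(3-6) nn mult_nonneg_nonneg powr_ge_zero)
    from mult_left_mono[OF this less_imp_le[OF D_pos]] show ?thesis
      by (rule order_trans[OF nu_mult[OF that(1,2)]])
  qed
  have leS: "\<nu> (m11 S) \<le> nu2 S" "\<nu> (m12 S) \<le> nu2 S" "\<nu> (m21 S) \<le> nu2 S" "\<nu> (m22 S) \<le> nu2 S"
    using Se nnS by (auto simp: nu2_def)
  have leT: "\<nu> (m11 T) \<le> nu2 T" "\<nu> (m12 T) \<le> nu2 T" "\<nu> (m21 T) \<le> nu2 T" "\<nu> (m22 T) \<le> nu2 T"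
    using Te nnT by (auto simp: nu2_def)
  define R0 where "R0 = D * ?R"
  note entry = entry[folded R0_def]
  have entry2: "\<nu> (s * t + s' * t') \<le> 2 * R0"
    if "s \<in> C" "t \<in> C" "\<nu> s \<le> nu2 S" "\<nu> t \<le> nu2 T" "norm s \<le> norm S" "norm t \<le> norm T"
      "s' \<in> C" "t' \<in> C" "\<nu> s' \<le> nu2 S" "\<nu> t' \<le> nu2 T" "norm s' \<le> norm S" "norm t' \<le> norm T" for s t s' t'
  proof -
    have "\<nu> (s * t + s' * t') \<le> \<nu> (s * t) + \<nu> (s' * t')"
      by (intro nu_add mult_mem that)
    also have "\<dots> \<le> R0 + R0" by (intro add_mono entry that)
    finally show ?thesis by simp
  qed
  have "\<nu> (m11 (S * T)) \<le> 2 * R0" "\<nu> (m12 (S * T)) \<le> 2 * R0"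
    "\<nu> (m21 (S * T)) \<le> 2 * R0" "\<nu> (m22 (S * T)) \<le> 2 * R0"
    unfolding mat2_sel_simps
    by (rule entry2; use Se Te leS leT norm_mat2_entry_le[of S] norm_mat2_entry_le[of T] in simp)+
  then have "nu2 (S * T) \<le> 8 * R0" unfolding nu2_def[of "S * T"] by linarith
  then show "nu2 (S * T) \<le> 8 * D * ?R" by (simp add: R0_def)
next
  fix Y :: "nat \<Rightarrow> 'b mat2"
  assume "\<And>n. Y n \<in> C2" and sm: "summable (\<lambda>n. nu2 (Y n))"
  then have Y: "m11 (Y n) \<in> C" "m12 (Y n) \<in> C" "m21 (Y n) \<in> C" "m22 (Y n) \<in> C" for n
    by (auto simp: C2_def)
  have sme: "summable (\<lambda>n. \<nu> (m11 (Y n)))" "summable (\<lambda>n. \<nu> (m12 (Y n)))"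
      "summable (\<lambda>n. \<nu> (m21 (Y n)))" "summable (\<lambda>n. \<nu> (m22 (Y n)))"
    by (rule summable_comparison_test'[OF sm, of 0]; use Y in \<open>simp add: nu2_def nu_nonneg\<close>)+
  have smY: "summable Y"
  proof -
    have s: "summable (\<lambda>n. m11 (Y n))" "summable (\<lambda>n. m12 (Y n))" "summable (\<lambda>n. m21 (Y n))"
        "summable (\<lambda>n. m22 (Y n))"
      using Y sme by (auto intro: nu_summable_norm)
    have "Y sums Mat2 (\<Sum>n. m11 (Y n)) (\<Sum>n. m12 (Y n)) (\<Sum>n. m21 (Y n)) (\<Sum>n. m22 (Y n))"
      unfolding sums_def
      using s[THEN summable_LIMSEQ] by (intro tendsto_mat2I) simp_all
    then show ?thesis by (rule sums_summable)
  qed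
  have e: "m11 (suminf Y) = (\<Sum>n. m11 (Y n))" "m12 (suminf Y) = (\<Sum>n. m12 (Y n))"
    "m21 (suminf Y) = (\<Sum>n. m21 (Y n))" "m22 (suminf Y) = (\<Sum>n. m22 (Y n))"
    by (simp_all add: bounded_linear.suminf[OF _ smY] bounded_linear_mat2_entry)
  show "(\<Sum>n. Y n) \<in> C2" unfolding C2_def mem_Collect_eq e by (intro conjI suminf_mem Y sme)
  have "nu2 (\<Sum>n. Y n) \<le> (\<Sum>n. \<nu> (m11 (Y n))) + (\<Sum>n. \<nu> (m12 (Y n))) + (\<Sum>n. \<nu> (m21 (Y n)))
      + (\<Sum>n. \<nu> (m22 (Y n)))"
    unfolding nu2_def e by (intro add_mono nu_suminf Y sme)
  also have "\<dots> = (\<Sum>n. nu2 (Y n))"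
    unfolding nu2_def by (simp add: suminf_add[symmetric] summable_add sme)
  finally show "nu2 (\<Sum>n. Y n) \<le> (\<Sum>n. nu2 (Y n))" .
qed (use q_pos q_le_1 theta_pos theta_less_1 D_pos in auto)

end

section \<open>Binomial series\<close>

text \<open>The Taylor coefficients of \<open>(1 - z) powr (- c)\<close>: the inverse square root
  for \<open>c = 1/2\<close>, the square root for \<open>c = - (1/2)\<close>, the geometric series
  for \<open>c = 1\<close>.\<close>

definition rising_coeff :: "real \<Rightarrow> nat \<Rightarrow> real" where
  "rising_coeff c n = pochhammer c n / fact n"

lemma rising_coeff_gbinomial: "rising_coeff c n = (-1) ^ n * (- c gchoose n)"
  by (simp add: rising_coeff_def gbinomial_pochhammer mult.assoc[symmetric] power_mult_distrib[symmetric])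

lemma rising_coeff_convolution:
  "(\<Sum>k\<le>n. rising_coeff a k * rising_coeff b (n - k)) = rising_coeff (a + b) n"
proof -
  have "(\<Sum>k\<le>n. rising_coeff a k * rising_coeff b (n - k)) =
      (\<Sum>k\<le>n. (-1) ^ n * ((- a gchoose k) * (- b gchoose (n - k))))"
  proof (rule sum.cong[OF refl])
    fix k assume "k \<in> {..n}"
    then have "(-1 :: real) ^ n = (-1) ^ k * (-1) ^ (n - k)" by (simp flip: power_add)
    then show "rising_coeff a k * rising_coeff b (n - k) = (-1) ^ n * ((- a gchoose k) * (- b gchoose (n - k)))"
      by (simp add: rising_coeff_gbinomial)
  qed
  also have "\<dots> = (-1) ^ n * (- a + - b gchoose n)"
    by (simp only: sum_distrib_left[symmetric] atMost_atLeast0 gbinomial_Vandermonde)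
  also have "\<dots> = rising_coeff (a + b) n" by (simp add: rising_coeff_gbinomial)
  finally show ?thesis .
qed

lemma rising_coeff_0 [simp]: "rising_coeff c 0 = 1"
  by (simp add: rising_coeff_def)

lemma rising_coeff_1 [simp]: "rising_coeff 1 n = 1"
  by (simp add: rising_coeff_def pochhammer_fact[symmetric])

lemma rising_coeff_minus_1: "rising_coeff (-1) n = (if n = 0 then 1 else if n = 1 then -1 else 0)"
proof (cases n)
  case (Suc m)
  then show ?thesis by (cases m) (simp_all add: rising_coeff_def pochhammer_rec)
qed simp

text \<open>The inverse square root squares to the geometric series. Hence a convolution with
  nonnegative terms equals 1, and the coefficient is one of these terms.\<close>

lemma rising_coeff_half: "0 \<le> rising_coeff (1/2) n" "rising_coeff (1/2) n \<le> 1"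
proof -
  have nn: "0 \<le> rising_coeff (1/2) n" for n
    by (simp add: rising_coeff_def pochhammer_nonneg)
  show "0 \<le> rising_coeff (1/2) n" by (rule nn)
  have "rising_coeff (1/2) n = (\<Sum>k\<in>{0}. rising_coeff (1/2) k * rising_coeff (1/2) (n - k))" by simp
  also have "\<dots> \<le> (\<Sum>k\<le>n. rising_coeff (1/2) k * rising_coeff (1/2) (n - k))"
    by (rule sum_mono2) (auto intro: mult_nonneg_nonneg nn)
  also have "\<dots> = 1" by (simp add: rising_coeff_convolution)
  finally show "rising_coeff (1/2) n \<le> 1" .
qed

lemma rising_coeff_minus_half_nonpos: "0 < n \<Longrightarrow> rising_coeff (- (1/2)) n \<le> 0"
  by (cases n) (auto simp: rising_coeff_def pochhammer_rec intro!: divide_nonneg_nonneg pochhammer_nonneg)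

text \<open>All coefficients after the first are nonpositive, and convolution with the geometric
  series shows that the partial sums are the coefficients for \<open>1/2\<close>, hence nonnegative.
  This yields absolute convergence on the closed unit ball, which the square root of a positive
  operator requires.\<close>

lemma sum_abs_rising_coeff_minus_half: "(\<Sum>k<n. \<bar>rising_coeff (- (1/2)) (Suc k)\<bar>) \<le> 1"
proof -
  have "(\<Sum>k<n. \<bar>rising_coeff (- (1/2)) (Suc k)\<bar>) = - (\<Sum>k<n. rising_coeff (- (1/2)) (Suc k))"
    unfolding sum_negf[symmetric] by (rule sum.cong) (simp_all add: abs_of_nonpos[OF rising_coeff_minus_half_nonpos])
  also have "(\<Sum>k<n. rising_coeff (- (1/2)) (Suc k)) = (\<Sum>k\<le>n. rising_coeff (- (1/2)) k) - 1"
    by (simp add: lessThan_Suc_atMost[symmetric] sum.lessThan_Suc_shift del: sum.lessThan_Suc)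
  also have "(\<Sum>k\<le>n. rising_coeff (- (1/2)) k) = rising_coeff (1/2) n"
    using rising_coeff_convolution[of "- (1/2)" 1 n] by simp
  finally show ?thesis using rising_coeff_half(1)[of n] by simp
qed

lemma summable_abs_rising_coeff_minus_half: "summable (\<lambda>n. \<bar>rising_coeff (- (1/2)) n\<bar>)"
proof -
  have "summable (\<lambda>k. \<bar>rising_coeff (- (1/2)) (Suc k)\<bar>)"
    by (rule summableI_nonneg_bounded[of _ 1]) (use sum_abs_rising_coeff_minus_half in auto)
  then show ?thesis by (subst (asm) summable_Suc_iff)
qed

lemma rising_series_mult:
  fixes e :: "'a::{real_normed_algebra_1,banach}"
  assumes "summable (\<lambda>n. norm (rising_coeff a n *\<^sub>R e ^ n))" "summable (\<lambda>n. norm (rising_coeff b n *\<^sub>R e ^ n))"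
  shows "(\<Sum>n. rising_coeff a n *\<^sub>R e ^ n) * (\<Sum>n. rising_coeff b n *\<^sub>R e ^ n) = (\<Sum>n. rising_coeff
      (a + b) n *\<^sub>R e ^ n)"
  unfolding Cauchy_product[OF assms]
proof (rule suminf_cong)
  fix n
  have "(\<Sum>i\<le>n. rising_coeff a i *\<^sub>R e ^ i * rising_coeff b (n - i) *\<^sub>R e ^ (n - i)) =
      (\<Sum>i\<le>n. (rising_coeff a i * rising_coeff b (n - i)) *\<^sub>R e ^ n)"
    by (rule sum.cong) (auto simp flip: power_add)
  then show "(\<Sum>i\<le>n. rising_coeff a i *\<^sub>R e ^ i * rising_coeff b (n - i) *\<^sub>R e ^ (n - i)) = rising_coeff
      (a + b) n *\<^sub>R e ^ n"
    by (simp only: scaleR_left.sum[symmetric] rising_coeff_convolution)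
qed

lemma commute_suminf:
  fixes f :: "nat \<Rightarrow> 'a::real_normed_algebra"
  assumes "summable f" "\<And>n. x * f n = f n * x"
  shows "x * suminf f = suminf f * x"
  using suminf_mult[OF assms(1), of x] suminf_mult2[OF assms(1), of x] assms(2) by simp

section \<open>Inverses and inverse square roots near the identity\<close>

lemma inverse_near_one:
  fixes x y :: "'a::real_normed_algebra_1"
  assumes "(1 + x) * y = 1" "norm x \<le> 1/32"
  shows "norm (y - 1) \<le> 1/16"
proof -
  have e: "y = 1 - x * y" using assms(1) by (simp add: distrib_right eq_diff_eq)
  have xy: "norm (x * y) \<le> 1/32 * norm y"
    by (rule order_trans[OF norm_mult_ineq mult_right_mono]) (use assms in auto)
  have "norm y \<le> 1 + norm (x * y)" using norm_triangle_ineq4[of 1 "x * y"] e by simp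
  then have "norm y \<le> 2" using xy by simp
  moreover have "y - 1 = - (x * y)" using assms(1) by (simp add: distrib_right eq_neg_iff_add_eq_0 diff_add_eq)
  ultimately show ?thesis using xy by simp
qed

lemma one_plus_small_inverse:
  fixes x :: "'a::{real_normed_algebra_1,banach}"
  assumes "norm x \<le> 1/32"
  shows "\<exists>y. (1 + x) * y = 1 \<and> y * (1 + x) = 1 \<and> norm (y - 1) \<le> 1/16"
proof -
  have "summable (\<lambda>n. (- x) ^ n)"
    by (rule summable_comparison_test'[of "\<lambda>n. norm x ^ n" 0])
      (use assms norm_power_ineq[of "- x"] in \<open>auto intro!: summable_geometric\<close>)
  from geometric_inverse[OF this] obtain y where "(1 + x) * y = 1" "y * (1 + x) = 1" by auto
  then show ?thesis using inverse_near_one[OF _ assms] by blast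
qed

text \<open>
  The map \<open>p \<mapsto> 1/2 + (p - 1/2) (1 - 4 (p - p\<^sup>2))\<^sup>-\<^sup>1\<^sup>/\<^sup>2\<close> yields the
  projection onto the part of the spectrum
  of \<open>p\<close> near \<open>1\<close> along the part near \<open>0\<close>. It yields \<open>1\<close> if all of the
  spectrum is near \<open>1\<close>.
\<close>

lemma rising_series_near_one:
  fixes p :: "'a::{real_normed_algebra_1,banach}"
  assumes p: "norm (p - 1) \<le> 1/16"
  shows "norm (4 *\<^sub>R (p - p * p)) \<le> 1/3"
    and "(p - (1/2) *\<^sub>R 1) * (\<Sum>n. rising_coeff (1/2) n *\<^sub>R (4 *\<^sub>R (p - p * p)) ^ n) = (1/2) *\<^sub>R 1"
proof -
  define e where "e = 4 *\<^sub>R (p - p * p)"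
  \<comment> \<open>\<open>s * s = 1 - e\<close> and \<open>w\<close> is the inverse square root of
    \<open>1 - e\<close>, so \<open>s * w\<close> squares to 1. Being close to 1, it must equal
    1.\<close>
  define s where "s = 2 *\<^sub>R p - 1"
  define w where "w = (\<Sum>n. rising_coeff (1/2) n *\<^sub>R e ^ n)"
  have "norm p \<le> 17/16" using norm_triangle_ineq[of "p - 1" 1] p by simp
  then have "norm (p * (p - 1)) \<le> 17/16 * (1/16)"
    by (intro order_trans[OF norm_mult_ineq mult_mono]) (use p in auto)
  moreover have "norm e = 4 * norm (p * (p - 1))"
    by (simp add: e_def right_diff_distrib norm_minus_commute)
  ultimately have e: "norm e \<le> 1/3" by simp
  then show "norm (4 *\<^sub>R (p - p * p)) \<le> 1/3" by (simp add: e_def)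
  have geo: "summable (\<lambda>n. norm e ^ n)" using e by (intro summable_geometric) auto
  have term_le: "norm (rising_coeff (1/2) n *\<^sub>R e ^ n) \<le> norm e ^ n" for n
    using mult_mono[of "\<bar>rising_coeff (1/2) n\<bar>" 1 "norm (e ^ n)" "norm e ^ n"] rising_coeff_half[of n] norm_power_ineq[of e n]
    by simp
  have smn: "summable (\<lambda>n. norm (rising_coeff (1/2) n *\<^sub>R e ^ n))"
    by (rule summable_comparison_test'[OF geo, of 0]) (use term_le in simp)
  have sm: "summable (\<lambda>n. rising_coeff (1/2) n *\<^sub>R e ^ n)" by (rule summable_norm_cancel[OF smn])
  have sme: "summable (\<lambda>n. e ^ n)"
    by (rule summable_comparison_test'[OF geo, of 0]) (simp add: norm_power_ineq)
  have "w * w = (\<Sum>n. e ^ n)"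
    unfolding w_def using rising_series_mult[OF smn smn] by simp
  also have "\<dots> * (1 - e) = 1"
  proof -
    have "(\<Sum>n. e ^ n) = 1 + (\<Sum>n. e ^ n) * e"
      using suminf_split_head[OF sme] suminf_mult2[OF sme, of e] by (simp add: power_commutes)
    then show ?thesis by (simp add: right_diff_distrib diff_eq_eq)
  qed
  finally have ww: "w * w * (1 - e) = 1" .
  have f4: "4 *\<^sub>R y = y + y + (y + y)" for y :: 'a
    using scaleR_add_left[of 2 2 y] by (simp add: scaleR_2)
  have ss: "s * s = 1 - e" by (simp add: s_def e_def algebra_simps scaleR_2 f4)
  have "s * e = e * s" by (simp add: s_def e_def algebra_simps)
  then have "s * e ^ n = e ^ n * s" for n by (rule power_commuting_commutes[symmetric, OF sym])
  then have sw: "s * w = w * s" unfolding w_def by (intro commute_suminf sm) simp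
  have "(s * w) * (s * w) = w * w * (s * s)" using sw by (metis mult.assoc)
  then have sq: "(s * w) * (s * w) = 1" using ww ss by simp
  have w1: "norm (w - 1) \<le> 1/2"
  proof -
    have geoS: "summable (\<lambda>n. norm e ^ Suc n)" using geo by (subst summable_Suc_iff)
    have "w - 1 = (\<Sum>n. rising_coeff (1/2) (Suc n) *\<^sub>R e ^ Suc n)"
      unfolding w_def using suminf_split_head[OF sm] by simp
    also have "norm \<dots> \<le> (\<Sum>n. norm e ^ Suc n)"
      by (rule norm_suminf_le[OF _ geoS]) (rule term_le)
    also have "\<dots> = norm e / (1 - norm e)"
      using e geo by (simp add: suminf_mult suminf_geometric)
    also have "\<dots> \<le> 1/2" using e by (simp add: divide_le_eq)
    finally show ?thesis .
  qed
  define z where "z = s * w - 1"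
  have "s - 1 = 2 *\<^sub>R (p - 1)" by (simp add: s_def algebra_simps scaleR_2)
  then have s1: "norm (s - 1) \<le> 1/8" using p by simp
  have "norm w \<le> 3/2" using norm_triangle_ineq[of "w - 1" 1] w1 by simp
  then have "norm ((s - 1) * w) \<le> 1/8 * (3/2)"
    by (intro order_trans[OF norm_mult_ineq mult_mono]) (use s1 in auto)
  moreover have "z = (s - 1) * w + (w - 1)" by (simp add: z_def algebra_simps)
  ultimately have z1: "norm z < 1" using norm_triangle_ineq[of "(s - 1) * w" "w - 1"] w1 by simp
  \<comment> \<open>With \<open>norm z < 1\<close> this relation leaves only \<open>z = 0\<close>,
    so -1 is excluded from the spectrum of \<open>s * w\<close>.\<close>
  have "2 *\<^sub>R z = - (z * z)" using sq by (simp add: z_def algebra_simps scaleR_2)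
  then have "2 * norm z = norm (z * z)" by (metis norm_minus_cancel norm_scaleR abs_numeral)
  also have "\<dots> \<le> norm z * norm z" by (rule norm_mult_ineq)
  also have "\<dots> \<le> 1 * norm z" using z1 by (intro mult_right_mono) auto
  finally have "z = 0" by simp
  then have "s * w = 1" by (simp add: z_def)
  moreover have "p - (1/2) *\<^sub>R 1 = (1/2) *\<^sub>R s" by (simp add: s_def algebra_simps)
  ultimately show "(p - (1/2) *\<^sub>R 1) * (\<Sum>n. rising_coeff (1/2) n *\<^sub>R (4 *\<^sub>R (p - p * p)) ^ n) = (1/2) *\<^sub>R 1"
    by (simp add: w_def e_def)
qed

text \<open>Serves both to move exponentials through the solution of a Sylvester equation and to
  split an exponential along a coordinate projection.\<close>

lemma exp_intertwine:
  fixes A B Z :: "'a::{real_normed_algebra_1,banach}"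
  assumes "A * Z = Z * B"
  shows "exp A * Z = Z * exp B"
proof -
  have "A ^ n * Z = Z * B ^ n" for n
    by (induction n) (simp_all add: assms mult.assoc, metis assms mult.assoc)
  then have "(\<Sum>n. (A ^ n /\<^sub>R fact n) * Z) = (\<Sum>n. Z * (B ^ n /\<^sub>R fact n))" by simp
  then show ?thesis
    unfolding exp_def by (simp only: suminf_mult suminf_mult2 summable_exp_generic)
qed

section \<open>Matrices leaving a graph invariant\<close>

text \<open>
  The matrices that leave the graph of \<open>X\<close>, the set of the pairs \<open>(x, X x)\<close>, invariant. The coordinate change
  \<open>(x, y) \<mapsto> (x, y - X x)\<close> makes them upper triangular with diagonal entries \<open>diag1 X M\<close>
  and \<open>diag2 X M\<close>.
\<close>

definition graph_inv :: "'a::real_normed_algebra_1 \<Rightarrow> 'a mat2 set" where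
  "graph_inv X = {M. m21 M + m22 M * X = X * (m11 M + m12 M * X)}"

definition diag1 :: "'a::real_normed_algebra_1 \<Rightarrow> 'a mat2 \<Rightarrow> 'a" where
  "diag1 X M = m11 M + m12 M * X"

definition diag2 :: "'a::real_normed_algebra_1 \<Rightarrow> 'a mat2 \<Rightarrow> 'a" where
  "diag2 X M = m22 M - X * m12 M"

text \<open>In the adapted coordinates these are products of upper triangular matrices, so diagonal
  entries multiply.\<close>

lemma graph_inv_mult:
  assumes "M \<in> graph_inv X" "N \<in> graph_inv X"
  shows "M * N \<in> graph_inv X" "diag1 X (M * N) = diag1 X M * diag1 X N" "diag2 X (M * N) = diag2 X M * diag2 X N"
proof -
  have M: "m21 M = X * (m11 M + m12 M * X) - m22 M * X" and N: "m21 N = X * (m11 N + m12 N * X) - m22 N * X"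
    using assms by (simp_all add: graph_inv_def eq_diff_eq)
  show "M * N \<in> graph_inv X" by (simp add: graph_inv_def M N algebra_simps)
  show "diag1 X (M * N) = diag1 X M * diag1 X N" by (simp add: diag1_def N algebra_simps)
  show "diag2 X (M * N) = diag2 X M * diag2 X N" by (simp add: diag2_def M algebra_simps)
qed

lemma bounded_linear_diag:
  "bounded_linear (diag1 X)" "bounded_linear (diag2 X)"
  unfolding diag1_def[abs_def] diag2_def[abs_def]
  by (intro bounded_linear_add bounded_linear_sub bounded_linear_mat2_entry
      bounded_linear_compose[OF bounded_linear_mult_left bounded_linear_mat2_entry(2)]
      bounded_linear_compose[OF bounded_linear_mult_right bounded_linear_mat2_entry(2)])+

lemma graph_inv_linear:
  "\<lbrakk>M \<in> graph_inv X; N \<in> graph_inv X\<rbrakk> \<Longrightarrow> M + N \<in> graph_inv X"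
  "\<lbrakk>M \<in> graph_inv X; N \<in> graph_inv X\<rbrakk> \<Longrightarrow> M - N \<in> graph_inv X"
  "M \<in> graph_inv X \<Longrightarrow> c *\<^sub>R M \<in> graph_inv X"
  by (simp_all add: graph_inv_def algebra_simps flip: scaleR_add_right)

lemma graph_inv_one: "1 \<in> graph_inv X"
  by (simp add: graph_inv_def)

lemma diag_simps [simp]:
  "diag1 X 1 = 1" "diag1 X (M + N) = diag1 X M + diag1 X N" "diag1 X (M - N) = diag1 X M - diag1 X N"
  "diag1 X (c *\<^sub>R M) = c *\<^sub>R diag1 X M"
  "diag2 X 1 = 1" "diag2 X (M + N) = diag2 X M + diag2 X N" "diag2 X (M - N) = diag2 X M - diag2 X N"
  "diag2 X (c *\<^sub>R M) = c *\<^sub>R diag2 X M"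
  by (simp_all add: diag1_def diag2_def algebra_simps)

lemma graph_inv_power:
  assumes "M \<in> graph_inv X"
  shows "M ^ n \<in> graph_inv X" "diag1 X (M ^ n) = diag1 X M ^ n" "diag2 X (M ^ n) = diag2 X M ^ n"
  using assms by (induction n) (simp_all add: graph_inv_mult graph_inv_one)

lemma graph_inv_suminf:
  fixes X :: "'a::{real_normed_algebra_1,banach}"
  assumes "summable Y" "\<And>n. Y n \<in> graph_inv X"
  shows "suminf Y \<in> graph_inv X" "diag1 X (suminf Y) = (\<Sum>n. diag1 X (Y n))" "diag2 X (suminf Y) = (\<Sum>n. diag2 X (Y n))"
proof -
  \<comment> \<open>The lower left entry in the adapted coordinates. Invariance of the graph is the
    kernel of this bounded linear map and so passes to limits.\<close>
  define f where "f M = m21 M + m22 M * X - X * (m11 M + m12 M * X)" for M :: "'a mat2"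
  have bl: "bounded_linear f"
    unfolding f_def[abs_def]
    by (intro bounded_linear_add bounded_linear_sub bounded_linear_mat2_entry
        bounded_linear_compose[OF bounded_linear_mult_left] bounded_linear_compose[OF bounded_linear_mult_right])
  have f: "f M = 0 \<longleftrightarrow> M \<in> graph_inv X" for M by (simp add: f_def graph_inv_def)
  have "f (Y n) = 0" for n by (simp only: f assms(2))
  then have "f (suminf Y) = 0" by (simp add: bounded_linear.suminf[OF bl assms(1)])
  then show "suminf Y \<in> graph_inv X" by (simp only: f)
qed (rule bounded_linear.suminf[OF _ assms(1)], rule bounded_linear_diag)+

lemma graph_inv_exp:
  fixes X :: "'a::{real_normed_algebra_1,banach}"
  assumes "M \<in> graph_inv X"
  shows "exp M \<in> graph_inv X" "diag1 X (exp M) = exp (diag1 X M)" "diag2 X (exp M) = exp (diag2 X M)"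
  unfolding exp_def
  using graph_inv_suminf[OF summable_exp_generic, of M X] assms
  by (simp_all add: graph_inv_power graph_inv_linear)

lemma graph_inv_inverse:
  fixes X :: "'a::{real_normed_algebra_1,banach}"
  assumes M: "M \<in> graph_inv X" and a: "diag1 X M * a = 1" "a * diag1 X M = 1" and d: "diag2 X M * d = 1" "d * diag2 X M = 1"
  shows "\<exists>N \<in> graph_inv X. M * N = 1 \<and> N * M = 1 \<and> diag1 X N = a \<and> diag2 X N = d"
proof -
  \<comment> \<open>The upper right entry of the inverse of the triangular form; \<open>N\<close> is
    that inverse carried back to the original coordinates.\<close>
  define b where "b = - (a * m12 M * d)"
  define N where "N = Mat2 (a - b * X) b (X * (a - b * X) - d * X) (X * b + d)"
  have N: "N \<in> graph_inv X" "diag1 X N = a" "diag2 X N = d"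
    by (simp_all add: N_def graph_inv_def diag1_def diag2_def algebra_simps)
  have m12: "m12 (M * N) = 0" "m12 (N * M) = 0"
  proof -
    have "m12 (M * N) = diag1 X M * b + m12 M * d" by (simp add: N_def diag1_def algebra_simps)
    also have "\<dots> = 0" using a by (simp add: b_def mult.assoc[symmetric])
    finally show "m12 (M * N) = 0" .
    have "m12 (N * M) = a * m12 M + b * diag2 X M" by (simp add: N_def diag2_def algebra_simps)
    also have "\<dots> = 0" using d by (simp add: b_def mult.assoc)
    finally show "m12 (N * M) = 0" .
  qed
  have one: "L = 1" if L: "L \<in> graph_inv X" "diag1 X L = 1" "diag2 X L = 1" "m12 L = 0" for L
    using L by (simp add: graph_inv_def diag1_def diag2_def mat2_eq_iff)
  have "M * N = 1" by (rule one) (use graph_inv_mult[OF M N(1)] N a d m12 in simp_all)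
  moreover have "N * M = 1" by (rule one) (use graph_inv_mult[OF N(1) M] N a d m12 in simp_all)
  ultimately show ?thesis using N by blast
qed

text \<open>Scaling the second coordinate by a small \<open>\<epsilon>\<close> pushes the
  off-diagonal entry of the triangular form below \<open>\<rho>\<close>, so that row sums are at
  most \<open>2 * \<rho>\<close>. The change of coordinates affects only the constant
  \<open>c\<close>.\<close>

lemma graph_inv_power_bound:
  fixes X :: "'a::real_normed_algebra_1"
  assumes M: "M \<in> graph_inv X" and \<rho>: "0 < \<rho>" "norm (diag1 X M) \<le> \<rho>" "norm (diag2 X M) \<le> \<rho>"
  shows "\<exists>c. \<forall>n. norm (M ^ n) \<le> c * (2 * \<rho>) ^ n"
proof -
  define \<epsilon> where "\<epsilon> = \<rho> / (norm (m12 M) + 1)"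
  have pos: "0 < norm (m12 M) + 1" by (smt (verit) norm_ge_zero)
  have \<epsilon>: "0 < \<epsilon>" "\<epsilon> * norm (m12 M) \<le> \<rho>"
    using \<rho> pos unfolding \<epsilon>_def by (simp_all add: field_simps)
  define K where "K = Mat2 1 0 X (\<epsilon> *\<^sub>R 1)"
  define J where "J = Mat2 1 0 (- (inverse \<epsilon> *\<^sub>R X)) (inverse \<epsilon> *\<^sub>R 1)"
  define L where "L = Mat2 (diag1 X M) (\<epsilon> *\<^sub>R m12 M) 0 (diag2 X M)"
  have JK: "J * K = 1" "K * J = 1" using \<epsilon> by (simp_all add: J_def K_def mat2_eq_iff)
  have "M * K = K * L"
    using M by (simp add: K_def L_def mat2_eq_iff diag1_def diag2_def graph_inv_def algebra_simps)
  then have step: "M = K * L * J" using JK by (metis mult.assoc mult_1_right)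
  have "M ^ n = K * L ^ n * J" for n
  proof (induction n)
    case (Suc n)
    have "M ^ Suc n = K * L * (J * K) * L ^ n * J" using Suc step by (simp add: mult.assoc)
    then show ?case using JK by (simp add: mult.assoc)
  qed (use JK in simp)
  moreover have "norm L \<le> 2 * \<rho>"
    using \<epsilon> \<rho> by (simp add: L_def norm_mat2_def)
  ultimately have "norm (M ^ n) \<le> norm K * norm J * (2 * \<rho>) ^ n" for n
  proof -
    have "norm (K * L ^ n * J) \<le> norm K * norm (L ^ n) * norm J"
      by (rule order_trans[OF norm_mult_ineq mult_right_mono[OF norm_mult_ineq]]) simp
    also have "\<dots> \<le> norm K * (2 * \<rho>) ^ n * norm J"
      using \<open>norm L \<le> 2 * \<rho>\<close> by (intro mult_right_mono mult_left_mono order_trans[OF norm_power_ineq power_mono]) auto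
    finally show ?thesis using \<open>M ^ n = K * L ^ n * J\<close> by (simp add: mult_ac)
  qed
  then show ?thesis by blast
qed

section \<open>Adjoints and coercive operators\<close>

lemma Re_cinner: "Re (cinner x y) = inner x y"
  unfolding cinner_def inner_ell2_def by (rule infsum_Re[OF summable_coord_mult, symmetric])

lemma cinner_scaleC_left: "cinner (c *\<^sub>C x) y = c * cinner x y"
  by (simp add: cinner_def scaleC_ell2.rep_eq mult.assoc infsum_cmult_right')

lemma cinner_add_left: "cinner (x + x') y = cinner x y + cinner x' y"
  unfolding cinner_def by (simp add: distrib_right infsum_add[OF summable_coord_mult summable_coord_mult])

lemma cinner_commute: "cinner x y = cnj (cinner y x)"
  unfolding cinner_def by (simp add: mult.commute flip: infsum_cnj)

lemma inner_scaleC_left: "inner (c *\<^sub>C x) y = Re (c * cinner x y)"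
  by (simp only: Re_cinner[symmetric] cinner_scaleC_left)

text \<open>The scalars 1 and -i pick out the real and the imaginary part. Identities for the
  complex pairing thus reduce to the real inner product of the type class.\<close>

lemma cinner_eq_iff_inner: "cinner x y = cinner u v \<longleftrightarrow> (\<forall>c. inner (c *\<^sub>C x) y = inner (c *\<^sub>C u) v)"
proof
  assume *: "\<forall>c. inner (c *\<^sub>C x) y = inner (c *\<^sub>C u) v"
  show "cinner x y = cinner u v"
    using *[rule_format, of 1] *[rule_format, of "- \<i>"] by (simp add: inner_scaleC_left complex_eq_iff)
qed (simp add: inner_scaleC_left)

lemma app_scaleC: "T \<cdot> (c *\<^sub>C x) = c *\<^sub>C (T \<cdot> x)"
  unfolding app_def by (rule blinfun_of_scaleC)

lemma bounded_linear_app: "bounded_linear (\<lambda>x. T \<cdot> x)"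
  unfolding app_def by (rule blinfun.bounded_linear_right)

lemma norm_app_le: "norm (T \<cdot> x) \<le> norm T * norm x"
  unfolding app_def norm_ell2_op.rep_eq by (rule norm_blinfun)

lemma ell2_op_eqI: "(\<And>x. S \<cdot> x = T \<cdot> x) \<Longrightarrow> S = T"
  unfolding app_def by (metis blinfun_eqI blinfun_of_inject)

lemma norm_ell2_op_bound: "0 \<le> K \<Longrightarrow> (\<And>x. norm (T \<cdot> x) \<le> K * norm x) \<Longrightarrow> norm T \<le> K"
  unfolding app_def norm_ell2_op.rep_eq by (rule norm_blinfun_bound)

lemma bounded_linear_app_left: "bounded_linear (\<lambda>T. T \<cdot> x)"
  by (rule bounded_linear_intro[where K = "norm x"]) (auto simp: norm_app_le)

lemmas app_linear_simps =
  bounded_linear.linear[OF bounded_linear_app, THEN linear_add]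
  bounded_linear.linear[OF bounded_linear_app, THEN linear_diff]
  bounded_linear.linear[OF bounded_linear_app, THEN linear_neg]
  bounded_linear.linear[OF bounded_linear_app, THEN linear_0]
  bounded_linear.linear[OF bounded_linear_app, THEN linear_cmul]

lemma ell2_op_exists:
  fixes f :: "'i ell2 \<Rightarrow> 'i ell2"
  assumes add: "\<And>x y. f (x + y) = f x + f y" and scale: "\<And>c x. f (c *\<^sub>C x) = c *\<^sub>C f x"
    and bound: "\<And>x. norm (f x) \<le> norm x * K"
  shows "\<exists>T. \<forall>x. T \<cdot> x = f x"
proof -
  have sc: "r *\<^sub>R x = complex_of_real r *\<^sub>C x" for r and x :: "'i ell2"
    by (rule ell2_eqI) (simp add: scaleC_ell2.rep_eq)
  have bl: "bounded_linear f"
    by (rule bounded_linear_intro[where K = K]) (auto simp: add bound sc scale)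
  then have "T \<cdot> x = f x" if "T = Abs_ell2_op (Blinfun f)" for T x
    unfolding app_def that by (subst Abs_ell2_op_inverse) (auto simp: bounded_linear_Blinfun_apply scale)
  then show ?thesis by blast
qed

definition unit_vec :: "'i \<Rightarrow> 'i ell2" where
  "unit_vec j = Abs_ell2 (\<lambda>i. if i = j then 1 else 0)"

lemma coord_unit_vec: "coord (unit_vec j) i = (if i = j then 1 else 0)"
proof -
  have "(\<lambda>i. (cmod (if i = j then 1 else 0))\<^sup>2) summable_on UNIV"
    by (subst summable_on_cong_neutral[where T = "{j}" and g = "\<lambda>i. (cmod (if i = j then 1 else 0))\<^sup>2"]) auto
  then show ?thesis unfolding unit_vec_def by (subst Abs_ell2_inverse) auto
qed

lemma inner_unit_vec: "inner x (c *\<^sub>C unit_vec j) = Re (coord x j * cnj c)"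
proof -
  have "inner x (c *\<^sub>C unit_vec j) = (\<Sum>\<^sub>\<infinity>i. if i = j then Re (coord x j * cnj c) else 0)"
    unfolding inner_ell2_def by (intro infsum_cong) (auto simp: scaleC_ell2.rep_eq coord_unit_vec)
  also have "\<dots> = (\<Sum>\<^sub>\<infinity>i\<in>{j}. Re (coord x j * cnj c))"
    by (rule infsum_cong_neutral) auto
  finally show ?thesis by simp
qed

lemma coord_sum: "coord (sum f A) i = (\<Sum>j\<in>A. coord (f j) i)"
  by (induction A rule: infinite_finite_induct) auto

lemma coord_sum_unit_vec:
  "finite F \<Longrightarrow> coord (\<Sum>j\<in>F. c j *\<^sub>C unit_vec j) i = (if i \<in> F then c i else 0)"
  by (simp add: coord_sum scaleC_ell2.rep_eq coord_unit_vec if_distrib[of "\<lambda>x. _ * x"] sum.delta' cong: if_cong)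

lemma inner_sum_unit_vec:
  "finite F \<Longrightarrow> inner x (\<Sum>j\<in>F. c j *\<^sub>C unit_vec j) = (\<Sum>j\<in>F. Re (coord x j * cnj (c j)))"
  by (simp add: inner_sum_right inner_unit_vec)

lemma Re_mult_cnj_self: "Re (z * cnj z) = (cmod z)\<^sup>2"
  by (simp add: complex_norm_square[symmetric] flip: complex_norm_square)

lemma norm_sum_unit_vec:
  "finite F \<Longrightarrow> (norm (\<Sum>j\<in>F. c j *\<^sub>C unit_vec j))\<^sup>2 = (\<Sum>j\<in>F. (cmod (c j))\<^sup>2)"
  unfolding power2_norm_eq_inner[of "sum _ _"] inner_sum_unit_vec coord_sum_unit_vec
  by (rule sum.cong[OF refl]) (simp only: if_True Re_mult_cnj_self)

text \<open>By Pythagoras the squared distance from \<open>x\<close> to a finite partial sum is the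
  missing part of the convergent series of squared coordinates.\<close>

lemma has_sum_unit_vec: "((\<lambda>j. coord x j *\<^sub>C unit_vec j) has_sum x) UNIV"
proof -
  have "((\<lambda>i. (cmod (coord x i))\<^sup>2) has_sum (norm x)\<^sup>2) UNIV"
    unfolding norm_ell2_square by (rule has_sum_infsum[OF coord_summable])
  from tendsto_diff[OF tendsto_const this[unfolded has_sum_def], of "(norm x)\<^sup>2"]
  have "((\<lambda>F. (norm x)\<^sup>2 - (\<Sum>i\<in>F. (cmod (coord x i))\<^sup>2)) \<longlongrightarrow> 0) (finite_subsets_at_top UNIV)"
    by simp
  moreover have "\<forall>\<^sub>F F in finite_subsets_at_top UNIV. (norm x)\<^sup>2 - (\<Sum>i\<in>F. (cmod (coord x i))\<^sup>2) =
      (norm ((\<Sum>j\<in>F. coord x j *\<^sub>C unit_vec j) - x))\<^sup>2"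
  proof (rule eventually_finite_subsets_at_top_weakI)
    fix F :: "'a set" assume F: "finite F"
    let ?s = "\<Sum>j\<in>F. coord x j *\<^sub>C unit_vec j"
    have "inner x ?s = (\<Sum>i\<in>F. (cmod (coord x i))\<^sup>2)"
      unfolding inner_sum_unit_vec[OF F] by (simp only: Re_mult_cnj_self)
    moreover have "(norm (?s - x))\<^sup>2 = (norm ?s)\<^sup>2 - 2 * inner x ?s + (norm x)\<^sup>2"
      by (simp add: power2_norm_eq_inner inner_diff_left inner_diff_right inner_commute)
    ultimately show "(norm x)\<^sup>2 - (\<Sum>i\<in>F. (cmod (coord x i))\<^sup>2) = (norm (?s - x))\<^sup>2"
      by (simp add: norm_sum_unit_vec[OF F])
  qed
  ultimately have "((\<lambda>F. (norm ((\<Sum>j\<in>F. coord x j *\<^sub>C unit_vec j) - x))\<^sup>2) \<longlongrightarrow>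
      0) (finite_subsets_at_top UNIV)"
    by (rule Lim_transform_eventually)
  from tendsto_real_sqrt[OF this]
  have "((\<lambda>F. norm ((\<Sum>j\<in>F. coord x j *\<^sub>C unit_vec j) - x)) \<longlongrightarrow> 0) (finite_subsets_at_top UNIV)"
    by simp
  then show ?thesis
    unfolding has_sum_def by (rule LIM_zero_cancel[OF tendsto_norm_zero_cancel])
qed

text \<open>The coordinates of the adjoint are forced by the images of the unit vectors. Their
  square sums are bounded by testing \<open>T\<close> on the finite vector formed from these very
  coordinates and applying Cauchy-Schwarz.\<close>

lemma adjoint_exists: "\<exists>S. \<forall>x y. inner (T \<cdot> x) y = inner x (S \<cdot> y)"
proof -
  define z where "z y j = cinner y (T \<cdot> unit_vec j)" for y j
  have trm: "inner (c *\<^sub>C (T \<cdot> unit_vec j)) y = Re (c * cnj (z y j))" for c j y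
    unfolding z_def inner_scaleC_left by (simp only: cinner_commute[of "T \<cdot> unit_vec j"])
  have bound: "(\<Sum>j\<in>F. (cmod (z y j))\<^sup>2) \<le> (norm T * norm y)\<^sup>2" if F: "finite F" for F y
  proof -
    define x where "x = (\<Sum>j\<in>F. z y j *\<^sub>C unit_vec j)"
    have x: "(norm x)\<^sup>2 = (\<Sum>j\<in>F. (cmod (z y j))\<^sup>2)" unfolding x_def by (rule norm_sum_unit_vec[OF F])
    have "T \<cdot> x = (\<Sum>j\<in>F. z y j *\<^sub>C (T \<cdot> unit_vec j))"
      unfolding x_def by (simp add: linear_sum[OF bounded_linear.linear[OF bounded_linear_app]] app_scaleC)
    then have "inner (T \<cdot> x) y = (\<Sum>j\<in>F. (cmod (z y j))\<^sup>2)"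
      by (simp only: inner_sum_left trm Re_mult_cnj_self)
    then have "(norm x)\<^sup>2 = inner (T \<cdot> x) y" using x by simp
    also have "\<dots> \<le> norm (T \<cdot> x) * norm y" by (rule norm_cauchy_schwarz)
    also have "\<dots> \<le> norm T * norm x * norm y" by (intro mult_right_mono norm_app_le) auto
    finally have "norm x * norm x \<le> (norm T * norm y) * norm x" by (simp add: power2_eq_square mult_ac)
    then have "norm x \<le> norm T * norm y"
      by (cases "norm x = 0") (auto simp: mult_le_cancel_right)
    then show ?thesis unfolding x[symmetric] by (rule power_mono) simp
  qed
  have summ: "(\<lambda>j. (cmod (z y j))\<^sup>2) summable_on UNIV" for y
    by (rule nonneg_bdd_above_summable_on) (auto intro!: bdd_aboveI2[where M = "(norm T * norm y)\<^sup>2"] bound)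
  then have coord_z: "coord (Abs_ell2 (z y)) = z y" for y by (simp add: Abs_ell2_inverse)
  have "\<exists>S. \<forall>y. S \<cdot> y = Abs_ell2 (z y)"
  proof (rule ell2_op_exists[where K = "norm T"])
    show "Abs_ell2 (z (x + y)) = Abs_ell2 (z x) + Abs_ell2 (z y)" for x y
      by (rule ell2_eqI) (simp add: coord_z, simp add: z_def cinner_add_left)
    show "Abs_ell2 (z (c *\<^sub>C x)) = c *\<^sub>C Abs_ell2 (z x)" for c x
      by (rule ell2_eqI) (simp add: coord_z scaleC_ell2.rep_eq, simp add: z_def cinner_scaleC_left)
    show "norm (Abs_ell2 (z y)) \<le> norm y * norm T" for y
    proof (rule power2_le_imp_le)
      show "(norm (Abs_ell2 (z y)))\<^sup>2 \<le> (norm y * norm T)\<^sup>2"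
        unfolding norm_ell2_square coord_z
        by (rule infsum_le_finite_sums[OF summ]) (use bound[of _ y] in \<open>simp add: mult.commute\<close>)
    qed simp
  qed
  then obtain S where S: "\<And>y. S \<cdot> y = Abs_ell2 (z y)" by blast
  have "inner (T \<cdot> x) y = inner x (S \<cdot> y)" for x y
  proof -
    have "((\<lambda>j. inner (T \<cdot> (coord x j *\<^sub>C unit_vec j)) y) has_sum inner (T \<cdot> x) y) UNIV"
      by (intro has_sum_bounded_linear[OF bounded_linear_inner_left] has_sum_bounded_linear[OF bounded_linear_app] has_sum_unit_vec)
    then have "((\<lambda>j. Re (coord x j * cnj (z y j))) has_sum inner (T \<cdot> x) y) UNIV"
      by (simp only: app_scaleC trm)
    then show ?thesis unfolding inner_ell2_def[of x] S coord_z by (rule infsumI[symmetric])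
  qed
  then show ?thesis by blast
qed

lemma inner_adj: "inner (T \<cdot> x) y = inner x (adj T \<cdot> y)"
proof -
  obtain S where S: "\<And>x y. inner (T \<cdot> x) y = inner x (S \<cdot> y)" using adjoint_exists by blast
  have cS: "\<forall>x y. cinner (T \<cdot> x) y = cinner x (S \<cdot> y)"
    by (simp add: cinner_eq_iff_inner app_scaleC[symmetric] S)
  have "adj T = S" unfolding adj_def
  proof (rule the_equality, rule cS)
    fix S' assume S': "\<forall>x y. cinner (T \<cdot> x) y = cinner x (S' \<cdot> y)"
    have "inner x (S' \<cdot> y) = inner x (S \<cdot> y)" for x y
      unfolding Re_cinner[symmetric] by (simp only: S'[rule_format, symmetric] cS[rule_format, symmetric])
    then show "S' = S" by - (rule ell2_op_eqI, rule vector_eq_ldot[THEN iffD1], simp)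
  qed
  then show ?thesis using S by simp
qed

lemma adj_eqI:
  assumes "\<And>x y. inner (T \<cdot> x) y = inner x (S \<cdot> y)"
  shows "adj T = S"
proof (rule ell2_op_eqI, rule vector_eq_ldot[THEN iffD1], rule allI)
  fix x y
  show "inner y (adj T \<cdot> x) = inner y (S \<cdot> x)"
    using assms[of y x] inner_adj[of T y x] by simp
qed

lemma inner_adj': "inner x (T \<cdot> y) = inner (adj T \<cdot> x) y"
  by (simp only: inner_adj[of T y x, symmetric] inner_commute)

lemma adj_adj [simp]: "adj (adj T) = T"
  by (rule adj_eqI) (simp add: inner_adj')

lemma adj_simps [simp]:
  "adj 0 = 0" "adj 1 = 1" "adj (S + T) = adj S + adj T" "adj (S - T) = adj S - adj T" "adj (- T) = - adj T"
  "adj (r *\<^sub>R T) = r *\<^sub>R adj T" "adj (S * T) = adj T * adj S"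
  by (rule adj_eqI; simp add: inner_adj inner_add_left inner_add_right inner_diff_left inner_diff_right)+

lemma adj_power: "adj (T ^ n) = adj T ^ n"
  by (induction n) (simp_all add: power_commutes)

lemma norm_adj_le: "norm (adj T) \<le> norm T"
proof (rule norm_ell2_op_bound)
  fix y
  have "norm (adj T \<cdot> y) * norm (adj T \<cdot> y) = inner (T \<cdot> adj T \<cdot> y) y"
    by (simp add: inner_adj dot_square_norm power2_eq_square)
  also have "\<dots> \<le> norm (T \<cdot> adj T \<cdot> y) * norm y" by (rule norm_cauchy_schwarz)
  also have "\<dots> \<le> norm T * norm (adj T \<cdot> y) * norm y" by (intro mult_right_mono norm_app_le) auto
  finally have "norm (adj T \<cdot> y) * norm (adj T \<cdot> y) \<le> (norm T * norm y) * norm (adj T \<cdot> y)" by (simp add: mult_ac)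
  then show "norm (adj T \<cdot> y) \<le> norm T * norm y"
    by (cases "norm (adj T \<cdot> y) = 0") (auto simp: mult_le_cancel_right)
qed simp

lemma norm_adj [simp]: "norm (adj T) = norm T"
  using norm_adj_le[of T] norm_adj_le[of "adj T"] by simp

lemma bounded_linear_adj: "bounded_linear adj"
  by (rule bounded_linear_intro[where K = 1]) simp_all

lemma adj_exp: "adj (exp T) = exp (adj T)"
  unfolding exp_def by (simp add: bounded_linear.suminf[OF bounded_linear_adj summable_exp_generic] adj_power)

section \<open>Coercive operators and inverse-closedness\<close>

text \<open>The squared norm of \<open>(1 - \<tau> *\<^sub>R R) \<cdot> x\<close> is at most
  \<open>1 - 2 * \<tau> * c + \<tau>^2 * m^2\<close> times that of \<open>x\<close>, and the step
  size \<open>c / m^2\<close> minimizes this factor.\<close>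

lemma coercive_contraction:
  assumes c: "0 < c" and coer: "\<And>x. c * (norm x)\<^sup>2 \<le> inner (R \<cdot> x) x"
  shows "\<exists>\<tau> \<rho>. 0 < \<tau> \<and> 0 < \<rho> \<and> \<rho> < 1 \<and> norm (1 - \<tau> *\<^sub>R R) \<le> \<rho>"
proof -
  define m where "m = norm R + c"
  have m: "0 < m" "norm R \<le> m" "c \<le> m" using c by (auto simp: m_def add_nonneg_pos)
  define \<tau> where "\<tau> = c / m\<^sup>2"
  \<comment> \<open>The factor attained is \<open>1 - c^2 / m^2\<close>; only half of the gain is
    kept, so that \<open>\<rho>\<close> stays positive.\<close>
  define \<rho> where "\<rho> = sqrt (1 - c\<^sup>2 / (2 * m\<^sup>2))"
  have cm: "c\<^sup>2 / m\<^sup>2 \<le> 1" using m c by (simp add: power_mono)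
  have cm': "0 < c\<^sup>2 / m\<^sup>2" using m c by simp
  have half: "c\<^sup>2 / (2 * m\<^sup>2) = c\<^sup>2 / m\<^sup>2 / 2" by simp
  have \<rho>: "0 < \<rho>" "\<rho> < 1" unfolding \<rho>_def half using cm cm' by auto
  have "norm ((1 - \<tau> *\<^sub>R R) \<cdot> x) \<le> \<rho> * norm x" for x
  proof (rule power2_le_imp_le)
    have "(norm (R \<cdot> x))\<^sup>2 \<le> (m * norm x)\<^sup>2"
      using norm_app_le[of R x] m by (intro power_mono order_trans[OF norm_app_le mult_right_mono]) auto
    then have 1: "\<tau>\<^sup>2 * (norm (R \<cdot> x))\<^sup>2 \<le> \<tau>\<^sup>2 * (m\<^sup>2 * (norm x)\<^sup>2)"
      by (intro mult_left_mono) (auto simp: power_mult_distrib)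
    have 2: "2 * \<tau> * (c * (norm x)\<^sup>2) \<le> 2 * \<tau> * inner (R \<cdot> x) x"
      using coer c m by (intro mult_left_mono) (auto simp: \<tau>_def)
    have "(norm ((1 - \<tau> *\<^sub>R R) \<cdot> x))\<^sup>2 = (norm x)\<^sup>2 - 2 * \<tau> * inner (R \<cdot> x) x +
        \<tau>\<^sup>2 * (norm (R \<cdot> x))\<^sup>2"
      unfolding power2_norm_eq_inner
      by (simp add: inner_diff_left inner_diff_right inner_commute power2_eq_square[of \<tau>] algebra_simps)
    also have "\<dots> \<le> (norm x)\<^sup>2 - 2 * \<tau> * (c * (norm x)\<^sup>2) + \<tau>\<^sup>2 * (m\<^sup>2 * (norm x)\<^sup>2)"
      using 1 2 by simp
    also have "\<dots> = (1 - c\<^sup>2 / m\<^sup>2) * (norm x)\<^sup>2"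
      using m by (simp add: \<tau>_def power2_eq_square field_simps)
    also have "\<dots> \<le> (1 - c\<^sup>2 / (2 * m\<^sup>2)) * (norm x)\<^sup>2"
      unfolding half using cm' by (intro mult_right_mono) auto
    also have "\<dots> = (\<rho> * norm x)\<^sup>2"
      unfolding \<rho>_def power_mult_distrib half using cm cm' by simp
    finally show "(norm ((1 - \<tau> *\<^sub>R R) \<cdot> x))\<^sup>2 \<le> (\<rho> * norm x)\<^sup>2" .
  qed (use \<rho> in simp)
  then have "norm (1 - \<tau> *\<^sub>R R) \<le> \<rho>" using \<rho> by (intro norm_ell2_op_bound) auto
  moreover have "0 < \<tau>" using c m by (simp add: \<tau>_def)
  ultimately show ?thesis using \<rho> by blast
qed

lemma inner_adj_left: "inner (adj T \<cdot> x) y = inner x (T \<cdot> y)"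
  by (rule inner_adj'[symmetric])

locale star_subalgebra = differential_subalgebra C \<nu> q \<theta> D
  for C :: "'i ell2_op set" and \<nu> q \<theta> D +
  assumes adj_mem: "T \<in> C \<Longrightarrow> adj T \<in> C"
begin

text \<open>A positive multiple of \<open>R\<close> is 1 minus a contraction. It contracts in the
  operator norm only, which is enough for the Neumann series to converge in
  \<open>C\<close>.\<close>

lemma coercive_inverse_mem:
  assumes R: "R \<in> C" and "0 < c" "\<And>x. c * (norm x)\<^sup>2 \<le> inner (R \<cdot> x) x"
  shows "\<exists>S\<in>C. R * S = 1 \<and> S * R = 1"
proof -
  obtain \<tau> \<rho> where \<tau>: "0 < \<tau>" "0 < \<rho>" "\<rho> < 1" "norm (1 - \<tau> *\<^sub>R R) \<le> \<rho>"
    using coercive_contraction[OF assms(2,3)] by blast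
  have "1 - \<tau> *\<^sub>R R \<in> C" by (intro diff_mem one_mem scaleR_mem R)
  moreover have "norm ((1 - \<tau> *\<^sub>R R) ^ n) \<le> 1 * \<rho> ^ n" for n
    using norm_power_ineq[of "1 - \<tau> *\<^sub>R R" n] power_mono[OF \<tau>(4), of n] by simp
  ultimately obtain S where S: "S \<in> C" "(1 - (1 - \<tau> *\<^sub>R R)) * S = 1" "S * (1 - (1 - \<tau> *\<^sub>R R)) = 1"
    using inverse_one_minus_mem[of "1 - \<tau> *\<^sub>R R" 1 \<rho>] \<tau> by blast
  then have "R * (\<tau> *\<^sub>R S) = 1" "(\<tau> *\<^sub>R S) * R = 1" by simp_all
  then show ?thesis using scaleR_mem[OF S(1)] by blast
qed

text \<open>
  With \<open>M\<^sup>* M = [p, r; r\<^sup>*, s]\<close>, both \<open>p\<close> and the Schur complement \<open>s -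
  r\<^sup>* p\<^sup>-\<^sup>1 r\<close> inherit coercivity from
  the lower bound \<open>\<parallel>M (x, y)\<parallel>\<^sup>2 \<ge> \<delta> (\<parallel>x\<parallel>\<^sup>2 +
  \<parallel>y\<parallel>\<^sup>2)\<close>.
\<close>

lemma mat2_inverse_mem:
  assumes M: "M \<in> C2" and MN: "M * N = 1" and NM: "N * M = 1"
  shows "N \<in> C2"
proof -
  obtain a b c d where Mdef: "M = Mat2 a b c d" by (cases M)
  have mem: "a \<in> C" "b \<in> C" "c \<in> C" "d \<in> C" using M by (simp_all add: C2_def Mdef)
  define p where "p = adj a * a + adj c * c"
  define r where "r = adj a * b + adj c * d"
  define r' where "r' = adj b * a + adj d * c"
  define s where "s = adj b * b + adj d * d"
  have memp: "p \<in> C" "r \<in> C" "r' \<in> C" "s \<in> C"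
    unfolding p_def r_def r'_def s_def by (intro add_mem mult_mem adj_mem mem)+
  define k where "k = norm N + 1"
  have k: "0 < k" "norm N \<le> k" by (auto simp: k_def add_nonneg_pos)
  \<comment> \<open>Each coordinate of \<open>(x, y)\<close> is recovered from
    \<open>M (x, y)\<close> by a row of \<open>N\<close>; squaring a sum of two terms bounded
    through \<open>k\<close> costs the factor \<open>2 * k^2\<close>.\<close>
  define \<delta> where "\<delta> = 1 / (2 * k\<^sup>2)"
  have \<delta>: "0 < \<delta>" using k by (simp add: \<delta>_def)
  have below: "\<delta> * (norm z)\<^sup>2 \<le> (norm u)\<^sup>2 + (norm v)\<^sup>2"
    if "z = n \<cdot> u + n' \<cdot> v" "norm n \<le> norm N" "norm n' \<le> norm N" for z u v n n'
  proof -
    have "norm z \<le> norm n * norm u + norm n' * norm v"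
      unfolding that(1) by (intro norm_triangle_le add_mono norm_app_le)
    also have "\<dots> \<le> k * norm u + k * norm v"
      using that k by (intro add_mono mult_right_mono) auto
    finally have "(norm z)\<^sup>2 \<le> (k * norm u + k * norm v)\<^sup>2" by (intro power_mono) auto
    also have "\<dots> \<le> 2 * k\<^sup>2 * ((norm u)\<^sup>2 + (norm v)\<^sup>2)"
      using sum_squares_bound[of "k * norm u" "k * norm v"] by (simp add: power2_sum power_mult_distrib algebra_simps)
    finally show ?thesis using k by (simp add: \<delta>_def field_simps)
  qed
  have col: "m11 N * a + m12 N * c = 1" "m11 N * b + m12 N * d = 0" "m21 N * a + m22 N * c = 0" "m21 N * b + m22 N * d = 1"
    using NM by (simp_all add: Mdef mat2_eq_iff)
  have below_x: "\<delta> * (norm x)\<^sup>2 \<le> (norm (a \<cdot> x + b \<cdot> y))\<^sup>2 + (norm (c \<cdot> x + d \<cdot> y))\<^sup>2"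
    and below_y: "\<delta> * (norm y)\<^sup>2 \<le> (norm (a \<cdot> x + b \<cdot> y))\<^sup>2 + (norm (c \<cdot> x + d
        \<cdot> y))\<^sup>2" for x y
  proof -
    have "(m11 N * a + m12 N * c) \<cdot> x + (m11 N * b + m12 N * d) \<cdot> y = x"
      "(m21 N * a + m22 N * c) \<cdot> x + (m21 N * b + m22 N * d) \<cdot> y = y" unfolding col by simp_all
    then show "\<delta> * (norm x)\<^sup>2 \<le> (norm (a \<cdot> x + b \<cdot> y))\<^sup>2 + (norm (c \<cdot> x + d \<cdot> y))\<^sup>2"
      "\<delta> * (norm y)\<^sup>2 \<le> (norm (a \<cdot> x + b \<cdot> y))\<^sup>2 + (norm (c \<cdot> x + d \<cdot> y))\<^sup>2"
      by (intro below[of _ "m11 N" _ "m12 N"] below[of _ "m21 N" _ "m22 N"];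
          simp add: norm_mat2_entry_le app_linear_simps algebra_simps)+
  qed
  have quad: "(norm (a \<cdot> x + b \<cdot> y))\<^sup>2 + (norm (c \<cdot> x + d \<cdot> y))\<^sup>2 =
      inner (p \<cdot> x) x + 2 * inner (r \<cdot> y) x + inner (s \<cdot> y) y" for x y
    by (simp add: power2_norm_eq_inner p_def r_def s_def inner_add_left inner_add_right inner_adj_left)
      (simp add: inner_commute)
  have "\<delta> * (norm x)\<^sup>2 \<le> inner (p \<cdot> x) x" for x
    using below_x[of x 0] quad[of x 0] by (simp add: app_linear_simps)
  then obtain pi where pi: "pi \<in> C" "p * pi = 1" "pi * p = 1"
    using coercive_inverse_mem[OF memp(1) \<delta>] by blast
  define \<sigma> where "\<sigma> = s - r' * pi * r"
  have "\<delta> * (norm y)\<^sup>2 \<le> inner (\<sigma> \<cdot> y) y" for y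
  proof -
    \<comment> \<open>The minimizer of the quadratic form in its first variable; the minimal value
      is the form of the Schur complement.\<close>
    define x where "x = - (pi \<cdot> r \<cdot> y)"
    have "p \<cdot> x = - ((p * pi) \<cdot> r \<cdot> y)" by (simp add: x_def app_linear_simps)
    then have px: "p \<cdot> x = - (r \<cdot> y)" using pi by simp
    have r': "r' = adj r" by (simp add: r'_def r_def)
    have "inner (\<sigma> \<cdot> y) y = inner (s \<cdot> y) y - inner (r' \<cdot> pi \<cdot> r \<cdot> y) y"
      by (simp add: \<sigma>_def inner_diff_left mult.assoc)
    also have "inner (r' \<cdot> pi \<cdot> r \<cdot> y) y = - inner x (r \<cdot> y)"
      unfolding r' by (simp add: inner_adj x_def)
    finally have "inner (\<sigma> \<cdot> y) y = inner (p \<cdot> x) x + 2 * inner (r \<cdot> y) x + inner (s \<cdot> y) y"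
      by (simp add: px inner_commute)
    then show ?thesis using below_y[of y x] quad[of x y] by simp
  qed
  moreover have "\<sigma> \<in> C" unfolding \<sigma>_def by (intro diff_mem mult_mem memp pi)
  ultimately obtain si where si: "si \<in> C" "\<sigma> * si = 1" "si * \<sigma> = 1"
    using coercive_inverse_mem[OF _ \<delta>] by blast
  \<comment> \<open>The block inversion formula for \<open>adj M * M\<close>. A left inverse
    suffices, because \<open>N\<close> is a right inverse of \<open>M\<close>.\<close>
  define W where "W = Mat2 (pi + pi * r * si * r' * pi) (- (pi * r * si)) (- (si * r' * pi)) si"
  define Ms where "Ms = Mat2 (adj a) (adj c) (adj b) (adj d)"
  have "W \<in> C2" "Ms \<in> C2" unfolding W_def Ms_def C2_def
    by (auto intro!: add_mem mult_mem uminus_mem adj_mem mem memp pi si)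
  then have WMs: "W * Ms \<in> C2"
    unfolding C2_def by (auto intro!: add_mem mult_mem)
  have "Ms * M = Mat2 p r r' s" by (simp add: Ms_def Mdef mat2_eq_iff p_def r_def r'_def s_def)
  moreover have "W * Mat2 p r r' s = 1"
  proof -
    have sis: "si * s = 1 + si * (r' * (pi * r))" using si by (simp add: \<sigma>_def algebra_simps mult.assoc)
    have "(pi + pi * r * si * r' * pi) * p + - (pi * r * si) * r' = 1"
      using pi by (simp add: distrib_right mult.assoc)
    moreover have "(pi + pi * r * si * r' * pi) * r + - (pi * r * si) * s = 0"
      by (simp add: distrib_right distrib_left mult.assoc sis)
    moreover have "- (si * r' * pi) * p + si * r' = 0" using pi by (simp add: mult.assoc)
    moreover have "- (si * r' * pi) * r + si * s = 1" by (simp add: mult.assoc sis)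
    ultimately show ?thesis by (simp only: W_def mat2_eq_iff mat2.sel mat2_sel_simps simp_thms)
  qed
  ultimately have "W * Ms * M = 1" by (simp add: mult.assoc)
  then have "N = W * Ms" using MN by (metis mult.assoc mult_1_left mult_1_right)
  then show ?thesis using WMs by simp
qed

end

section \<open>Positive operators\<close>

text \<open>Expand the nonnegative form at \<open>x\<close> minus \<open>Q \<cdot> x\<close> divided
  by \<open>norm Q\<close>.\<close>

lemma positive_norm_square_le:
  assumes adj: "adj Q = Q" and pos: "\<And>x. 0 \<le> inner (Q \<cdot> x) x"
  shows "(norm (Q \<cdot> x))\<^sup>2 \<le> norm Q * inner (Q \<cdot> x) x"
proof (cases "norm Q = 0")
  case False
  then have m: "0 < norm Q" by simp
  define t where "t = inverse (norm Q)"
  have sym: "inner (Q \<cdot> y) z = inner y (Q \<cdot> z)" for y z using inner_adj[of Q y z] adj by simp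
  have "0 \<le> inner (Q \<cdot> (x - t *\<^sub>R (Q \<cdot> x))) (x - t *\<^sub>R (Q \<cdot> x))" by (rule pos)
  also have "\<dots> = inner (Q \<cdot> x) x - 2 * t * (norm (Q \<cdot> x))\<^sup>2 + t\<^sup>2 * inner (Q \<cdot> Q \<cdot>
      x) (Q \<cdot> x)"
    unfolding power2_norm_eq_inner
    by (simp add: app_linear_simps inner_diff_left inner_diff_right sym[of "Q \<cdot> x" x] power2_eq_square[of t] algebra_simps)
  also have "inner (Q \<cdot> Q \<cdot> x) (Q \<cdot> x) \<le> norm Q * (norm (Q \<cdot> x))\<^sup>2"
    using norm_cauchy_schwarz[of "Q \<cdot> Q \<cdot> x" "Q \<cdot> x"] mult_right_mono[OF norm_app_le[of Q "Q \<cdot> x"],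
        of "norm (Q \<cdot> x)"]
    by (simp add: power2_eq_square mult.assoc)
  finally have "0 \<le> inner (Q \<cdot> x) x - 2 * t * (norm (Q \<cdot> x))\<^sup>2 + t\<^sup>2 * (norm Q * (norm (Q \<cdot> x))\<^sup>2)"
    by (simp add: mult_left_mono)
  also have "\<dots> = inner (Q \<cdot> x) x - t * (norm (Q \<cdot> x))\<^sup>2"
    using m by (simp add: t_def power2_eq_square field_simps)
  finally show ?thesis using m by (simp add: t_def field_simps)
qed simp

text \<open>With \<open>e = 1 - Q / norm Q\<close>, the root of \<open>1 - e\<close> is a binomial
  series that converges absolutely already for \<open>norm e \<le> 1\<close>. That the root commutes
  with everything commuting with \<open>Q\<close> is recorded for the uniqueness proof.\<close>

lemma positive_sqrt_exists:
  assumes adj: "adj Q = Q" and pos: "\<And>x. 0 \<le> inner (Q \<cdot> x) x"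
  shows "\<exists>S. adj S = S \<and> (\<forall>x. 0 \<le> inner (S \<cdot> x) x) \<and> S * S = Q \<and> (\<forall>T. T * Q
      = Q * T \<longrightarrow> T * S = S * T)"
proof (cases "Q = 0")
  case True
  then show ?thesis by (intro exI[of _ 0]) simp
next
  case False
  define m where "m = norm Q"
  have m: "0 < m" using False by (simp add: m_def)
  define e where "e = 1 - inverse m *\<^sub>R Q"
  have "norm e \<le> 1"
  proof (rule norm_ell2_op_bound)
    fix x
    have "(norm (e \<cdot> x))\<^sup>2 = (norm x)\<^sup>2 - 2 * inverse m * inner (Q \<cdot> x) x + (inverse m)\<^sup>2 *
        (norm (Q \<cdot> x))\<^sup>2"
      unfolding power2_norm_eq_inner
      by (simp add: e_def inner_diff_left inner_diff_right inner_commute power2_eq_square[of "inverse m"] algebra_simps)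
    also have "\<dots> \<le> (norm x)\<^sup>2 - 2 * inverse m * inner (Q \<cdot> x) x + (inverse m)\<^sup>2 * (m * inner (Q \<cdot> x) x)"
      using positive_norm_square_le[OF assms, of x] by (simp add: mult_left_mono m_def)
    also have "\<dots> = (norm x)\<^sup>2 - inverse m * inner (Q \<cdot> x) x"
      using m by (simp add: power2_eq_square field_simps)
    also have "\<dots> \<le> (norm x)\<^sup>2" using pos[of x] m by simp
    finally have "norm (e \<cdot> x) \<le> norm x" by (rule power2_le_imp_le) (rule norm_ge_zero)
    then show "norm (e \<cdot> x) \<le> 1 * norm x" by simp
  qed simp
  then have en: "norm (e ^ n) \<le> 1" for n
    using norm_power_ineq[of e n] power_le_one[of "norm e" n] by simp
  let ?c = "rising_coeff (- (1/2))"
  have smn: "summable (\<lambda>n. norm (?c n *\<^sub>R e ^ n))"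
    by (rule summable_comparison_test'[OF summable_abs_rising_coeff_minus_half, of 0])
      (use en in \<open>simp add: mult_left_le\<close>)
  have sm: "summable (\<lambda>n. ?c n *\<^sub>R e ^ n)" by (rule summable_norm_cancel[OF smn])
  define w where "w = (\<Sum>n. ?c n *\<^sub>R e ^ n)"
  have "w * w = (\<Sum>n. rising_coeff (-1) n *\<^sub>R e ^ n)"
    unfolding w_def using rising_series_mult[OF smn smn] by simp
  also have "\<dots> = (\<Sum>n\<in>{0,1}. rising_coeff (-1) n *\<^sub>R e ^ n)"
    by (rule suminf_finite) (auto simp: rising_coeff_minus_1)
  also have "\<dots> = inverse m *\<^sub>R Q" by (simp add: rising_coeff_minus_1 e_def)
  finally have ww: "w * w = inverse m *\<^sub>R Q" .
  have "adj e = e" by (simp add: e_def adj)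
  then have adjw: "adj w = w"
    unfolding w_def by (simp add: bounded_linear.suminf[OF bounded_linear_adj sm] adj_power)
  have posw: "0 \<le> inner (w \<cdot> x) x" for x
  proof -
    have bl: "bounded_linear (\<lambda>T. inner (T \<cdot> x) x)"
      by (rule bounded_linear_compose[OF bounded_linear_inner_left bounded_linear_app_left])
    have smS: "summable (\<lambda>n. ?c (Suc n) *\<^sub>R e ^ Suc n)" using sm by (subst summable_Suc_iff)
    have smSn: "summable (\<lambda>n. \<bar>?c (Suc n)\<bar>)" using summable_abs_rising_coeff_minus_half by (subst summable_Suc_iff)
    \<comment> \<open>The coefficients beyond the constant term 1 have absolute sum at most 1, so
      \<open>v\<close> cannot outweigh the identity.\<close>
    define v where "v = (\<Sum>n. ?c (Suc n) *\<^sub>R e ^ Suc n)"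
    have "norm v \<le> (\<Sum>n. \<bar>?c (Suc n)\<bar>)"
      unfolding v_def
    proof (rule norm_suminf_le[OF _ smSn])
      show "norm (?c (Suc n) *\<^sub>R e ^ Suc n) \<le> \<bar>?c (Suc n)\<bar>" for n
        using en[of "Suc n"] mult_left_le[of "norm (e ^ Suc n)" "\<bar>?c (Suc n)\<bar>"] by simp
    qed
    also have "\<dots> \<le> 1" by (rule suminf_le_const[OF smSn]) (rule sum_abs_rising_coeff_minus_half)
    finally have v: "norm v \<le> 1" .
    have "w = 1 + v" unfolding w_def v_def using suminf_split_head[OF sm] by simp
    moreover have "- inner (v \<cdot> x) x \<le> norm x * norm x"
    proof -
      have "- inner (v \<cdot> x) x \<le> norm (v \<cdot> x) * norm x"
        using norm_cauchy_schwarz[of "- (v \<cdot> x)" x] by simp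
      also have "\<dots> \<le> 1 * norm x * norm x"
        using v by (intro mult_right_mono order_trans[OF norm_app_le mult_right_mono]) auto
      finally show ?thesis by simp
    qed
    ultimately show ?thesis by (simp add: inner_add_left dot_square_norm power2_eq_square)
  qed
  define S where "S = sqrt m *\<^sub>R w"
  have "S * S = Q" using ww m by (simp add: S_def flip: mult.assoc)
  moreover have "adj S = S" by (simp add: S_def adjw)
  moreover have "0 \<le> inner (S \<cdot> x) x" for x using posw[of x] m by (simp add: S_def)
  moreover have "T * S = S * T" if "T * Q = Q * T" for T
  proof -
    have "T * e = e * T" using that by (simp add: e_def algebra_simps)
    then have "e * T = T * e" by simp
    then have "e ^ n * T = T * e ^ n" for n by (rule power_commuting_commutes)
    then have "T * w = w * T" unfolding w_def by (intro commute_suminf sm) simp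
    then show ?thesis by (simp add: S_def)
  qed
  ultimately show ?thesis by blast
qed

lemma positive_form_zero:
  assumes "adj S = S" "\<And>x. 0 \<le> inner (S \<cdot> x) x" "inner (S \<cdot> y) y = 0"
  shows "S \<cdot> y = 0"
  using positive_norm_square_le[OF assms(1,2), of y] assms(3) by simp

text \<open>From \<open>(S + T) * (S - T) = 0\<close> both nonnegative forms vanish on the range of
  the difference. The difference therefore has square zero and, being self-adjoint, is zero.\<close>

lemma positive_sqrt_unique:
  assumes S: "adj S = S" "\<And>x. 0 \<le> inner (S \<cdot> x) x" and T: "adj T = T" "\<And>x. 0 \<le> inner (T \<cdot> x) x"
    and eq: "S * S = T * T" and comm: "S * T = T * S"
  shows "S = T"
proof -
  define \<Delta> where "\<Delta> = S - T"
  have zero: "(S + T) * \<Delta> = 0" using eq comm by (simp add: \<Delta>_def algebra_simps)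
  then have sum0: "S \<cdot> \<Delta> \<cdot> x + T \<cdot> \<Delta> \<cdot> x = 0" for x
  proof -
    have "((S + T) * \<Delta>) \<cdot> x = 0" by (simp only: zero app_simps(1))
    then show ?thesis by (simp only: app_simps(3,6))
  qed
  have "\<Delta> \<cdot> x = 0" for x
  proof -
    let ?y = "\<Delta> \<cdot> x"
    have "inner (S \<cdot> ?y) ?y + inner (T \<cdot> ?y) ?y = 0"
      using sum0[of x] by (simp flip: inner_add_left)
    then have "inner (S \<cdot> ?y) ?y = 0" "inner (T \<cdot> ?y) ?y = 0"
      using S(2)[of ?y] T(2)[of ?y] by linarith+
    then have "S \<cdot> ?y = 0" "T \<cdot> ?y = 0" using positive_form_zero S T by blast+
    then have "(S - T) \<cdot> ?y = 0" by simp
    then have "\<Delta> \<cdot> ?y = 0" by (simp only: \<Delta>_def)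
    moreover have "adj \<Delta> = \<Delta>" by (simp add: \<Delta>_def S T)
    ultimately have "inner ?y ?y = 0" using inner_adj[of \<Delta> x ?y] by simp
    then show ?thesis by simp
  qed
  then have "\<Delta> = 0" by (intro ell2_op_eqI) simp
  then show ?thesis by (simp add: \<Delta>_def)
qed

section \<open>Exponential stability\<close>

definition exp_decay :: "'i ell2_op \<Rightarrow> bool" where
  "exp_decay T \<longleftrightarrow> (\<exists>E>0. \<exists>\<alpha>>0. \<forall>t\<ge>0. norm (exp (t *\<^sub>R T)) \<le>
      E * exp (- \<alpha> * t))"

text \<open>Along a trajectory the form of \<open>V\<close>, multiplied by
  \<open>exp (\<kappa> * s)\<close>, is nonincreasing. The form is quadratic, hence the halved rate
  and the square root in the constant.\<close>

lemma lyapunov_exp_decay: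
  assumes adj: "adj V = V" and c: "0 < c" "\<And>x. c * (norm x)\<^sup>2 \<le> inner (V \<cdot> x) x"
    and \<delta>: "0 < \<delta>" "\<And>x. inner (V \<cdot> x) (T \<cdot> x) \<le> - \<delta> * (norm x)\<^sup>2"
  shows "exp_decay T"
proof -
  define m where "m = norm V + 1"
  have m: "0 < m" by (simp add: m_def add_nonneg_pos)
  have Vm: "inner (V \<cdot> x) x \<le> m * (norm x)\<^sup>2" for x
  proof -
    have "inner (V \<cdot> x) x \<le> norm V * norm x * norm x"
      by (rule order_trans[OF norm_cauchy_schwarz mult_right_mono[OF norm_app_le]]) simp
    also have "\<dots> \<le> m * norm x * norm x" by (intro mult_right_mono) (auto simp: m_def)
    finally show ?thesis by (simp add: power2_eq_square mult.assoc)
  qed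
  define \<kappa> where "\<kappa> = 2 * \<delta> / m"
  have \<kappa>: "0 < \<kappa>" using \<delta> m by (simp add: \<kappa>_def)
  have decay: "c * (norm (exp (t *\<^sub>R T) \<cdot> x))\<^sup>2 \<le> exp (- \<kappa> * t) * (m * (norm x)\<^sup>2)" if "0
      \<le> t" for t x
  proof -
    define y where "y s = exp (s *\<^sub>R T) \<cdot> x" for s
    define \<phi> where "\<phi> s = inner (V \<cdot> y s) (y s)" for s
    have dy: "(y has_vector_derivative (T \<cdot> y s)) (at s)" for s
      using bounded_linear.has_vector_derivative[OF bounded_linear_app_left[of x] exp_scaleR_has_vector_derivative_left[of T s]]
      by (simp add: y_def[abs_def])
    have d\<phi>: "(\<phi> has_real_derivative 2 * inner (V \<cdot> y s) (T \<cdot> y s)) (at s)" for s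
    proof -
      have sym: "inner (V \<cdot> T \<cdot> y s) (y s) = inner (V \<cdot> y s) (T \<cdot> y s)"
        using inner_adj[of V "T \<cdot> y s" "y s"] adj by (simp add: inner_commute)
      have "(\<phi> has_vector_derivative (inner (V \<cdot> y s) (T \<cdot> y s) + inner (V \<cdot> T \<cdot> y s) (y s))) (at s)"
        unfolding \<phi>_def[abs_def]
        by (rule bounded_bilinear.has_vector_derivative[OF bounded_bilinear_inner
              bounded_linear.has_vector_derivative[OF bounded_linear_app dy] dy])
      then show ?thesis by (simp add: sym has_real_derivative_iff_has_vector_derivative)
    qed
    have "exp (\<kappa> * t) * \<phi> t \<le> exp (\<kappa> * 0) * \<phi> 0"
    proof (rule DERIV_nonpos_imp_nonincreasing[OF that])
      fix s
      have d: "((\<lambda>s. exp (\<kappa> * s) * \<phi> s) has_real_derivative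
          exp (\<kappa> * s) * (\<kappa> * \<phi> s + 2 * inner (V \<cdot> y s) (T \<cdot> y s))) (at s)"
        by (auto intro!: derivative_eq_intros d\<phi> simp: algebra_simps)
      have le: "\<kappa> * \<phi> s + 2 * inner (V \<cdot> y s) (T \<cdot> y s) \<le> 0"
      proof -
        have "\<kappa> * \<phi> s \<le> \<kappa> * (m * (norm (y s))\<^sup>2)"
          unfolding \<phi>_def using \<kappa> by (intro mult_left_mono Vm) auto
        also have "\<dots> = 2 * \<delta> * (norm (y s))\<^sup>2" using m by (simp add: \<kappa>_def)
        finally show ?thesis using \<delta>(2)[of "y s"] by simp
      qed
      show "\<exists>y. ((\<lambda>s. exp (\<kappa> * s) * \<phi> s) has_real_derivative y) (at s) \<and> y \<le> 0"
        by (rule exI, rule conjI[OF d]) (use le in \<open>simp add: mult_le_0_iff\<close>)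
    qed
    then have "exp (\<kappa> * t) * \<phi> t \<le> m * (norm x)\<^sup>2"
      using Vm[of x] by (simp add: \<phi>_def y_def)
    then have "exp (- \<kappa> * t) * (exp (\<kappa> * t) * \<phi> t) \<le> exp (- \<kappa> * t) * (m * (norm x)\<^sup>2)"
      by (intro mult_left_mono) auto
    then have "\<phi> t \<le> exp (- \<kappa> * t) * (m * (norm x)\<^sup>2)"
      by (simp add: mult.assoc[symmetric] exp_add[symmetric])
    then show ?thesis using c(2)[of "y t"] by (simp add: \<phi>_def y_def)
  qed
  define E where "E = sqrt (m / c)"
  have E: "0 < E" using m c by (simp add: E_def)
  have E2: "E\<^sup>2 = m / c" using m c by (simp add: E_def)
  have "norm (exp (t *\<^sub>R T)) \<le> E * exp (- (\<kappa> / 2) * t)" if "0 \<le> t" for t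
  proof (rule norm_ell2_op_bound)
    fix x
    have "(exp (- (\<kappa> / 2) * t))\<^sup>2 = exp (- \<kappa> * t)" by (simp add: power2_eq_square exp_add[symmetric])
    then have "(norm (exp (t *\<^sub>R T) \<cdot> x))\<^sup>2 \<le> (E * exp (- (\<kappa> / 2) * t) * norm x)\<^sup>2"
      using decay[OF that, of x] c by (simp add: power_mult_distrib E2 field_simps)
    then show "norm (exp (t *\<^sub>R T) \<cdot> x) \<le> E * exp (- (\<kappa> / 2) * t) * norm x"
      by (rule power2_le_imp_le) (use E in simp)
  qed (use E in simp)
  moreover have "0 < \<kappa> / 2" using \<kappa> by simp
  ultimately show ?thesis unfolding exp_decay_def using E by blast
qed

text \<open>\<open>W\<close> integrates \<open>exp (t *\<^sub>R adj S) * exp (t *\<^sub>R S)\<close>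
  up to a time at which the semigroup has norm at most 1/2. The boundary terms then bound twice
  \<open>inner (W \<cdot> x) (S \<cdot> x)\<close> by -3/4 of the squared norm of \<open>x\<close>,
  which is more than claimed. A finite horizon avoids improper integrals.\<close>

lemma exp_decay_gramian:
  assumes "exp_decay S"
  shows "\<exists>W. adj W = W \<and> (\<forall>x. 0 \<le> inner (W \<cdot> x) x) \<and> (\<forall>x. inner (W \<cdot> x) (S
      \<cdot> x) \<le> - (1/4) * (norm x)\<^sup>2)"
proof -
  obtain E \<alpha> where E: "0 < E" "0 < \<alpha>" "\<And>t. 0 \<le> t \<Longrightarrow> norm (exp (t *\<^sub>R S)) \<le> E
      * exp (- \<alpha> * t)"
    using assms unfolding exp_decay_def by blast
  define \<tau> where "\<tau> = ln (2 * E + 1) / \<alpha>"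
  have \<tau>: "0 \<le> \<tau>" using E by (simp add: \<tau>_def)
  have "- \<alpha> * \<tau> = - ln (2 * E + 1)" using E by (simp add: \<tau>_def)
  then have "exp (- \<alpha> * \<tau>) = 1 / (2 * E + 1)" using E by (simp only: exp_minus exp_ln divide_inverse mult_1_left)
  then have "norm (exp (\<tau> *\<^sub>R S)) \<le> E / (2 * E + 1)" using E(3)[OF \<tau>] by simp
  also have "\<dots> \<le> 1/2" using E by (simp add: field_simps)
  finally have half: "norm (exp (\<tau> *\<^sub>R S)) \<le> 1/2" .
  define f where "f t = exp (t *\<^sub>R adj S) * exp (t *\<^sub>R S)" for t
  define f' where "f' t = adj S * f t + f t * S" for t
  have df: "(f has_vector_derivative f' t) (at t within A)" for t A
  proof -
    have "(f has_vector_derivative (exp (t *\<^sub>R adj S) * (exp (t *\<^sub>R S) * S) + adj S * exp (t *\<^sub>R adj S) *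
        exp (t *\<^sub>R S))) (at t)"
      unfolding f_def[abs_def]
      by (rule has_vector_derivative_mult[OF
            exp_scaleR_has_vector_derivative_left exp_scaleR_has_vector_derivative_right])
    moreover have "exp (t *\<^sub>R adj S) * (exp (t *\<^sub>R S) * S) + adj S * exp (t *\<^sub>R adj S) * exp (t *\<^sub>R S) = f' t"
      by (simp only: f'_def f_def mult.assoc add.commute)
    ultimately show ?thesis
      by (metis has_vector_derivative_at_within)
  qed
  have cont: "continuous_on {0..\<tau>} f"
    by (rule continuous_on_vector_derivative) (rule df)
  define W where "W = integral {0..\<tau>} f"
  have hW: "(f has_integral W) {0..\<tau>}"
    unfolding W_def by (intro integrable_integral integrable_continuous_real cont)
  have "(f' has_integral (adj S * W + W * S)) {0..\<tau>}"
    unfolding f'_def[abs_def]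
    using has_integral_add[OF has_integral_linear[OF hW bounded_linear_mult_right[of "adj S"]]
        has_integral_linear[OF hW bounded_linear_mult_left[of S]]]
    by (simp add: o_def)
  moreover have "(f' has_integral (f \<tau> - f 0)) {0..\<tau>}"
    by (rule fundamental_theorem_of_calculus[OF \<tau>]) (rule df)
  ultimately have W: "adj S * W + W * S = f \<tau> - f 0" by (rule has_integral_unique)
  have adjf: "adj (f t) = f t" for t by (simp add: f_def adj_exp)
  have "((adj \<circ> f) has_integral adj W) {0..\<tau>}" by (rule has_integral_linear[OF hW bounded_linear_adj])
  then have adjW: "adj W = W" using hW by (intro has_integral_unique[of f]) (simp_all add: o_def adjf)
  have quad: "inner (f t \<cdot> x) x = (norm (exp (t *\<^sub>R S) \<cdot> x))\<^sup>2" for t x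
    using inner_adj_left[of "exp (t *\<^sub>R S)" "exp (t *\<^sub>R S) \<cdot> x" x] by (simp add: f_def adj_exp power2_norm_eq_inner)
  have "0 \<le> inner (W \<cdot> x) x" for x
  proof -
    have bl: "bounded_linear (\<lambda>T. inner (T \<cdot> x) x)"
      by (rule bounded_linear_compose[OF bounded_linear_inner_left bounded_linear_app_left])
    show ?thesis
      by (rule has_integral_nonneg[OF has_integral_linear[OF hW bl]]) (simp add: quad)
  qed
  moreover have "inner (W \<cdot> x) (S \<cdot> x) \<le> - (1/4) * (norm x)\<^sup>2" for x
  proof -
    have "inner ((adj S * W + W * S) \<cdot> x) x = 2 * inner (W \<cdot> x) (S \<cdot> x)"
      using inner_adj[of W "S \<cdot> x" x] adjW
      by (simp add: inner_add_right inner_adj[of S x "W \<cdot> x", symmetric] inner_commute)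
    moreover have "inner ((f \<tau> - f 0) \<cdot> x) x = (norm (exp (\<tau> *\<^sub>R S) \<cdot> x))\<^sup>2 - (norm x)\<^sup>2"
      using quad[of \<tau> x] quad[of 0 x] by (simp add: inner_diff_left)
    moreover have "(norm (exp (\<tau> *\<^sub>R S) \<cdot> x))\<^sup>2 \<le> (1/2 * norm x)\<^sup>2"
      by (intro power_mono order_trans[OF norm_app_le mult_right_mono[OF half]]) auto
    ultimately have "2 * inner (W \<cdot> x) (S \<cdot> x) \<le> (1/2 * norm x)\<^sup>2 - (norm x)\<^sup>2" using W by simp
    moreover have "(1/2 * norm x)\<^sup>2 = (norm x)\<^sup>2 / 4" by (simp add: power_divide)
    ultimately show ?thesis using zero_le_power2[of "norm x"] by linarith
  qed
  ultimately show ?thesis using adjW by blast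
qed

text \<open>
  The value function \<open>X\<close> only controls the output \<open>C x\<close> and the input \<open>B\<^sup>* X
  x\<close>. Adding the Gramian \<open>W\<close> of the
  stable system \<open>A + L C\<close> to a large multiple of \<open>X\<close> gives a Lyapunov function of the closed loop.
\<close>

lemma closed_loop_exp_decay:
  assumes X: "adj X = X" "0 < c" "\<And>x. c * (norm x)\<^sup>2 \<le> inner (X \<cdot> x) x"
    and P: "0 < c'" "\<And>u. c' * (norm u)\<^sup>2 \<le> inner (P \<cdot> u) u"
    and C: "adj C = C"
    and ric: "adj A * X + X * A - X * (B * P * adj B) * X + C * C = 0"
    and det: "exp_decay (A + L * C)"
  shows "exp_decay (A - B * P * adj B * X)"
proof -
  define S where "S = A + L * C"
  obtain W where W: "adj W = W" "\<And>x. 0 \<le> inner (W \<cdot> x) x" "\<And>x. inner (W \<cdot> x) (S \<cdot> x) \<le> -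
      (1/4) * (norm x)\<^sup>2"
    using exp_decay_gramian[OF det] unfolding S_def by blast
  define g where "g = norm W * norm L"
  define h where "h = norm W * norm (B * P)"
  have gh: "0 \<le> g" "0 \<le> h" by (simp_all add: g_def h_def)
  \<comment> \<open>Large enough that half of \<open>k\<close> times the dissipation of
    \<open>X\<close> absorbs the terms \<open>4 * g^2\<close> and \<open>4 * h^2\<close> that
    \<open>W\<close> produces below.\<close>
  define k where "k = 8 * g\<^sup>2 + 8 * h\<^sup>2 / c' + 1"
  have k0: "0 \<le> 8 * h\<^sup>2 / c'" using P by simp
  have k: "0 < k" "8 * g\<^sup>2 \<le> k" "8 * h\<^sup>2 \<le> k * c'"
  proof -
    show "0 < k" "8 * g\<^sup>2 \<le> k" using k0 by (simp_all add: k_def add_nonneg_pos)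
    have "8 * h\<^sup>2 = (8 * h\<^sup>2 / c') * c'" using P by simp
    also have "\<dots> \<le> k * c'" using P by (intro mult_right_mono) (auto simp: k_def)
    finally show "8 * h\<^sup>2 \<le> k * c'" .
  qed
  define V where "V = k *\<^sub>R X + W"
  show ?thesis
  proof (rule lyapunov_exp_decay[of V "k * c" "1/8"])
    show "adj V = V" by (simp add: V_def X W)
    show "0 < k * c" using k X by simp
    show "k * c * (norm x)\<^sup>2 \<le> inner (V \<cdot> x) x" for x
    proof -
      have "k * (c * (norm x)\<^sup>2) \<le> k * inner (X \<cdot> x) x" using k X by (intro mult_left_mono) auto
      then show ?thesis using W(2)[of x] by (simp add: V_def inner_add_left)
    qed
    fix x
    define u where "u = adj B \<cdot> X \<cdot> x"
    define y where "y = C \<cdot> x"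
    define T where "T = A - B * P * adj B * X"
    have Tx: "T \<cdot> x = A \<cdot> x - B \<cdot> P \<cdot> u" by (simp add: T_def u_def)
    \<comment> \<open>Seen from the stable \<open>S\<close>, the closed loop is perturbed only
      through the output \<open>y\<close> and the input \<open>u\<close>, the two quantities that
      the dissipation of \<open>X\<close> controls.\<close>
    have TS: "T \<cdot> x = S \<cdot> x - L \<cdot> y - (B * P) \<cdot> u" by (simp add: Tx S_def y_def)
    have BPu: "inner (X \<cdot> x) (B \<cdot> P \<cdot> u) = inner (P \<cdot> u) u"
      using inner_adj[of B "P \<cdot> u" "X \<cdot> x"] by (simp add: u_def inner_commute)
    have XX: "inner (X \<cdot> z) x = inner z (X \<cdot> x)" for z using inner_adj[of X z x] X(1) by simp
    have CC: "inner (C \<cdot> C \<cdot> x) x = (norm y)\<^sup>2"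
      using inner_adj[of C "C \<cdot> x" x] C by (simp add: y_def power2_norm_eq_inner)
    have "inner ((adj A * X + X * A - X * (B * P * adj B) * X + C * C) \<cdot> x) x = 0" by (simp only: ric app_simps inner_zero_left)
    then have "2 * inner (X \<cdot> x) (A \<cdot> x) - inner (P \<cdot> u) u + (norm y)\<^sup>2 = 0"
      using BPu XX[of "A \<cdot> x"] XX[of "B \<cdot> P \<cdot> u"] CC
      by (simp add: inner_add_right inner_diff_right inner_adj[of A x "X \<cdot> x", symmetric] u_def[symmetric] inner_commute)
    moreover have "inner (X \<cdot> x) (T \<cdot> x) = inner (X \<cdot> x) (A \<cdot> x) - inner (P \<cdot> u) u"
      using BPu by (simp add: Tx inner_diff_right)
    ultimately have Xpart: "2 * inner (X \<cdot> x) (T \<cdot> x) = - (norm y)\<^sup>2 - inner (P \<cdot> u) u"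
      by simp
    have "inner (W \<cdot> x) (T \<cdot> x) = inner (W \<cdot> x) (S \<cdot> x) + inner (- (W \<cdot> x)) (L \<cdot> y) +
        inner (- (W \<cdot> x)) ((B * P) \<cdot> u)"
      by (simp add: TS inner_diff_right del: app_simps(6))
    also have "\<dots> \<le> - (1/4) * (norm x)\<^sup>2 + g * norm x * norm y + h * norm x * norm u"
    proof (intro add_mono W(3))
      have *: "inner (- (W \<cdot> x)) (Z \<cdot> v) \<le> norm W * norm Z * norm x * norm v" for Z v
      proof -
        have "inner (- (W \<cdot> x)) (Z \<cdot> v) \<le> norm (W \<cdot> x) * norm (Z \<cdot> v)"
          using norm_cauchy_schwarz[of "- (W \<cdot> x)" "Z \<cdot> v"] by simp
        also have "\<dots> \<le> (norm W * norm x) * (norm Z * norm v)" by (intro mult_mono norm_app_le) auto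
        finally show ?thesis by (simp add: mult_ac)
      qed
      show "inner (- (W \<cdot> x)) (L \<cdot> y) \<le> g * norm x * norm y" unfolding g_def by (rule *)
      show "inner (- (W \<cdot> x)) ((B * P) \<cdot> u) \<le> h * norm x * norm u" unfolding h_def by (rule *)
    qed
    \<comment> \<open>Young's inequality: each cross term takes 1/16 of the squared norm of
      \<open>x\<close>, which turns -1/4 into -1/8.\<close>
    also have "g * norm x * norm y \<le> (norm x)\<^sup>2 / 16 + 4 * g\<^sup>2 * (norm y)\<^sup>2"
      using sum_squares_bound[of "norm x / 4" "2 * g * norm y"] by (simp add: power2_eq_square mult_ac)
    also have "h * norm x * norm u \<le> (norm x)\<^sup>2 / 16 + 4 * h\<^sup>2 * (norm u)\<^sup>2"
      using sum_squares_bound[of "norm x / 4" "2 * h * norm u"] by (simp add: power2_eq_square mult_ac)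
    finally have Wpart: "inner (W \<cdot> x) (T \<cdot> x) \<le> - (1/8) * (norm x)\<^sup>2 + 4 * g\<^sup>2 * (norm
        y)\<^sup>2 + 4 * h\<^sup>2 * (norm u)\<^sup>2"
      by simp
    have "k * (c' * (norm u)\<^sup>2) \<le> k * inner (P \<cdot> u) u" using k P by (intro mult_left_mono) auto
    moreover have "8 * g\<^sup>2 * (norm y)\<^sup>2 \<le> k * (norm y)\<^sup>2" "8 * h\<^sup>2 * (norm u)\<^sup>2 \<le> k *
        c' * (norm u)\<^sup>2"
      using k by (intro mult_right_mono; simp)+
    moreover have "inner (V \<cdot> x) (T \<cdot> x) = k * inner (X \<cdot> x) (T \<cdot> x) + inner (W \<cdot> x) (T \<cdot> x)"
      by (simp add: V_def inner_add_left)
    moreover have "2 * (k * inner (X \<cdot> x) (T \<cdot> x)) = - (k * (norm y)\<^sup>2) - k * inner (P \<cdot> u) u"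
      using arg_cong[OF Xpart, of "(*) k"] by (simp add: right_diff_distrib)
    ultimately have "inner (V \<cdot> x) (T \<cdot> x) \<le> - (1/8) * (norm x)\<^sup>2"
      using Wpart unfolding mult.assoc by linarith
    then show "inner (V \<cdot> x) ((A - B * P * adj B * X) \<cdot> x) \<le> - (1/8) * (norm x)\<^sup>2"
      by (simp only: T_def)
  qed simp
qed

section \<open>Uniqueness of the stabilizing solution\<close>

text \<open>The equation makes \<open>exp (t *\<^sub>R adj S) * Z * exp (t *\<^sub>R T)\<close>
  constant in \<open>t\<close>, while both exponentials decay.\<close>

lemma exp_decay_sylvester_unique:
  assumes "exp_decay S" "exp_decay T" and eq: "adj S * Z + Z * T = 0"
  shows "Z = 0"
proof -
  obtain E \<alpha> where E: "0 < E" "0 < \<alpha>" "\<And>t. 0 \<le> t \<Longrightarrow> norm (exp (t *\<^sub>R S)) \<le> E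
      * exp (- \<alpha> * t)"
    using assms(1) unfolding exp_decay_def by blast
  obtain F \<beta> where F: "0 < F" "0 < \<beta>" "\<And>t. 0 \<le> t \<Longrightarrow> norm (exp (t *\<^sub>R T)) \<le> F *
      exp (- \<beta> * t)"
    using assms(2) unfolding exp_decay_def by blast
  have bound: "norm Z \<le> E * F * norm Z * exp (- (\<alpha> + \<beta>) * real n)" for n
  proof -
    let ?t = "real n"
    have "(- (?t *\<^sub>R adj S)) * Z = Z * (?t *\<^sub>R T)"
      using eq by (simp add: eq_neg_iff_add_eq_0 flip: scaleR_add_right scaleR_minus_right) (metis add.commute add_eq_0_iff2
          minus_mult_left)
    then have "exp (- (?t *\<^sub>R adj S)) * Z = Z * exp (?t *\<^sub>R T)" by (rule exp_intertwine)
    then have "exp (?t *\<^sub>R adj S) * (exp (- (?t *\<^sub>R adj S)) * Z) = exp (?t *\<^sub>R adj S) * Z * exp (?t *\<^sub>R T)"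
      by (simp add: mult.assoc)
    then have Z: "Z = exp (?t *\<^sub>R adj S) * Z * exp (?t *\<^sub>R T)"
      by (simp add: mult.assoc[symmetric] exp_minus_inverse)
    have aS: "norm (exp (?t *\<^sub>R adj S)) \<le> E * exp (- \<alpha> * ?t)"
      using E(3)[of ?t] norm_adj[of "exp (?t *\<^sub>R S)"] by (simp add: adj_exp)
    have "norm Z \<le> norm (exp (?t *\<^sub>R adj S)) * norm Z * norm (exp (?t *\<^sub>R T))"
      by (subst Z) (rule order_trans[OF norm_mult_ineq mult_right_mono[OF norm_mult_ineq]], simp)
    also have "\<dots> \<le> (E * exp (- \<alpha> * ?t)) * norm Z * (F * exp (- \<beta> * ?t))"
      using E F aS by (intro mult_mono) auto
    also have "\<dots> = E * F * norm Z * exp (- (\<alpha> + \<beta>) * ?t)"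
    proof -
      have "exp (- (\<alpha> + \<beta>) * ?t) = exp (- \<alpha> * ?t) * exp (- \<beta> * ?t)"
        by (simp add: exp_add[symmetric] algebra_simps)
      then show ?thesis by (simp only: mult_ac)
    qed
    finally show ?thesis .
  qed
  have "(\<lambda>n. exp (- (\<alpha> + \<beta>)) ^ n) \<longlonglongrightarrow> 0"
    using E F by (intro LIMSEQ_realpow_zero) auto
  then have "(\<lambda>n. E * F * norm Z * exp (- (\<alpha> + \<beta>)) ^ n) \<longlonglongrightarrow> E * F * norm Z * 0"
    by (intro tendsto_mult tendsto_const)
  moreover have "exp (- (\<alpha> + \<beta>) * real n) = exp (- (\<alpha> + \<beta>)) ^ n" for n
    by (simp add: exp_of_nat_mult[symmetric] mult.commute)
  ultimately have "norm Z \<le> 0"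
    using bound by (intro LIMSEQ_le_const[of "\<lambda>n. E * F * norm Z * exp (- (\<alpha> + \<beta>)) ^ n"]) auto
  then show ?thesis by simp
qed

text \<open>In the difference of the two equations the quadratic terms are absorbed exactly when the
  closed loop of \<open>X\<close> is used on the left and that of \<open>Y\<close> on the
  right.\<close>

lemma riccati_stabilizing_unique:
  assumes X: "adj X = X" "adj A * X + X * A - X * N * X + Q = 0" "exp_decay (A - N * X)"
    and Y: "adj Y = Y" "adj A * Y + Y * A - Y * N * Y + Q = 0" "exp_decay (A - N * Y)"
    and N: "adj N = N"
  shows "Y = X"
proof -
  have "adj (A - N * X) * (X - Y) + (X - Y) * (A - N * Y) =
      (adj A * X + X * A - X * N * X + Q) - (adj A * Y + Y * A - Y * N * Y + Q)"
    by (simp add: X Y N algebra_simps mult.assoc)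
  also have "\<dots> = 0" by (simp only: X Y diff_self)
  finally have "X - Y = 0" by (rule exp_decay_sylvester_unique[OF X(3) Y(3)])
  then show ?thesis by simp
qed

section \<open>Membership of the Riccati solution\<close>

context star_subalgebra
begin

text \<open>
  The graph of \<open>X\<close> is the stable subspace of the Hamiltonian \<open>H = [A, -N; -Q, -A\<^sup>*]\<close>, so the
  Riesz projection \<open>P\<close>
  onto it determines \<open>X\<close>. Contour integrals are not available in a \<open>q\<close>-Banach space. Instead
  \<open>P\<close> is obtained
  from its approximation \<open>\<Theta> = (1 + e\<^sup>t\<^sup>H)\<^sup>-\<^sup>1\<close>, for large \<open>t\<close>, by the power series
  \<open>1/2 + (\<Theta> - 1/2) (1 - 4 (\<Theta> - \<Theta>\<^sup>2))\<^sup>-\<^sup>1\<^sup>/\<^sup>2\<close>, which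
  converges in the algebra.
\<close>

theorem riccati_solution_mem:
  assumes mem: "A \<in> C" "N \<in> C" "Q \<in> C" and N: "adj N = N" and X: "adj X = X"
    and ric: "adj A * X + X * A - X * N * X + Q = 0"
    and stable: "exp_decay (A - N * X)"
  shows "X \<in> C"
proof -
  interpret M: differential_subalgebra C2 nu2 q \<theta> "8 * D" by (rule mat2_subalgebra)
  define T where "T = A - N * X"
  obtain E \<alpha> where E: "0 < E" "0 < \<alpha>" "\<And>t. 0 \<le> t \<Longrightarrow> norm (exp (t *\<^sub>R T)) \<le> E
      * exp (- \<alpha> * t)"
    using stable unfolding exp_decay_def T_def by blast
  \<comment> \<open>Chosen so that the stable semigroup has norm at most 1/32 at time
    \<open>t\<close>, the threshold for inverses within 1/16 of 1. The added 1 keeps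
    \<open>t\<close> nonnegative.\<close>
  define t where "t = ln (32 * E + 1) / \<alpha>"
  have t: "0 \<le> t" using E by (simp add: t_def)
  define a where "a = exp (t *\<^sub>R T)"
  have "- \<alpha> * t = - ln (32 * E + 1)" using E by (simp add: t_def)
  then have "exp (- \<alpha> * t) = 1 / (32 * E + 1)"
    using E by (simp only: exp_minus exp_ln divide_inverse mult_1_left)
  then have "norm a \<le> E / (32 * E + 1)" using E(3)[OF t] by (simp add: a_def)
  also have "\<dots> \<le> 1/32" using E by (simp add: field_simps)
  finally have a: "norm a \<le> 1/32" .
  define H where "H = Mat2 A (- N) (- Q) (- adj A)"
  \<comment> \<open>The Riccati equation says that \<open>H\<close> leaves the graph of
    \<open>X\<close> invariant; the diagonal entries are the closed loop and the negative of its
    adjoint.\<close>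
  have H: "H \<in> graph_inv X" "diag1 X H = T" "diag2 X H = - adj T"
  proof -
    have "- Q - adj A * X = X * A - X * N * X" using ric by (simp add: algebra_simps eq_neg_iff_add_eq_0)
    then show "H \<in> graph_inv X" by (simp add: H_def graph_inv_def algebra_simps mult.assoc)
  qed (simp_all add: H_def diag1_def diag2_def T_def N X)
  have HC: "H \<in> C2" using mem by (auto simp: H_def C2_def intro: uminus_mem adj_mem)
  define \<Phi> where "\<Phi> = exp (t *\<^sub>R H)"
  define d where "d = exp (- (t *\<^sub>R adj T))"
  define d' where "d' = exp (t *\<^sub>R adj T)"
  have \<Phi>: "\<Phi> \<in> graph_inv X" "diag1 X \<Phi> = a" "diag2 X \<Phi> = d"
    using graph_inv_exp[OF graph_inv_linear(3)[OF H(1), of t]] by (simp_all add: \<Phi>_def a_def d_def H)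
  have dd: "d * d' = 1" "d' * d = 1"
    using exp_minus_inverse[of "t *\<^sub>R adj T"] exp_minus_inverse[of "- (t *\<^sub>R adj T)"] by (simp_all add: d_def d'_def)
  have "d' = adj a" by (simp add: d'_def a_def adj_exp)
  then have d': "norm d' \<le> 1/32" using a by simp
  obtain \<theta>\<^sub>1 where \<theta>1: "(1 + a) * \<theta>\<^sub>1 = 1" "\<theta>\<^sub>1 * (1 + a) = 1" "norm
      (\<theta>\<^sub>1 - 1) \<le> 1/16"
    using one_plus_small_inverse[OF a] by blast
  obtain e where e: "(1 + d') * e = 1" "e * (1 + d') = 1" "norm (e - 1) \<le> 1/16"
    using one_plus_small_inverse[OF d'] by blast
  \<comment> \<open>Only the inverse \<open>d'\<close> of \<open>d\<close> is small. Since the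
    inverse of \<open>1 + d\<close> is \<open>d'\<close> times the inverse of \<open>1 + d'\<close>,
    it equals \<open>1 - e\<close> and is close to 0.\<close>
  have e': "1 - e = d' * e" "1 - e = e * d'"
    using e by (simp_all add: distrib_right distrib_left diff_eq_eq add.commute)
  have \<theta>2: "(1 + d) * (1 - e) = 1" "(1 - e) * (1 + d) = 1"
  proof -
    have "(1 + d) * (d' * e) = (1 + d') * e" using dd by (simp add: algebra_simps mult.assoc[symmetric])
    then show "(1 + d) * (1 - e) = 1" using e by (simp only: e'(1))
    have "(e * d') * (1 + d) = e * (1 + d')" using dd by (simp add: algebra_simps mult.assoc)
    then show "(1 - e) * (1 + d) = 1" using e by (simp only: e'(2))
  qed
  have "1 + \<Phi> \<in> graph_inv X" by (intro graph_inv_one graph_inv_linear \<Phi>)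
  from graph_inv_inverse[OF this, of \<theta>\<^sub>1 "1 - e"] obtain \<Theta>
    where \<Theta>: "\<Theta> \<in> graph_inv X" "(1 + \<Phi>) * \<Theta> = 1" "\<Theta> * (1 + \<Phi>) = 1" "diag1 X
        \<Theta> = \<theta>\<^sub>1" "diag2 X \<Theta> = 1 - e"
    using \<theta>1 \<theta>2 by (auto simp: \<Phi>)
  have \<Theta>C: "\<Theta> \<in> C2"
    by (rule mat2_inverse_mem[OF _ \<Theta>(2,3)]) (simp add: \<Phi>_def M.add_mem M.one_mem M.exp_mem M.scaleR_mem HC)
  define r where "r = 4 *\<^sub>R (\<Theta> - \<Theta> * \<Theta>)"
  have r: "r \<in> graph_inv X" unfolding r_def by (intro graph_inv_linear graph_inv_mult \<Theta>)
  have rC: "r \<in> C2" unfolding r_def by (intro M.scaleR_mem M.diff_mem M.mult_mem \<Theta>C)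
  \<comment> \<open>\<open>p - p * p\<close> is invariant under \<open>p \<mapsto> 1 - p\<close>, so
    the estimate near 1 also serves the diagonal entry near 0.\<close>
  have "(1 - e) - (1 - e) * (1 - e) = e - e * e" by (simp add: algebra_simps)
  then have dr: "diag1 X r = 4 *\<^sub>R (\<theta>\<^sub>1 - \<theta>\<^sub>1 * \<theta>\<^sub>1)" "diag2 X r = 4 *\<^sub>R (e - e * e)"
    by (simp_all add: r_def graph_inv_mult \<Theta>)
  obtain c where c: "\<And>n. norm (r ^ n) \<le> c * (2 * (1/3)) ^ n"
    using graph_inv_power_bound[OF r, of "1/3"] rising_series_near_one(1)[OF \<theta>1(3)] rising_series_near_one(1)[OF e(3)] dr
    by auto
  let ?c = "rising_coeff (1/2)"
  have c1: "\<bar>?c n\<bar> \<le> 1" for n using rising_coeff_half[of n] by simp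
  define w where "w = (\<Sum>n. ?c n *\<^sub>R r ^ n)"
  have wC: "w \<in> C2" unfolding w_def by (rule M.power_series_mem[OF rC c _ _ c1]) auto
  have sm: "summable (\<lambda>n. ?c n *\<^sub>R r ^ n)"
  proof (rule summable_comparison_test')
    show "summable (\<lambda>n. c * (2 * (1/3)) ^ n)" by (intro summable_mult summable_geometric) auto
    show "norm (?c n *\<^sub>R r ^ n) \<le> c * (2 * (1/3)) ^ n" for n
      using mult_mono[OF c1 c, of n n] by simp
  qed
  have "?c n *\<^sub>R r ^ n \<in> graph_inv X" for n by (intro graph_inv_linear graph_inv_power r)
  note w = graph_inv_suminf[OF sm this, folded w_def]
  have dw: "diag1 X w = (\<Sum>n. ?c n *\<^sub>R (4 *\<^sub>R (\<theta>\<^sub>1 - \<theta>\<^sub>1 * \<theta>\<^sub>1)) ^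
      n)" "diag2 X w = (\<Sum>n. ?c n *\<^sub>R (4 *\<^sub>R (e - e * e)) ^ n)"
    unfolding w by (simp_all only: diag_simps graph_inv_power[OF r] dr)
  \<comment> \<open>The correction term has diagonal entries 1/2 and -1/2, so those of
    \<open>P\<close> come out as exactly 1 and 0.\<close>
  define P where "P = (1/2) *\<^sub>R 1 + (\<Theta> - (1/2) *\<^sub>R 1) * w"
  have PC: "P \<in> C2" unfolding P_def by (intro M.add_mem M.scaleR_mem M.mult_mem M.diff_mem M.one_mem \<Theta>C wC)
  have half: "(1/2) *\<^sub>R 1 \<in> graph_inv X" by (intro graph_inv_linear graph_inv_one)
  have P: "P \<in> graph_inv X" unfolding P_def by (intro graph_inv_linear(1,2) graph_inv_mult half \<Theta> w)
  have "diag1 X P = (1/2) *\<^sub>R 1 + (\<theta>\<^sub>1 - (1/2) *\<^sub>R 1) * diag1 X w"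
    unfolding P_def diag_simps graph_inv_mult(2)[OF graph_inv_linear(2)[OF \<Theta>(1) half] w(1)] \<Theta> ..
  also have "\<dots> = 1" unfolding dw rising_series_near_one(2)[OF \<theta>1(3)] by (simp flip: scaleR_add_left)
  finally have P1: "diag1 X P = 1" .
  have "diag2 X P = (1/2) *\<^sub>R 1 + (1 - e - (1/2) *\<^sub>R 1) * diag2 X w"
    unfolding P_def diag_simps graph_inv_mult(3)[OF graph_inv_linear(2)[OF \<Theta>(1) half] w(1)] \<Theta> ..
  also have "1 - e - (1/2) *\<^sub>R 1 = - (e - (1/2) *\<^sub>R 1)"
    using scaleR_add_left[of "1/2" "1/2" "1 :: 'i ell2_op"] by (simp add: algebra_simps)
  also have "(1/2) *\<^sub>R 1 + - (e - (1/2) *\<^sub>R 1) * diag2 X w = 0"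
    unfolding dw minus_mult_left[symmetric] rising_series_near_one(2)[OF e(3)] by simp
  finally have P2: "diag2 X P = 0" .
  \<comment> \<open>Diagonal entries 1 and 0 force the second row of \<open>P\<close> to be
    \<open>X\<close> times the first.\<close>
  define F where "F = m11 P"
  define G where "G = m12 P"
  have FG: "F + G * X = 1" using P1 by (simp add: diag1_def F_def G_def)
  have P22: "m22 P = X * G" using P2 by (simp add: diag2_def G_def)
  have P21: "m21 P = X * F"
  proof -
    have "m21 P + X * G * X = X * (F + G * X)" using P unfolding graph_inv_def F_def G_def mem_Collect_eq P22[unfolded G_def] .
    then show ?thesis by (simp add: distrib_left mult.assoc)
  qed
  have PeC: "F \<in> C" "G \<in> C" "X * F \<in> C" "X * G \<in> C"
    using PC P21 P22 by (simp_all add: C2_def F_def G_def)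
  \<comment> \<open>Coercive by \<open>F + G * X = 1\<close>, though neither \<open>F\<close> nor
    \<open>G\<close> is known to be invertible. Since \<open>X * K\<close> is built from entries of
    \<open>P\<close> and adjoints, dividing by \<open>K\<close> yields \<open>X\<close>.\<close>
  define K where "K = F * adj F + G * adj G"
  have K: "K \<in> C" unfolding K_def by (intro add_mem mult_mem adj_mem PeC)
  define k where "k = norm X + 1"
  have k: "1 \<le> k" "norm X \<le> k" by (simp_all add: k_def)
  have coer: "1 / (2 * k\<^sup>2) * (norm x)\<^sup>2 \<le> inner (K \<cdot> x) x" for x
  proof -
    have "adj (F + G * X) \<cdot> x = x" by (simp only: FG adj_simps app_simps)
    then have "x = adj F \<cdot> x + X \<cdot> adj G \<cdot> x" by (simp add: X)
    then have "norm x \<le> norm (adj F \<cdot> x) + norm (X \<cdot> adj G \<cdot> x)" by (metis norm_triangle_ineq)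
    also have "\<dots> \<le> k * norm (adj F \<cdot> x) + k * norm (adj G \<cdot> x)"
    proof (rule add_mono)
      show "norm (adj F \<cdot> x) \<le> k * norm (adj F \<cdot> x)" using mult_right_mono[OF k(1), of "norm (adj F \<cdot> x)"] by simp
      show "norm (X \<cdot> adj G \<cdot> x) \<le> k * norm (adj G \<cdot> x)"
        by (rule order_trans[OF norm_app_le mult_right_mono[OF k(2)]]) simp
    qed
    finally have "(norm x)\<^sup>2 \<le> (k * norm (adj F \<cdot> x) + k * norm (adj G \<cdot> x))\<^sup>2" by (intro power_mono) auto
    also have "\<dots> \<le> 2 * k\<^sup>2 * ((norm (adj F \<cdot> x))\<^sup>2 + (norm (adj G \<cdot> x))\<^sup>2)"
      using sum_squares_bound[of "k * norm (adj F \<cdot> x)" "k * norm (adj G \<cdot> x)"]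
      by (simp add: power2_sum power_mult_distrib algebra_simps)
    also have "(norm (adj F \<cdot> x))\<^sup>2 + (norm (adj G \<cdot> x))\<^sup>2 = inner (K \<cdot> x) x"
      by (simp add: K_def inner_add_left inner_adj power2_norm_eq_inner)
    finally show ?thesis using k by (simp add: field_simps)
  qed
  have "0 < 1 / (2 * k\<^sup>2)" using k by simp
  then obtain J where J: "J \<in> C" "K * J = 1"
    using coercive_inverse_mem[OF K _ coer] by blast
  have "X = X * K * J" using J by (simp add: mult.assoc)
  also have "X * K = (X * F) * adj F + (X * G) * adj G" by (simp add: K_def distrib_left mult.assoc)
  finally show ?thesis using PeC J by (metis add_mem adj_mem mult_mem)
qed

end

section \<open>Operators over a subset\<close>

lemma coord_id_on: "coord (id_on G \<cdot> x) i = (if i \<in> G then coord x i else 0)"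
  by (simp add: restrict_ell2.rep_eq)

lemma mem_ell2_on_iff: "x \<in> ell2_on G \<longleftrightarrow> id_on G \<cdot> x = x"
  by (auto simp: ell2_on_def coord_inject[symmetric] fun_eq_iff coord_id_on simp del: id_on_app)

lemma mem_ell2_on_compl_iff: "x \<in> ell2_on (- G) \<longleftrightarrow> id_on G \<cdot> x = 0"
  by (auto simp: ell2_on_def coord_inject[symmetric] fun_eq_iff coord_id_on simp del: id_on_app)

lemma id_on_idem: "id_on G * id_on G = id_on G"
  by (rule ell2_op_eqI) (simp add: coord_inject[symmetric] fun_eq_iff coord_id_on del: id_on_app)

lemma adj_id_on [simp]: "adj (id_on G) = id_on G"
  by (rule adj_eqI, unfold inner_ell2_def, rule infsum_cong) (simp add: coord_id_on del: id_on_app)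

lemma ops_on_iff: "T \<in> ops_on G \<longleftrightarrow> id_on G * T = T \<and> T * id_on G = T"
proof
  assume T: "T \<in> ops_on G"
  have "id_on G * T = T"
    using T by (intro ell2_op_eqI) (simp add: ops_on_def mem_ell2_on_iff del: id_on_app)
  moreover have "T * id_on G = T"
  proof (rule ell2_op_eqI)
    fix x
    have "id_on G \<cdot> (x - id_on G \<cdot> x) = (id_on G - id_on G * id_on G) \<cdot> x"
      by (simp add: app_linear_simps del: id_on_app)
    then have "x - id_on G \<cdot> x \<in> ell2_on (- G)" by (simp add: id_on_idem mem_ell2_on_compl_iff del: id_on_app)
    then have "T \<cdot> (x - id_on G \<cdot> x) = 0" using T by (simp add: ops_on_def del: id_on_app)
    then show "(T * id_on G) \<cdot> x = T \<cdot> x" by (simp add: app_linear_simps del: id_on_app)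
  qed
  ultimately show "id_on G * T = T \<and> T * id_on G = T" ..
next
  assume T: "id_on G * T = T \<and> T * id_on G = T"
  then have "id_on G \<cdot> T \<cdot> x = T \<cdot> x" "T \<cdot> id_on G \<cdot> x = T \<cdot> x" for x
    by (metis app_simps(6))+
  moreover have "T \<cdot> x = 0" if "x \<in> ell2_on (- G)" for x
  proof -
    have "id_on G \<cdot> x = 0" using that by (simp only: mem_ell2_on_compl_iff)
    then show ?thesis using \<open>T \<cdot> id_on G \<cdot> x = T \<cdot> x\<close> by (simp only: app_linear_simps)
  qed
  ultimately show "T \<in> ops_on G" by (simp add: ops_on_def mem_ell2_on_iff del: id_on_app)
qed

lemma norm_id_on_le: "norm (id_on G) \<le> 1"
  by (rule norm_ell2_op_bound) (simp_all add: norm_restrict_ell2)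

lemma norm_compl_id_on_le: "norm (1 - id_on G) \<le> 1"
proof -
  have "1 - id_on G = id_on (- G)"
    by (rule ell2_op_eqI) (simp add: coord_inject[symmetric] fun_eq_iff coord_id_on del: id_on_app)
  then show ?thesis by (simp add: norm_id_on_le)
qed

lemma norm_id_on_pythagoras: "(norm x)\<^sup>2 = (norm (id_on G \<cdot> x))\<^sup>2 + (norm ((1 - id_on G) \<cdot> x))\<^sup>2"
proof -
  have "inner (id_on G \<cdot> x) ((1 - id_on G) \<cdot> x) = inner x ((id_on G - id_on G * id_on G) \<cdot> x)"
    using inner_adj[of "id_on G" x "(1 - id_on G) \<cdot> x"] by (simp add: app_linear_simps del: id_on_app)
  then have "inner (id_on G \<cdot> x) ((1 - id_on G) \<cdot> x) = 0" by (simp add: id_on_idem del: id_on_app)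
  moreover have "x = id_on G \<cdot> x + (1 - id_on G) \<cdot> x" by (simp del: id_on_app)
  ultimately show ?thesis
    using power2_norm_eq_inner by (smt (verit, ccfv_SIG) inner_add_left inner_add_right inner_commute)
qed

lemma positive_on_inner:
  assumes "positive_on G Q"
  shows "adj Q = Q" "Q \<in> ops_on G" "0 \<le> inner (Q \<cdot> x) x"
proof -
  show Q: "adj Q = Q" "Q \<in> ops_on G" using assms by (simp_all add: positive_on_def)
  then have PQ: "id_on G * Q * id_on G = Q" by (simp add: ops_on_iff)
  have "inner (Q \<cdot> x) x = inner (id_on G \<cdot> Q \<cdot> id_on G \<cdot> x) x"
    using PQ by (metis app_simps(6))
  also have "\<dots> = inner (Q \<cdot> id_on G \<cdot> x) (id_on G \<cdot> x)"
    using inner_adj[of "id_on G"] by (simp del: id_on_app)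
  also have "\<dots> \<ge> 0"
  proof -
    have "id_on G \<cdot> x \<in> ell2_on G" unfolding mem_ell2_on_iff by (simp only: app_simps(6)[symmetric] id_on_idem)
    then show ?thesis using assms by (simp add: positive_on_def Re_cinner)
  qed
  finally show "0 \<le> inner (Q \<cdot> x) x" .
qed

lemma strictly_positive_on_inner:
  assumes "strictly_positive_on G R"
  shows "adj R = R" "R \<in> ops_on G" "\<exists>c>0. \<forall>x. c * (norm x)\<^sup>2 \<le> inner ((R + (1 - id_on G)) \<cdot> x) x"
proof -
  let ?P = "id_on G"
  show R: "adj R = R" "R \<in> ops_on G" using assms by (simp_all add: strictly_positive_on_def)
  obtain c where c: "0 < c" "\<And>x. x \<in> ell2_on G \<Longrightarrow> c * (norm x)\<^sup>2 \<le> inner (R \<cdot> x) x"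
    using assms by (auto simp: strictly_positive_on_def Re_cinner)
  \<comment> \<open>The form splits along \<open>G\<close> and its complement; on the complement the
    added projection contributes the constant 1.\<close>
  have "min c 1 * (norm x)\<^sup>2 \<le> inner ((R + (1 - ?P)) \<cdot> x) x" for x
  proof -
    have PR: "?P * R * ?P = R" using R by (simp add: ops_on_iff)
    have "inner (R \<cdot> x) x = inner (?P \<cdot> R \<cdot> ?P \<cdot> x) x"
      using PR by (metis app_simps(6))
    also have "\<dots> = inner (R \<cdot> ?P \<cdot> x) (?P \<cdot> x)"
      using inner_adj[of ?P] by (simp del: id_on_app)
    finally have 1: "inner (R \<cdot> x) x = inner (R \<cdot> ?P \<cdot> x) (?P \<cdot> x)" .
    have "inner ((1 - ?P) \<cdot> x) ((1 - ?P) \<cdot> x) = inner x (((1 - ?P) * (1 - ?P)) \<cdot> x)"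
      using inner_adj[of "1 - ?P" x "(1 - ?P) \<cdot> x"] by (simp del: id_on_app)
    also have "(1 - ?P) * (1 - ?P) = 1 - ?P" by (simp add: algebra_simps id_on_idem)
    finally have 2: "inner ((1 - ?P) \<cdot> x) x = (norm ((1 - ?P) \<cdot> x))\<^sup>2"
      by (simp add: power2_norm_eq_inner inner_commute del: id_on_app app_simps)
    have "?P \<cdot> x \<in> ell2_on G" unfolding mem_ell2_on_iff by (simp only: app_simps(6)[symmetric] id_on_idem)
    from c(2)[OF this] have "min c 1 * (norm (?P \<cdot> x))\<^sup>2 \<le> inner (R \<cdot> x) x"
      unfolding 1 by (rule order_trans[OF mult_right_mono, rotated 2]) auto
    moreover have "min c 1 * (norm ((1 - ?P) \<cdot> x))\<^sup>2 \<le> inner ((1 - ?P) \<cdot> x) x"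
      unfolding 2 using mult_right_mono[of "min c 1" 1 "(norm ((1 - ?P) \<cdot> x))\<^sup>2"] by simp
    ultimately show ?thesis
      unfolding norm_id_on_pythagoras[of x G] app_simps(3)[of R] inner_add_left distrib_left by (rule add_mono)
  qed
  moreover have "0 < min c 1" using c by simp
  ultimately show "\<exists>c>0. \<forall>x. c * (norm x)\<^sup>2 \<le> inner ((R + (1 - ?P)) \<cdot> x) x" by blast
qed

lemma sqrt_on_square:
  assumes Q: "positive_on G Q"
  shows "positive_on G (sqrt_on G Q)" "sqrt_on G Q * sqrt_on G Q = Q"
proof -
  let ?P = "id_on G"
  obtain S where S: "adj S = S" "\<And>x. 0 \<le> inner (S \<cdot> x) x" "S * S = Q" "\<And>T. T * Q = Q * T
      \<Longrightarrow> T * S = S * T"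
    using positive_sqrt_exists[OF positive_on_inner(1,3)[OF Q]] by blast
  \<comment> \<open>\<open>Q\<close> vanishes on the complement of \<open>G\<close>, and
    \<open>S * S = Q\<close> with \<open>S\<close> self-adjoint makes \<open>S\<close> vanish there
    too, so the root on the whole space is a root on \<open>G\<close>.\<close>
  have "S * (1 - ?P) = 0"
  proof (rule ell2_op_eqI)
    fix x
    let ?y = "(1 - ?P) \<cdot> x"
    have "Q * (1 - ?P) = 0" using positive_on_inner(2)[OF Q] by (simp add: ops_on_iff right_diff_distrib)
    then have "Q \<cdot> ?y = 0" by (metis app_simps(1,6))
    then have "S \<cdot> S \<cdot> ?y = 0" using S(3) by (metis app_simps(6))
    then have "inner (S \<cdot> ?y) (S \<cdot> ?y) = 0" using inner_adj[of S ?y "S \<cdot> ?y"] S(1) by simp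
    then show "(S * (1 - ?P)) \<cdot> x = 0 \<cdot> x" by (simp del: id_on_app)
  qed
  then have SP: "S * ?P = S" by (simp add: right_diff_distrib)
  have PS: "?P * S = S" using arg_cong[OF SP, of adj] by (simp only: adj_simps adj_id_on S(1))
  have "positive_on G S"
    unfolding positive_on_def ops_on_iff Re_cinner using PS SP S(1,2) by blast
  \<comment> \<open>Any other root commutes with its own square \<open>Q\<close>, hence with
    \<open>S\<close>.\<close>
  moreover have "S' = S" if S': "positive_on G S'" "S' * S' = Q" for S'
  proof (rule positive_sqrt_unique[OF positive_on_inner(1,3)[OF S'(1)] S(1,2)])
    show "S' * S' = S * S" by (simp only: S'(2) S(3))
    have "S' * Q = Q * S'" unfolding S'(2)[symmetric] by (rule mult.assoc[symmetric])
    then show "S' * S = S * S'" by (rule S(4))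
  qed
  ultimately have "\<exists>!S. positive_on G S \<and> S * S = Q" using S(3) by blast
  from theI'[OF this] show "positive_on G (sqrt_on G Q)" "sqrt_on G Q * sqrt_on G Q = Q"
    unfolding sqrt_on_def by simp_all
qed

text \<open>The shifted operator acts as \<open>S\<close> on the coordinates in \<open>G\<close> and
  as -1 on the others. The projections intertwine it with \<open>S\<close> and with the scalar
  -1.\<close>

lemma exp_shifted:
  assumes S: "S \<in> ops_on G"
  shows "exp (t *\<^sub>R (S - (1 - id_on G))) * id_on G = exp_on G (t *\<^sub>R S)"
    and "exp (t *\<^sub>R (S - (1 - id_on G))) * (1 - id_on G) = exp (- t) *\<^sub>R (1 - id_on G)"
proof -
  let ?P = "id_on G"
  let ?T = "t *\<^sub>R (S - (1 - ?P))"
  have PS: "?P * S = S" "S * ?P = S" using S by (simp_all add: ops_on_iff)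
  have "?T * ?P = ?P * (t *\<^sub>R S)" by (simp add: algebra_simps PS id_on_idem)
  then show "exp ?T * ?P = exp_on G (t *\<^sub>R S)" unfolding exp_on_def by (rule exp_intertwine)
  have "?T * (1 - ?P) = (1 - ?P) * of_real (- t)"
    by (simp add: of_real_def algebra_simps PS id_on_idem)
  then have "exp ?T * (1 - ?P) = (1 - ?P) * exp (of_real (- t))" by (rule exp_intertwine)
  then show "exp ?T * (1 - ?P) = exp (- t) *\<^sub>R (1 - ?P)" by (simp only: exp_of_real) (simp add: of_real_def)
qed

lemma exp_decay_shifted:
  assumes "exp_stable_on G (ops_on G) norm S"
  shows "exp_decay (S - (1 - id_on G))"
proof -
  let ?P = "id_on G"
  obtain E \<alpha> where E: "0 < E" "0 < \<alpha>" "\<And>t. 0 \<le> t \<Longrightarrow> norm (exp_on G (t *\<^sub>R S))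
      \<le> E * exp (- \<alpha> * t)" and S: "S \<in> ops_on G"
    using assms unfolding exp_stable_on_def by blast
  have "norm (exp (t *\<^sub>R (S - (1 - ?P)))) \<le> (E + 1) * exp (- min \<alpha> 1 * t)" if t: "0 \<le> t" for t
  proof -
    let ?e = "exp (t *\<^sub>R (S - (1 - ?P)))"
    have mono: "exp (- \<alpha> * t) \<le> exp (- min \<alpha> 1 * t)" "exp (- t) \<le> exp (- min \<alpha> 1 * t)"
      using mult_right_mono[of "min \<alpha> 1" \<alpha> t] mult_right_mono[of "min \<alpha> 1" 1 t] t by simp_all
    have "norm ?e = norm (?e * ?P + ?e * (1 - ?P))" by (simp add: right_diff_distrib)
    also have "\<dots> \<le> norm (?e * ?P) + norm (?e * (1 - ?P))" by (rule norm_triangle_ineq)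
    also have "\<dots> \<le> E * exp (- \<alpha> * t) + exp (- t) * 1"
      unfolding exp_shifted[OF S]
      by (intro add_mono E(3) t) (simp add: norm_compl_id_on_le)
    also have "\<dots> \<le> E * exp (- min \<alpha> 1 * t) + exp (- min \<alpha> 1 * t) * 1"
      using E mono by (intro add_mono mult_left_mono mult_right_mono) auto
    finally show ?thesis by (simp add: algebra_simps)
  qed
  then show ?thesis
    unfolding exp_decay_def using E by (intro exI[of _ "E + 1"] conjI exI[of _ "min \<alpha> 1"]) auto
qed

section \<open>Unitization\<close>

lemma norm_suminf_powr_le:
  fixes x :: "nat \<Rightarrow> 'a::banach"
  assumes q: "0 < q" "q \<le> 1" and x: "summable x" and sm: "summable (\<lambda>n. norm (x n) powr q)"
  shows "norm (suminf x) powr q \<le> (\<Sum>n. norm (x n) powr q)"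
proof (rule LIMSEQ_le_const2)
  show "(\<lambda>n. norm (\<Sum>k<n. x k) powr q) \<longlonglongrightarrow> norm (suminf x) powr q"
    using q by (intro tendsto_powr' tendsto_norm summable_LIMSEQ[OF x] tendsto_const) auto
  have "norm (\<Sum>k<n. x k) powr q \<le> (\<Sum>k<n. norm (x k) powr q)" for n
  proof (induction n)
    case (Suc n)
    have "norm (\<Sum>k<Suc n. x k) powr q \<le> (norm (\<Sum>k<n. x k) + norm (x n)) powr q"
      using q by (intro powr_mono2) (auto simp: norm_triangle_ineq)
    also have "\<dots> \<le> norm (\<Sum>k<n. x k) powr q + norm (x n) powr q"
      using q by (intro powr_subadditive) auto
    finally show ?case using Suc by simp
  qed simp
  also have "(\<Sum>k<n. norm (x k) powr q) \<le> (\<Sum>n. norm (x n) powr q)" for n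
    by (rule sum_le_suminf[OF sm]) auto
  finally show "\<exists>N. \<forall>n\<ge>N. norm (\<Sum>k<n. x k) powr q \<le> (\<Sum>n. norm (x n) powr q)" by blast
qed

lemma scaleR_eq_scaleC: "r *\<^sub>R (T :: 'i ell2_op) = complex_of_real r *\<^sub>C T"
  by (rule ell2_op_eqI) (simp add: coord_inject[symmetric] fun_eq_iff scaleC_ell2.rep_eq)

context proper_q_banach_algebra_on
begin

lemma scaleR_mem: "T \<in> \<A> \<Longrightarrow> r *\<^sub>R T \<in> \<A>"
  by (simp add: scaleR_eq_scaleC scaleC_mem)

lemma nrm_scaleR: "T \<in> \<A> \<Longrightarrow> nrm (r *\<^sub>R T) = \<bar>r\<bar> * nrm T"
  by (simp add: scaleR_eq_scaleC nrm_scaleC)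

lemma diff_mem: "\<lbrakk>S \<in> \<A>; T \<in> \<A>\<rbrakk> \<Longrightarrow> S - T \<in> \<A>"
  using add_mem[OF _ scaleR_mem[of T "-1"], of S] by simp

lemma sum_mem: "(\<And>k. k \<in> F \<Longrightarrow> Y k \<in> \<A>) \<Longrightarrow> sum Y F \<in> \<A>"
  by (induction F rule: infinite_finite_induct) (auto intro: zero_mem add_mem)

lemma nrm_sum_powr_le:
  "(\<And>k. k \<in> F \<Longrightarrow> Y k \<in> \<A>) \<Longrightarrow> nrm (sum Y F) powr q \<le> (\<Sum>k\<in>F. nrm (Y k) powr q)"
proof (induction F rule: infinite_finite_induct)
  case (insert k F)
  then have "nrm (Y k + sum Y F) powr q \<le> nrm (Y k) powr q + nrm (sum Y F) powr q"
    by (intro nrm_add sum_mem) auto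
  then show ?case using insert by fastforce
qed (use nrm_eq_0_iff[OF zero_mem] in auto)

text \<open>The partial sums are Cauchy for \<open>nrm\<close>. Since \<open>nrm\<close> dominates
  the operator norm, their limit in the algebra is also the sum in operator norm.\<close>

lemma series_mem:
  assumes Y: "\<And>n. Y n \<in> \<A>" and sm: "summable (\<lambda>n. nrm (Y n) powr q)"
  shows "summable Y" "suminf Y \<in> \<A>" "nrm (suminf Y) powr q \<le> (\<Sum>n. nrm (Y n) powr q)"
proof -
  define S where "S n = (\<Sum>k<n. Y k)" for n
  have S: "S n \<in> \<A>" for n unfolding S_def by (intro sum_mem Y)
  have diff: "nrm (S m - S n) powr q \<le> \<bar>\<Sum>k=n..<m. nrm (Y k) powr q\<bar>" if "n \<le> m" for m n
  proof -
    have "S m - S n = (\<Sum>k=n..<m. Y k)"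
      unfolding S_def using sum_diff_nat_ivl[of 0 n m Y] that by (simp add: atLeast0LessThan)
    then show ?thesis using nrm_sum_powr_le[of "{n..<m}" Y] Y by (simp add: abs_of_nonneg sum_nonneg)
  qed
  have sym: "nrm (S m - S n) = nrm (S n - S m)" for m n
    using nrm_scaleR[OF diff_mem[OF S[of n] S[of m]], of "-1"] by simp
  have "\<exists>L\<in>\<A>. (\<lambda>n. nrm (S n - L) powr q) \<longlonglongrightarrow> 0"
  proof (rule complete[OF S], intro allI impI)
    fix e :: real assume "0 < e"
    then obtain N where N: "\<And>m n. m \<ge> N \<Longrightarrow> norm (\<Sum>k=m..<n. nrm (Y k) powr q) < e"
      using sm unfolding summable_Cauchy by blast
    have "nrm (S m - S n) powr q < e" if "m \<ge> N" "n \<ge> N" for m n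
    proof (cases "n \<le> m")
      case True
      then show ?thesis using diff[of n m] N[of n m] that by simp
    next
      case False
      then show ?thesis using diff[of m n] N[of m n] that sym[of m n] by simp
    qed
    then show "\<exists>N. \<forall>m\<ge>N. \<forall>n\<ge>N. nrm (S m - S n) powr q < e" by blast
  qed
  then obtain L where L: "L \<in> \<A>" "(\<lambda>n. nrm (S n - L) powr q) \<longlonglongrightarrow> 0" by blast
  have "(\<lambda>n. (nrm (S n - L) powr q) powr (1 / q)) \<longlonglongrightarrow> 0 powr (1 / q)"
    using q_pos by (intro tendsto_powr' L tendsto_const) auto
  then have "(\<lambda>n. nrm (S n - L)) \<longlonglongrightarrow> 0"
    using q_pos nrm_nonneg[OF diff_mem[OF S L(1)]] by (simp add: powr_powr)
  then have "(\<lambda>n. S n - L) \<longlonglongrightarrow> 0"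
    by (rule Lim_null_comparison[rotated]) (intro always_eventually allI norm_le_nrm diff_mem S L)
  then have "Y sums L" unfolding sums_def S_def[symmetric] by (rule LIM_zero_cancel)
  then show "summable Y" "suminf Y \<in> \<A>" using L(1) by (auto simp: sums_iff)
  have "nrm L powr q \<le> (\<Sum>n. nrm (Y n) powr q)"
  proof (rule LIMSEQ_le_const)
    show "(\<lambda>n. nrm (S n - L) powr q + (\<Sum>n. nrm (Y n) powr q)) \<longlonglongrightarrow> (\<Sum>n. nrm (Y n) powr q)"
      using tendsto_add[OF L(2) tendsto_const[of "\<Sum>n. nrm (Y n) powr q"]] by simp
    have "nrm L powr q \<le> nrm (S n - L) powr q + (\<Sum>n. nrm (Y n) powr q)" for n
    proof -
      have "nrm ((L - S n) + S n) powr q \<le> nrm (L - S n) powr q + nrm (S n) powr q"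
        by (intro nrm_add diff_mem S L)
      moreover have "nrm (L - S n) = nrm (S n - L)"
        using nrm_scaleR[OF diff_mem[OF S[of n] L(1)], of "-1"] by simp
      moreover have "nrm (S n) powr q \<le> (\<Sum>k<n. nrm (Y k) powr q)"
        unfolding S_def by (intro nrm_sum_powr_le Y)
      moreover have "(\<Sum>k<n. nrm (Y k) powr q) \<le> (\<Sum>n. nrm (Y n) powr q)"
        by (rule sum_le_suminf[OF sm]) auto
      ultimately show ?thesis by simp
    qed
    then show "\<exists>N. \<forall>n\<ge>N. nrm L powr q \<le> nrm (S n - L) powr q + (\<Sum>n. nrm (Y n) powr q)" by blast
  qed
  then show "nrm (suminf Y) powr q \<le> (\<Sum>n. nrm (Y n) powr q)" using \<open>Y sums L\<close> by (simp add: sums_iff)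
qed

text \<open>Adjoins the real multiples of the complementary projection, so that 1 belongs to the
  algebra. If \<open>G\<close> is the whole index set that projection is 0 and the scalar is not
  determined, hence the existential quantifier.\<close>

definition unit_alg :: "'i ell2_op set" where
  "unit_alg = {S. S * id_on G \<in> \<A> \<and> (\<exists>c. S * (1 - id_on G) = c *\<^sub>R (1 - id_on G))}"

definition unit_nu :: "'i ell2_op \<Rightarrow> real" where
  "unit_nu S = nrm (S * id_on G) powr q + norm (S * (1 - id_on G)) powr q"

lemma mem_ops: "T \<in> \<A> \<Longrightarrow> id_on G * T = T" "T \<in> \<A> \<Longrightarrow> T * id_on G = T"
  using subset_ops ops_on_iff by blast+

lemma unit_alg_commute:
  assumes S: "S \<in> unit_alg"
  shows "id_on G * S = S * id_on G" "(1 - id_on G) * S = S * (1 - id_on G)"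
proof -
  let ?P = "id_on G"
  obtain c where c: "S * (1 - ?P) = c *\<^sub>R (1 - ?P)" and SP: "S * ?P \<in> \<A>" using S by (auto simp: unit_alg_def)
  have "?P * S = ?P * (S * ?P) + ?P * (S * (1 - ?P))" by (simp add: right_diff_distrib)
  also have "?P * (S * (1 - ?P)) = 0" unfolding c by (simp add: right_diff_distrib id_on_idem)
  finally show 1: "?P * S = S * ?P" using mem_ops(1)[OF SP] by simp
  show "(1 - ?P) * S = S * (1 - ?P)" by (simp add: left_diff_distrib right_diff_distrib 1)
qed

lemma unit_alg_mult:
  assumes S: "S \<in> unit_alg" and T: "T \<in> unit_alg"
  shows "S * T * id_on G = (S * id_on G) * (T * id_on G)"
    "S * T * (1 - id_on G) = (S * (1 - id_on G)) * (T * (1 - id_on G))"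
proof -
  let ?P = "id_on G"
  have "(S * ?P) * (T * ?P) = S * (?P * T) * ?P" by (simp add: mult.assoc)
  also have "\<dots> = S * T * (?P * ?P)" unfolding unit_alg_commute[OF T] by (simp only: mult.assoc)
  finally show "S * T * ?P = (S * ?P) * (T * ?P)" by (simp only: id_on_idem)
  have idem: "(1 - ?P) * (1 - ?P) = 1 - ?P" by (simp add: algebra_simps id_on_idem)
  have "(S * (1 - ?P)) * (T * (1 - ?P)) = S * ((1 - ?P) * T) * (1 - ?P)" by (simp only: mult.assoc)
  also have "\<dots> = S * T * ((1 - ?P) * (1 - ?P))" unfolding unit_alg_commute(2)[OF T] by (simp only: mult.assoc)
  finally show "S * T * (1 - ?P) = (S * (1 - ?P)) * (T * (1 - ?P))" by (simp only: idem)
qed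

text \<open>The exponent \<open>\<theta> / 2\<close> instead of \<open>\<theta>\<close> makes \<open>1 - \<theta>\<close> positive.\<close>

lemma differential':
  "\<exists>\<theta> D. 0 < \<theta> \<and> \<theta> < 1 \<and> 0 < D \<and> (\<forall>S\<in>\<A>. \<forall>T\<in>\<A>. nrm
      (S * T) powr q \<le> D *
    ((nrm S powr q) powr (1 - \<theta>) * norm S powr (q * \<theta>) * nrm T powr q +
      nrm S powr q * ((nrm T powr q) powr (1 - \<theta>) * norm T powr (q * \<theta>))))"
proof -
  obtain \<theta> D where \<theta>: "0 < \<theta>" "\<theta> \<le> 1" "0 < D" and diff: "\<And>S T. \<lbrakk>S \<in> \<A>; T
      \<in> \<A>\<rbrakk> \<Longrightarrow>
      nrm (S * T) powr q \<le> D * nrm S powr q * nrm T powr q *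
        ((norm S / nrm S) powr (q * \<theta>) + (norm T / nrm T) powr (q * \<theta>))"
    using differential by blast
  have ratio: "nrm T powr q * (norm T / nrm T) powr (q * \<theta>) \<le> (nrm T powr q) powr (1 - \<theta>/2) * norm T powr
      (q * (\<theta>/2))"
    if T: "T \<in> \<A>" for T
  proof (cases "nrm T = 0")
    case False
    then have pos: "0 < nrm T" using nrm_nonneg[OF T] by simp
    \<comment> \<open>Lowering the exponent of a quotient that is at most 1 only enlarges the
      power.\<close>
    have "norm T / nrm T \<le> 1" using norm_le_nrm[OF T] pos by simp
    then have "(norm T / nrm T) powr (q * \<theta>) \<le> (norm T / nrm T) powr (q * (\<theta>/2))"
      using pos q_pos \<theta> by (intro powr_mono') auto
    then have "nrm T powr q * (norm T / nrm T) powr (q * \<theta>) \<le> nrm T powr q * (norm T / nrm T) powr (q * (\<theta>/2))"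
      by (intro mult_left_mono) auto
    also have "\<dots> = nrm T powr (q - q * (\<theta>/2)) * norm T powr (q * (\<theta>/2))"
      using pos by (simp add: powr_divide powr_diff)
    also have "q - q * (\<theta>/2) = q * (1 - \<theta>/2)" by (simp add: algebra_simps)
    finally show ?thesis by (simp add: powr_powr)
  qed simp
  have "nrm (S * T) powr q \<le> D * ((nrm S powr q) powr (1 - \<theta>/2) * norm S powr (q * (\<theta>/2)) * nrm T powr q +
      nrm S powr q * ((nrm T powr q) powr (1 - \<theta>/2) * norm T powr (q * (\<theta>/2))))" if "S \<in> \<A>" "T \<in> \<A>" for S T
  proof -
    have "nrm (S * T) powr q \<le> D * ((nrm S powr q * (norm S / nrm S) powr (q * \<theta>)) * nrm T powr q +
        nrm S powr q * (nrm T powr q * (norm T / nrm T) powr (q * \<theta>)))"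
      using diff[OF that] by (simp add: algebra_simps)
    also have "\<dots> \<le> D * ((nrm S powr q) powr (1 - \<theta>/2) * norm S powr (q * (\<theta>/2)) * nrm T powr q +
        nrm S powr q * ((nrm T powr q) powr (1 - \<theta>/2) * norm T powr (q * (\<theta>/2))))"
      using \<theta> by (intro mult_left_mono add_mono mult_right_mono ratio that) auto
    finally show ?thesis .
  qed
  then show ?thesis using \<theta> by (intro exI[of _ "\<theta>/2"] exI[of _ D]) auto
qed

lemma star_subalgebra_unit_alg: "\<exists>\<theta> D. star_subalgebra unit_alg unit_nu q \<theta> D"
proof -
  let ?P = "id_on G"
  obtain \<theta> D where \<theta>: "0 < \<theta>" "\<theta> < 1" and D: "0 < D" and diff: "\<And>S T. \<lbrakk>S \<in>
      \<A>; T \<in> \<A>\<rbrakk> \<Longrightarrow> nrm (S * T) powr q \<le> D *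
      ((nrm S powr q) powr (1 - \<theta>) * norm S powr (q * \<theta>) * nrm T powr q +
        nrm S powr q * ((nrm T powr q) powr (1 - \<theta>) * norm T powr (q * \<theta>)))"
    using differential' by blast
  have norm_P: "norm (S * ?P) \<le> norm S" "norm (S * (1 - ?P)) \<le> norm S" for S
    using order_trans[OF norm_mult_ineq mult_left_mono[OF norm_id_on_le]]
      order_trans[OF norm_mult_ineq mult_left_mono[OF norm_compl_id_on_le]] by force+
  have split: "S = S * ?P + S * (1 - ?P)" for S by (simp add: right_diff_distrib)
  have memP: "S * ?P \<in> \<A>" if "S \<in> unit_alg" for S using that by (simp add: unit_alg_def)
  have powr_q: "(x + y) powr q \<le> x powr q + y powr q" if "0 \<le> x" "0 \<le> y" for x y
    using that q_pos q_le_1 by (rule powr_subadditive)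
  \<comment> \<open>\<open>D\<close> accounts for the block in \<open>\<A>\<close>, the 1 for the
    scalar block.\<close>
  have "star_subalgebra unit_alg unit_nu q \<theta> (D + 1)"
  proof (intro star_subalgebra.intro star_subalgebra_axioms.intro differential_subalgebra.intro)
    show "1 \<in> unit_alg" using id_mem by (auto simp: unit_alg_def intro: exI[of _ 1])
    fix S T :: "'i ell2_op" and c :: real
    assume T: "T \<in> unit_alg"
    then obtain d where d: "T * (1 - ?P) = d *\<^sub>R (1 - ?P)" by (auto simp: unit_alg_def)
    show "c *\<^sub>R T \<in> unit_alg"
      using memP[OF T] d by (auto simp: unit_alg_def scaleR_mem intro!: exI[of _ "c * d"])
    show nn: "0 \<le> unit_nu T" by (simp add: unit_nu_def)
    show "unit_nu (c *\<^sub>R T) = \<bar>c\<bar> powr q * unit_nu T"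
      using nrm_nonneg[OF memP[OF T]] by (simp add: unit_nu_def nrm_scaleR memP[OF T] powr_mult distrib_left)
    show "norm T powr q \<le> unit_nu T"
    proof -
      have "norm T \<le> nrm (T * ?P) + norm (T * (1 - ?P))"
        using norm_triangle_ineq[of "T * ?P" "T * (1 - ?P)"] norm_le_nrm[OF memP[OF T]] split[of T] by simp
      then have "norm T powr q \<le> (nrm (T * ?P) + norm (T * (1 - ?P))) powr q"
        using q_pos by (intro powr_mono2) auto
      also have "\<dots> \<le> unit_nu T" unfolding unit_nu_def by (intro powr_q nrm_nonneg memP T norm_ge_zero)
      finally show ?thesis .
    qed
    show "adj T \<in> unit_alg"
    proof -
      have "adj T * ?P = adj (?P * T)" "adj T * (1 - ?P) = adj ((1 - ?P) * T)" by simp_all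
      then have "adj T * ?P = adj (T * ?P)" "adj T * (1 - ?P) = d *\<^sub>R (1 - ?P)"
        unfolding unit_alg_commute[OF T] d by simp_all
      then show ?thesis unfolding unit_alg_def mem_Collect_eq using adj_mem[OF memP[OF T]] by metis
    qed
    assume S: "S \<in> unit_alg"
    then obtain c where c: "S * (1 - ?P) = c *\<^sub>R (1 - ?P)" by (auto simp: unit_alg_def)
    show "S + T \<in> unit_alg"
      using memP[OF S] memP[OF T] c d
      by (auto simp: unit_alg_def distrib_right add_mem scaleR_add_left intro!: exI[of _ "c + d"])
    show "unit_nu (S + T) \<le> unit_nu S + unit_nu T"
    proof -
      have "norm (S * (1 - ?P) + T * (1 - ?P)) powr q \<le> (norm (S * (1 - ?P)) + norm (T * (1 - ?P))) powr q"
        using q_pos by (intro powr_mono2 norm_triangle_ineq) auto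
      also have "\<dots> \<le> norm (S * (1 - ?P)) powr q + norm (T * (1 - ?P)) powr q" by (intro powr_q norm_ge_zero)
      finally show ?thesis
        using nrm_add[OF memP[OF S] memP[OF T]] by (simp only: unit_nu_def distrib_right)
    qed
    have idem: "(1 - ?P) * (1 - ?P) = 1 - ?P" by (simp add: algebra_simps id_on_idem)
    show "S * T \<in> unit_alg"
      unfolding unit_alg_def mem_Collect_eq unit_alg_mult[OF S T] c d
      using mult_mem[OF memP[OF S] memP[OF T]] idem by (auto intro!: exI[of _ "c * d"])
    show "unit_nu (S * T) \<le> (D + 1) * (unit_nu S powr (1 - \<theta>) * norm S powr (q * \<theta>) * unit_nu T +
        unit_nu S * (unit_nu T powr (1 - \<theta>) * norm T powr (q * \<theta>)))"
    proof -
      let ?R = "unit_nu S powr (1 - \<theta>) * norm S powr (q * \<theta>) * unit_nu T +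
        unit_nu S * (unit_nu T powr (1 - \<theta>) * norm T powr (q * \<theta>))"
      have le: "nrm (U * ?P) powr q \<le> unit_nu U" "norm (U * (1 - ?P)) powr q \<le> unit_nu U"
        and nn: "0 \<le> unit_nu U" for U by (simp_all add: unit_nu_def)
      have le': "(nrm (U * ?P) powr q) powr (1 - \<theta>) \<le> unit_nu U powr (1 - \<theta>)"
        "(norm (U * (1 - ?P)) powr q) powr (1 - \<theta>) \<le> unit_nu U powr (1 - \<theta>)"
        "norm (U * ?P) powr (q * \<theta>) \<le> norm U powr (q * \<theta>)" "norm (U * (1 - ?P)) powr (q * \<theta>) \<le>
            norm U powr (q * \<theta>)" for U
        using \<theta> q_pos le norm_P by (auto intro!: powr_mono2)
      have "nrm ((S * ?P) * (T * ?P)) powr q \<le> D *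
          ((nrm (S * ?P) powr q) powr (1 - \<theta>) * norm (S * ?P) powr (q * \<theta>) * nrm (T * ?P) powr q +
            nrm (S * ?P) powr q * ((nrm (T * ?P) powr q) powr (1 - \<theta>) * norm (T * ?P) powr (q * \<theta>)))"
        by (intro diff memP S T)
      also have "\<dots> \<le> D * ?R"
        by (intro mult_left_mono less_imp_le[OF D] add_mono mult_mono le le' nn mult_nonneg_nonneg powr_ge_zero)
      finally have 1: "nrm (S * T * ?P) powr q \<le> D * ?R" unfolding unit_alg_mult(1)[OF S T] .
      let ?s = "norm (S * (1 - ?P)) powr q"
      have "norm (S * T * (1 - ?P)) powr q \<le> (norm (S * (1 - ?P)) * norm (T * (1 - ?P))) powr q"
        unfolding unit_alg_mult(2)[OF S T] using q_pos by (intro powr_mono2 norm_mult_ineq) auto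
      also have "\<dots> = ?s * norm (T * (1 - ?P)) powr q" by (simp add: powr_mult)
      \<comment> \<open>On the scalar block the contribution to \<open>unit_nu\<close> is the q-th
        power of the operator norm itself, so the exponents split exactly.\<close>
      also have "?s = ?s powr (1 - \<theta>) * norm (S * (1 - ?P)) powr (q * \<theta>)"
        by (simp add: powr_powr powr_add[symmetric] algebra_simps)
      also have "\<dots> * norm (T * (1 - ?P)) powr q \<le> unit_nu S powr (1 - \<theta>) * norm S powr (q * \<theta>) * unit_nu T"
        by (intro mult_mono le le' nn mult_nonneg_nonneg powr_ge_zero)
      also have "\<dots> \<le> ?R" by (simp add: nn)
      finally have 2: "norm (S * T * (1 - ?P)) powr q \<le> ?R" .
      show ?thesis using add_mono[OF 1 2] by (simp only: unit_nu_def[of "S * T"] distrib_right mult_1_left)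
    qed
  next
    fix Y assume Y: "\<And>n. Y n \<in> unit_alg" and sm: "summable (\<lambda>n. unit_nu (Y n))"
    have sm1: "summable (\<lambda>n. nrm (Y n * ?P) powr q)" and sm2: "summable (\<lambda>n. norm (Y n * (1 - ?P)) powr q)"
      by (rule summable_comparison_test'[OF sm, of 0]; simp add: unit_nu_def)+
    note ser = series_mem[OF memP[OF Y] sm1]
    have sY2: "summable (\<lambda>n. norm (Y n * (1 - ?P)))"
    proof (rule summable_comparison_test_ev[OF _ sm2])
      have "\<forall>\<^sub>F n in sequentially. norm (Y n * (1 - ?P)) powr q < 1"
        by (rule order_tendstoD(2)[OF summable_LIMSEQ_zero[OF sm2]]) simp
      then show "\<forall>\<^sub>F n in sequentially. norm (norm (Y n * (1 - ?P))) \<le> norm (Y n * (1 - ?P)) powr q"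
      proof eventually_elim
        case (elim n)
        let ?x = "norm (Y n * (1 - ?P))"
        have "?x \<le> 1"
        proof (rule ccontr)
          assume "\<not> ?x \<le> 1"
          then have "1 < ?x powr q" using q_pos by (intro gr_one_powr) auto
          then show False using elim by simp
        qed
        then have "?x powr 1 \<le> ?x powr q" using q_le_1 by (intro powr_mono') auto
        then show ?case by simp
      qed
    qed
    note sY2' = summable_norm_cancel[OF sY2]
    have "summable (\<lambda>n. Y n * ?P + Y n * (1 - ?P))" by (rule summable_add[OF ser(1) sY2'])
    then have sY: "summable Y" unfolding split[symmetric] .
    have sums: "suminf Y * ?P = (\<Sum>n. Y n * ?P)" "suminf Y * (1 - ?P) = (\<Sum>n. Y n * (1 - ?P))"
      by (rule suminf_mult2[OF sY])+
    have "\<exists>c. Y n * (1 - ?P) = c *\<^sub>R (1 - ?P)" for n using Y[of n] unfolding unit_alg_def by blast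
    then obtain c where c: "\<And>n. Y n * (1 - ?P) = c n *\<^sub>R (1 - ?P)" by metis
    have "\<exists>d. suminf Y * (1 - ?P) = d *\<^sub>R (1 - ?P)"
    \<comment> \<open>If the projection is 0, the scalars \<open>c n\<close> are arbitrary and need
      not be summable, but then any \<open>d\<close> works.\<close>
    proof (cases "1 - ?P = 0")
      case False
      have "summable c"
      proof (rule summable_norm_cancel)
        have "summable (\<lambda>n. norm (Y n * (1 - ?P)) / norm (1 - ?P))" by (rule summable_divide[OF sY2])
        then show "summable (\<lambda>n. norm (c n))" using False by (simp add: c)
      qed
      then show ?thesis unfolding sums(2) c using suminf_scaleR_left by metis
    qed simp
    then show "suminf Y \<in> unit_alg" using ser(2) sums(1) by (simp add: unit_alg_def)
    have "unit_nu (suminf Y) \<le> (\<Sum>n. nrm (Y n * ?P) powr q) + (\<Sum>n. norm (Y n * (1 - ?P)) powr q)"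
      unfolding unit_nu_def sums
      by (intro add_mono ser(3) norm_suminf_powr_le q_pos q_le_1 sY2' sm2)
    also have "\<dots> = (\<Sum>n. unit_nu (Y n))" unfolding unit_nu_def by (rule suminf_add[OF sm1 sm2])
    finally show "unit_nu (suminf Y) \<le> (\<Sum>n. unit_nu (Y n))" .
  qed (use q_pos q_le_1 \<theta> D in auto)
  then show ?thesis by blast
qed

end

section \<open>Extension of the data to the whole index set, and the theorem\<close>

lemma id_on_cancel:
  assumes "T \<in> ops_on G"
  shows "id_on G * T = T" "T * id_on G = T" "(1 - id_on G) * T = 0" "T * (1 - id_on G) = 0"
  using assms by (simp_all add: ops_on_iff left_diff_distrib right_diff_distrib)

lemma adj_ops_on: "T \<in> ops_on G \<Longrightarrow> adj T \<in> ops_on G"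
  unfolding ops_on_iff by (metis adj_id_on adj_simps(7))

text \<open>
  The identity \<open>1 - id_on G\<close> of the complementary subspace is added to the data with signs that keep
  the closed loop stable: \<open>A\<close>, \<open>X\<close>, \<open>Q\<close>, \<open>R\<close> become \<open>A - (1 -
  id_on G)\<close>, \<open>X + (1 - id_on G)\<close>,
  \<open>Q + 2 (1 - id_on G)\<close>, \<open>R + (1 - id_on G)\<close>.
\<close>

lemma riccati_on_extend:
  assumes mem: "A \<in> ops_on G" "X \<in> ops_on G" "N \<in> ops_on G" "Q \<in> ops_on G"
    and ric: "adj A * X + X * A - X * N * X + Q = 0" and Z: "Z = 1 - id_on G"
  shows "adj (A - Z) * (X + Z) + (X + Z) * (A - Z) - (X + Z) * N * (X + Z) + (Q + 2 *\<^sub>R Z) = 0"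
proof -
  have c: "Z * A = 0" "A * Z = 0" "Z * X = 0" "X * Z = 0" "Z * N = 0" "N * Z = 0" "Z * adj A = 0" "adj A * Z = 0"
    unfolding Z using id_on_cancel mem adj_ops_on by blast+
  have ZZ: "Z * Z = Z" "adj Z = Z" unfolding Z by (simp_all add: algebra_simps id_on_idem)
  have "X * N * Z = 0" by (simp add: mult.assoc c)
  then have "adj (A - Z) * (X + Z) + (X + Z) * (A - Z) - (X + Z) * N * (X + Z) + (Q + 2 *\<^sub>R Z) =
      adj A * X + X * A - X * N * X + Q"
    by (simp add: ZZ c algebra_simps scaleR_2)
  then show ?thesis using ric by simp
qed

theorem theorem9p2:
  fixes G :: "(int ^ 'd) set" and q :: real
    and \<A> :: "(int ^ 'd) ell2_op set" and nrm :: "(int ^ 'd) ell2_op \<Rightarrow> real"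
    and A B Q R X :: "(int ^ 'd) ell2_op"
  assumes "0 < q" "q \<le> 1"
    and "proper_q_banach_algebra_on G q \<A> nrm"
    and "A \<in> \<A>" "B \<in> \<A>" "Q \<in> \<A>" "R \<in> \<A>"
    and "positive_on G Q" "strictly_positive_on G R"
    and "approx_controllable_on G A B"
    and "exp_detectable_on G A (sqrt_on G Q)"
    and X: "strictly_positive_on G X" "riccati_on G A B Q R X"
  shows "(\<forall>Y. strictly_positive_on G Y \<and> riccati_on G A B Q R Y \<longrightarrow> Y = X) \<and>
    X \<in> \<A> \<and> exp_stable_on G \<A> nrm (A - B * inverse_on G R * adj B * X)"
proof -
  interpret proper_q_banach_algebra_on G q \<A> nrm by fact
  obtain \<theta> D where "star_subalgebra unit_alg unit_nu q \<theta> D" using star_subalgebra_unit_alg by blast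
  then interpret U: star_subalgebra unit_alg unit_nu q \<theta> D .
  define P where "P = id_on G"
  define Z where "Z = 1 - P"
  have PZ: "P * Z = 0" "Z * P = 0" "Z * Z = Z" "P * P = P" "adj Z = Z" "adj P = P" "P + Z = 1"
    by (simp_all add: Z_def P_def algebra_simps id_on_idem)
  have ops: "T \<in> ops_on G" if "T \<in> \<A>" for T using that subset_ops by blast
  have cancel: "P * T = T" "T * P = T" "Z * T = 0" "T * Z = 0" if "T \<in> ops_on G" for T
    using id_on_cancel[OF that] by (simp_all add: P_def Z_def)
  have unit_mem: "T + r *\<^sub>R Z \<in> unit_alg" if "T \<in> \<A>" for T r
    unfolding unit_alg_def P_def[symmetric] Z_def[symmetric]
    using that cancel[OF ops[OF that]] by (auto simp: distrib_right PZ)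
  have unit_mem': "T \<in> unit_alg" if "T \<in> \<A>" for T using unit_mem[OF that, of 0] by simp
  have unit_memD: "T \<in> \<A>" if "T + Z \<in> unit_alg" "T \<in> ops_on G" for T
    using that(1) cancel[OF that(2)] unfolding unit_alg_def P_def[symmetric] by (simp add: distrib_right PZ)

  note R = strictly_positive_on_inner[OF \<open>strictly_positive_on G R\<close>, folded P_def, folded Z_def]
  obtain \<rho> where \<rho>: "0 < \<rho>" "\<And>x. \<rho> * (norm x)\<^sup>2 \<le> inner ((R + Z) \<cdot> x) x" using R(3) by blast
  have RZ: "R + Z \<in> unit_alg" using unit_mem[OF \<open>R \<in> \<A>\<close>, of 1] by simp
  obtain S where S: "S \<in> unit_alg" "(R + Z) * S = 1" "S * (R + Z) = 1"
    using U.coercive_inverse_mem[OF RZ \<rho>] by blast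
  have adjS: "adj S = S"
  proof -
    have "adj S * (R + Z) = 1" using arg_cong[OF S(2), of adj] by (simp add: R PZ)
    then have "adj S * (R + Z) * S = S" by simp
    then show ?thesis using S(2) by (simp only: mult.assoc mult_1_right)
  qed
  \<comment> \<open>For \<open>v = S \<cdot> u\<close> the form of \<open>S\<close> at
    \<open>u\<close> is that of \<open>R + Z\<close> at \<open>v\<close>, which is at least
    \<open>\<rho>\<close> times the squared norm of \<open>v\<close>, and
    \<open>norm u \<le> norm (R + Z) * norm v\<close>. The added 1 keeps the denominator
    positive.\<close>
  define \<sigma> where "\<sigma> = \<rho> / (norm (R + Z) + 1)\<^sup>2"
  have pos: "0 < norm (R + Z) + 1" by (smt (verit) norm_ge_zero)
  have \<sigma>: "0 < \<sigma>" using \<rho> pos by (simp add: \<sigma>_def)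
  have S_coercive: "\<sigma> * (norm u)\<^sup>2 \<le> inner (S \<cdot> u) u" for u
  proof -
    have u: "(R + Z) \<cdot> S \<cdot> u = u" using S(2) by (metis app_simps(2,6))
    have "norm u \<le> norm (R + Z) * norm (S \<cdot> u)" using norm_app_le[of "R + Z" "S \<cdot> u"] unfolding u .
    also have "\<dots> \<le> (norm (R + Z) + 1) * norm (S \<cdot> u)" by (intro mult_right_mono) auto
    finally have "(norm u)\<^sup>2 \<le> ((norm (R + Z) + 1) * norm (S \<cdot> u))\<^sup>2" by (intro power_mono) auto
    then have "\<sigma> * (norm u)\<^sup>2 \<le> \<sigma> * ((norm (R + Z) + 1)\<^sup>2 * (norm (S \<cdot> u))\<^sup>2)"
      using \<sigma> by (simp add: power_mult_distrib)
    also have "\<dots> = \<rho> * (norm (S \<cdot> u))\<^sup>2" using pos by (simp add: \<sigma>_def)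
    also have "\<dots> \<le> inner (S \<cdot> u) u" using \<rho>(2)[of "S \<cdot> u"] unfolding u by (simp add: inner_commute)
    finally show ?thesis .
  qed
  have SP: "P * S = S * P" "S * P \<in> \<A>"
    using unit_alg_commute[OF S(1)] S(1) by (simp_all add: P_def unit_alg_def)
  \<comment> \<open>\<open>R + Z\<close> is block diagonal, so the inverse relative to
    \<open>id_on G\<close> is the block over \<open>G\<close> of the inverse on the whole
    space.\<close>
  have inv: "inverse_on G R = S * P"
    unfolding inverse_on_def P_def[symmetric]
  proof (rule the_equality)
    have PR: "(R + Z) * P = R" "P * (R + Z) = R" using cancel[OF R(2)] by (simp_all add: distrib_right distrib_left PZ)
    have 1: "R * (S * P) = P"
    proof -
      have "R * (S * P) = ((R + Z) * P) * (P * S)" by (simp only: PR SP)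
      also have "\<dots> = (R + Z) * (P * P * S)" by (simp only: mult.assoc)
      also have "\<dots> = (R + Z) * S * P" by (simp only: PZ SP mult.assoc)
      finally show ?thesis by (simp only: S mult_1_left)
    qed
    have 2: "S * P * R = P"
    proof -
      have "S * P * R = S * (P * R)" by (rule mult.assoc)
      also have "\<dots> = S * ((R + Z) * P)" by (simp only: PR cancel(1)[OF R(2)])
      also have "\<dots> = S * (R + Z) * P" by (rule mult.assoc[symmetric])
      finally show ?thesis by (simp only: S mult_1_left)
    qed
    show "S * P \<in> ops_on G \<and> R * (S * P) = P \<and> S * P * R = P" using 1 2 ops SP by simp
    fix S' assume S': "S' \<in> ops_on G \<and> R * S' = P \<and> S' * R = P"
    have "S' = S' * P" using S' cancel(2)[of S'] by simp
    also have "\<dots> = S' * R * (S * P)" by (simp only: 1 mult.assoc)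
    also have "\<dots> = S * P" using S' cancel[OF ops[OF SP(2)]] by simp
    finally show "S' = S * P" .
  qed
  define N where "N = B * inverse_on G R * adj B"
  \<comment> \<open>\<open>B\<close> absorbs the projection. This puts in place of the inverse over
    \<open>G\<close> an operator that is coercive on the whole space, as the Lyapunov argument
    requires.\<close>
  have N: "N = B * S * adj B"
  proof -
    have "N = (B * P) * S * adj B" unfolding N_def inv SP(1)[symmetric] by (simp only: mult.assoc)
    then show ?thesis by (simp only: cancel[OF ops[OF \<open>B \<in> \<A>\<close>]])
  qed
  have NA: "N \<in> \<A>" unfolding N_def inv by (intro mult_mem adj_mem SP \<open>B \<in> \<A>\<close>)
  have adjN: "adj N = N" unfolding N by (simp add: adjS mult.assoc)

  define C where "C = sqrt_on G Q"
  have C: "adj C = C" "C \<in> ops_on G" "C * C = Q"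
    using sqrt_on_square[OF \<open>positive_on G Q\<close>] positive_on_inner by (auto simp: C_def)
  obtain L where L: "L \<in> ops_on G" "exp_stable_on G (ops_on G) norm (A + L * C)"
    using \<open>exp_detectable_on G A (sqrt_on G Q)\<close> by (auto simp: exp_detectable_on_def C_def)
  \<comment> \<open>The square of \<open>C'\<close> is the extended weight
    \<open>Q + 2 *\<^sub>R Z\<close>, and \<open>L * Z = 0\<close> gives
    \<open>L * C' = L * C\<close>, so detectability carries over.\<close>
  define C' where "C' = C + sqrt 2 *\<^sub>R Z"
  have C': "adj C' = C'" "C' * C' = Q + 2 *\<^sub>R Z"
    using cancel[OF C(2)] by (simp_all add: C'_def C PZ distrib_left distrib_right)
  have "exp_decay (A + L * C - Z)" using exp_decay_shifted[OF L(2)] by (simp add: P_def Z_def)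
  then have det: "exp_decay ((A - Z) + L * C')"
    using cancel[OF L(1)] by (simp add: C'_def distrib_left algebra_simps)

  \<comment> \<open>Formulated for an arbitrary strictly positive solution, because uniqueness
    compares the closed loops of two of them.\<close>
  have solution: "Y \<in> ops_on G" "adj (Y + Z) = Y + Z"
      "adj (A - Z) * (Y + Z) + (Y + Z) * (A - Z) - (Y + Z) * N * (Y + Z) + (Q + 2 *\<^sub>R Z) = 0"
      "exp_decay ((A - Z) - N * (Y + Z))"
    if Y: "strictly_positive_on G Y" "riccati_on G A B Q R Y" for Y
  proof -
    note Y' = strictly_positive_on_inner[OF Y(1), folded P_def, folded Z_def]
    obtain c where c: "0 < c" "\<And>x. c * (norm x)\<^sup>2 \<le> inner ((Y + Z) \<cdot> x) x" using Y'(3) by blast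
    show "Y \<in> ops_on G" "adj (Y + Z) = Y + Z" using Y' by (simp_all add: PZ)
    have "adj A * Y + Y * A - Y * N * Y + Q = 0"
      using Y(2) by (simp add: riccati_on_def N_def mult.assoc)
    then show ric: "adj (A - Z) * (Y + Z) + (Y + Z) * (A - Z) - (Y + Z) * N * (Y + Z) + (Q + 2 *\<^sub>R Z) = 0"
      by (rule riccati_on_extend[OF ops[OF \<open>A \<in> \<A>\<close>] Y'(2) ops[OF NA] ops[OF \<open>Q \<in>
          \<A>\<close>]]) (simp add: Z_def P_def)
    show "exp_decay ((A - Z) - N * (Y + Z))"
      unfolding N using ric[unfolded N C'(2)[symmetric]] Y'(1) PZ
      by - (rule closed_loop_exp_decay[OF _ c \<sigma> S_coercive C'(1) _ det], simp_all)
  qed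

  have unique: "Y = X" if "strictly_positive_on G Y" "riccati_on G A B Q R Y" for Y
  proof -
    have "Y + Z = X + Z"
      using riccati_stabilizing_unique[OF solution(2-4)[OF X] solution(2-4)[OF that] adjN] .
    then show ?thesis by simp
  qed
  have XU: "X + Z \<in> unit_alg"
  proof (rule U.riccati_solution_mem[OF _ _ _ adjN solution(2-4)[OF X]])
    show "A - Z \<in> unit_alg" using unit_mem[OF \<open>A \<in> \<A>\<close>, of "-1"] by simp
  qed (intro unit_mem' NA unit_mem \<open>Q \<in> \<A>\<close>)+
  then have XA: "X \<in> \<A>" using unit_memD solution(1)[OF X] by blast

  define T where "T = A - N * X"
  have T: "T \<in> \<A>" unfolding T_def by (intro diff_mem mult_mem NA XA \<open>A \<in> \<A>\<close>)
  \<comment> \<open>\<open>N\<close> vanishes on the complement, so the extended closed loop is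
    \<open>T\<close> over \<open>G\<close> and -1 elsewhere.\<close>
  have TZ_eq: "(A - Z) - N * (X + Z) = T - Z"
    using cancel(4)[OF ops[OF NA]] by (simp add: T_def distrib_left)
  have "exp_decay (T - Z)" using solution(4)[OF X] unfolding TZ_eq .
  then obtain E \<alpha> where E: "0 < \<alpha>" "\<And>t. 0 \<le> t \<Longrightarrow> norm (exp (t *\<^sub>R (T - Z)))
      \<le> E * exp (- \<alpha> * t)"
    unfolding exp_decay_def by blast
  have TZ: "T - Z \<in> unit_alg" using unit_mem[OF T, of "-1"] by simp
  from U.nu_exp_decay[OF TZ E(2,1)] obtain E' \<alpha>' where E': "0 < E'" "0 < \<alpha>'"
    "\<And>t. 0 \<le> t \<Longrightarrow> exp (t *\<^sub>R (T - Z)) \<in> unit_alg"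
    "\<And>t. 0 \<le> t \<Longrightarrow> unit_nu (exp (t *\<^sub>R (T - Z))) \<le> E' * exp (- \<alpha>' * t)" by blast
  have "exp_stable_on G \<A> nrm T"
    unfolding exp_stable_on_def
  proof (intro conjI exI allI impI)
    show "T \<in> \<A>" by (rule T)
    \<comment> \<open>\<open>unit_nu\<close> measures q-th powers; taking the root changes the
      constant and the rate accordingly.\<close>
    show "0 < E' powr (1 / q)" "0 < \<alpha>' / q" using E' q_pos by simp_all
    fix t :: real assume t: "0 \<le> t"
    have e: "exp_on G (t *\<^sub>R T) = exp (t *\<^sub>R (T - Z)) * id_on G"
      using exp_shifted(1)[OF ops[OF T], of t] by (simp add: Z_def P_def)
    show m: "exp_on G (t *\<^sub>R T) \<in> \<A>" using E'(3)[OF t] unfolding e unit_alg_def by blast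
    have "nrm (exp_on G (t *\<^sub>R T)) powr q \<le> E' * exp (- \<alpha>' * t)"
      using E'(4)[OF t] unfolding e unit_nu_def by (smt (verit) powr_ge_zero)
    then have "(nrm (exp_on G (t *\<^sub>R T)) powr q) powr (1 / q) \<le> (E' * exp (- \<alpha>' * t)) powr (1 / q)"
      using q_pos by (intro powr_mono2) auto
    also have "\<dots> = E' powr (1 / q) * exp (- (\<alpha>' / q) * t)"
      using E' by (simp add: powr_mult) (simp add: powr_def)
    finally show "nrm (exp_on G (t *\<^sub>R T)) \<le> E' powr (1 / q) * exp (- (\<alpha>' / q) * t)"
      using nrm_nonneg[OF m] q_pos by (simp add: powr_powr)
  qed
  then show ?thesis using unique XA by (simp add: T_def N_def)
qed

end
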